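(* Let $D$ be the selfadjoint operator on $\mathcal{H}$ which is diagonal in the spinor basis, $$D|j\mu n\uparrow\rangle=d_j^\uparrow|j\mu n\uparrow\rangle,\qquad D|j\mu n\downarrow\rangle=d_j^\downarrow|j\mu n\downarrow\rangle,$$ with $d_j^\uparrow=c_1^\uparrow j+c_2^\uparrow$ and $d_j^\downarrow=c_1^\downarrow j+c_2^\downarrow$, where $c_1^\uparrow,c_2^\uparrow,c_1^\downarrow,c_2^\downarrow$ are real constants independent of $j$ with $c_1^\uparrow\neq 0$ and $$c_1^\downarrow=-c_1^\uparrow,\qquad c_2^\downarrow=-c_2^\uparrow+c_1^\uparrow .$$ Then $(\mathcal{A}(SU_q(2)),\mathcal{H},D)$, with $\mathcal{A}(SU_q(2))$ acting on $\mathcal{H}$ via $\pi'$, is a $3^+$-summable spectral triple.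
   Context: Fix a real number $q$ with $0<q<1$ and put $[n]=\frac{q^n-q^{-n}}{q-q^{-1}}$. $\mathcal{A}=\mathcal{A}(SU_q(2))$ is the unital complex $*$-algebra generated by $a,b$ with relations $ba=qab$, $b^*a=qab^*$, $bb^*=b^*b$, $a^*a+q^2b^*b=1$, $aa^*+bb^*=1$. For any index $x$ write $x^\pm=x\pm\frac12$. Let $\mathcal{H}_\psi$ be the Hilbert space with orthonormal basis $|lmn\rangle$, $l=0,\frac12,1,\frac32,\dots$, $m,n\in\{-l,-l+1,\dots,l\}$. The (left regular) $*$-representation $\pi$ of $\mathcal{A}$ on $\mathcal{H}_\psi$ is $$\pi(a)|lmn\rangle=A^+_{lmn}|l^+m^+n^+\rangle+A^-_{lmn}|l^-m^+n^+\rangle,\quad \pi(b)|lmn\rangle=B^+_{lmn}|l^+m^+n^-\rangle+B^-_{lmn}|l^-m^+n^-\rangle,$$ $$A^+_{lmn}=q^{(-2l+m+n-1)/2}\Big(\tfrac{[l+m+1][l+n+1]}{[2l+1][2l+2]}\Big)^{1/2},\quad A^-_{lmn}=q^{(2l+m+n+1)/2}\Big(\tfrac{[l-m][l-n]}{[2l][2l+1]}\Big)^{1/2},$$ $$B^+_{lmn}=q^{(m+n-1)/2}\Big(\tfrac{[l+m+1][l-n+1]}{[2l+1][2l+2]}\Big)^{1/2},\quad B^-_{lmn}=-q^{(m+n-1)/2}\Big(\tfrac{[l-m][l+n]}{[2l][2l+1]}\Big)^{1/2}$$ (terms with $l^-<0$ are absent). Let $\mathbb{C}^2$ have orthonormal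 basis $|\frac12,\pm\frac12\rangle$. The space of spinors is $\mathcal{H}=\mathcal{H}_\psi\otimes\mathbb{C}^2$, and $\pi'=\pi\otimes\mathrm{id}$. With $C_{j\mu}=q^{-(j+\mu)/2}\frac{[j-\mu]^{1/2}}{[2j]^{1/2}}$, $S_{j\mu}=q^{(j-\mu)/2}\frac{[j+\mu]^{1/2}}{[2j]^{1/2}}$, the orthonormal spinor basis of $\mathcal{H}$ is $$|j\mu n\downarrow\rangle=C_{j\mu}|j^-\mu^+n\rangle\otimes|\tfrac12,-\tfrac12\rangle+S_{j\mu}|j^-\mu^-n\rangle\otimes|\tfrac12,+\tfrac12\rangle$$ for $j=\frac12,1,\frac32,\dots$, $\mu=-j,\dots,j$, $n=-j^-,\dots,j^-$, and $$|j\mu n\uparrow\rangle=-S_{j+1,\mu}|j^+\mu^+n\rangle\otimes|\tfrac12,-\tfrac12\rangle+C_{j+1,\mu}|j^+\mu^-n\rangle\otimes|\tfrac12,+\tfrac12\rangle$$ for $j=0,\frac12,1,\dots$, $\mu=-j,\dots,j$, $n=-j^+,\dots,j^+$ (vectors with out-of-range indices occur with coefficient $0$). A spectral triple $(\mathcal{A},\mathcal{H},D)$ consists of a $*$-algebra represented by bounded operators on $\mathcal{H}$ and a selfadjoint operator $D$ with compact resolvent such that $[D,\pi'(x)]$ extends to a bounded operator for all $x\in\mathcal{A}$. It is $3^+$-summable if the singular values $\mu_n$ of $(1+D^2)^{-1/2}$ satisfy $\mu_n=O(n^{-1/3})$. *)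

theory Defs
  imports "HOL-Analysis.Analysis" "HOL-Algebra.Ring" "HOL-Library.Landau_Symbols"
begin

section \<open>Complex Hilbert spaces\<close>

text \<open>The inner product is conjugate linear in the first argument. Norm and topology are
  those of the real inner product \<open>inner x y = Re (cinner x y)\<close>.\<close>

class complex_hilbert = real_inner + complete_space +
  fixes scaleC :: "complex \<Rightarrow> 'a \<Rightarrow> 'a" (infixr \<open>*\<^sub>C\<close> 75)
    and cinner :: "'a \<Rightarrow> 'a \<Rightarrow> complex"
  assumes scaleC_add_right: "c *\<^sub>C (x + y) = c *\<^sub>C x + c *\<^sub>C y"
    and scaleC_add_left: "(c + d) *\<^sub>C x = c *\<^sub>C x + d *\<^sub>C x"
    and scaleC_scaleC: "c *\<^sub>C d *\<^sub>C x = (c * d) *\<^sub>C x"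
    and scaleC_one: "1 *\<^sub>C x = x"
    and scaleR_scaleC: "r *\<^sub>R x = complex_of_real r *\<^sub>C x"
    and cinner_commute: "cinner x y = cnj (cinner y x)"
    and cinner_add_right: "cinner x (y + z) = cinner x y + cinner x z"
    and cinner_scaleC_right: "cinner x (c *\<^sub>C y) = c * cinner x y"
    and inner_eq_Re_cinner: "inner x y = Re (cinner x y)"
begin

subclass banach ..

end

global_interpretation complex_vector:
  vector_space "scaleC :: complex \<Rightarrow> 'a \<Rightarrow> 'a::complex_hilbert"
  by standard (simp_all add: scaleC_add_right scaleC_add_left scaleC_scaleC scaleC_one)


section \<open>The Hilbert space with a given orthonormal basis\<close>

typedef 'i ell2 = "{f :: 'i \<Rightarrow> complex. (\<lambda>i. (cmod (f i))\<^sup>2) summable_on UNIV}"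
  morphisms ell2_coeff Abs_ell2
  by (rule exI[of _ "\<lambda>_. 0"]) simp

setup_lifting type_definition_ell2

lemma ell2_coeff_summable: "(\<lambda>i. (cmod (ell2_coeff x i))\<^sup>2) summable_on UNIV"
  using ell2_coeff by blast

lemma ell2_summable_add:
  assumes "(\<lambda>i. (cmod (f i))\<^sup>2) summable_on UNIV" "(\<lambda>i. (cmod (g i))\<^sup>2) summable_on UNIV"
  shows "(\<lambda>i. (cmod (f i + g i))\<^sup>2) summable_on UNIV"
proof (rule summable_on_comparison_test)
  show "(\<lambda>i. 2 * (cmod (f i))\<^sup>2 + 2 * (cmod (g i))\<^sup>2) summable_on UNIV"
    by (intro summable_on_add summable_on_cmult_right assms)
  show "(cmod (f i + g i))\<^sup>2 \<le> 2 * (cmod (f i))\<^sup>2 + 2 * (cmod (g i))\<^sup>2" for i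
  proof -
    have "(cmod (f i + g i))\<^sup>2 \<le> (cmod (f i) + cmod (g i))\<^sup>2"
      by (intro power_mono norm_triangle_ineq) auto
    also have "\<dots> \<le> 2 * (cmod (f i))\<^sup>2 + 2 * (cmod (g i))\<^sup>2"
      using sum_squares_bound[of "cmod (f i)" "cmod (g i)"] by (simp add: power2_sum)
    finally show ?thesis .
  qed
qed auto

lemma ell2_summable_mult:
  assumes "(\<lambda>i. (cmod (f i))\<^sup>2) summable_on UNIV"
  shows "(\<lambda>i. (cmod (c * f i))\<^sup>2) summable_on UNIV"
  using summable_on_cmult_right[OF assms, of "(cmod c)\<^sup>2"]
  by (simp add: norm_mult power_mult_distrib)

lemma ell2_summable_cnj_mult:
  assumes "(\<lambda>i. (cmod (f i))\<^sup>2) summable_on UNIV" "(\<lambda>i. (cmod (g i))\<^sup>2) summable_on UNIV"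
  shows "(\<lambda>i. cnj (f i) * g i) summable_on UNIV"
proof (rule abs_summable_summable, rule summable_on_comparison_test)
  show "(\<lambda>i. (cmod (f i))\<^sup>2 + (cmod (g i))\<^sup>2) summable_on UNIV"
    by (intro summable_on_add assms)
  show "cmod (cnj (f i) * g i) \<le> (cmod (f i))\<^sup>2 + (cmod (g i))\<^sup>2" for i
  proof -
    have "0 \<le> cmod (f i) * cmod (g i)" by simp
    then show ?thesis
      using sum_squares_bound[of "cmod (f i)" "cmod (g i)"]
      unfolding norm_mult complex_mod_cnj mult.assoc by linarith
  qed
qed auto

instantiation ell2 :: (type) real_inner
begin

lift_definition zero_ell2 :: "'a ell2" is "\<lambda>_. 0" by simp
lift_definition plus_ell2 :: "'a ell2 \<Rightarrow> 'a ell2 \<Rightarrow> 'a ell2" is "\<lambda>f g i. f i + g i"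
  by (rule ell2_summable_add)
lift_definition uminus_ell2 :: "'a ell2 \<Rightarrow> 'a ell2" is "\<lambda>f i. - f i" by simp
lift_definition minus_ell2 :: "'a ell2 \<Rightarrow> 'a ell2 \<Rightarrow> 'a ell2" is "\<lambda>f g i. f i - g i"
  using ell2_summable_add[where g = "\<lambda>i. - g i" for g] by fastforce
lift_definition scaleR_ell2 :: "real \<Rightarrow> 'a ell2 \<Rightarrow> 'a ell2" is "\<lambda>r f i. complex_of_real r * f i"
  by (rule ell2_summable_mult)

definition inner_ell2 :: "'a ell2 \<Rightarrow> 'a ell2 \<Rightarrow> real" where
  "inner_ell2 x y = Re (\<Sum>\<^sub>\<infinity>i. cnj (ell2_coeff x i) * ell2_coeff y i)"
definition norm_ell2 :: "'a ell2 \<Rightarrow> real" where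
  "norm_ell2 x = sqrt (inner x x)"
definition dist_ell2 :: "'a ell2 \<Rightarrow> 'a ell2 \<Rightarrow> real" where
  "dist_ell2 x y = norm (x - y)"
definition sgn_ell2 :: "'a ell2 \<Rightarrow> 'a ell2" where
  "sgn_ell2 x = inverse (norm x) *\<^sub>R x"
definition uniformity_ell2 :: "('a ell2 \<times> 'a ell2) filter" where
  "uniformity_ell2 = (INF e\<in>{0<..}. principal {(x, y). dist x y < e})"
definition open_ell2 :: "'a ell2 set \<Rightarrow> bool" where
  "open_ell2 U \<longleftrightarrow> (\<forall>x\<in>U. eventually (\<lambda>(x', y). x' = x \<longrightarrow> y \<in> U) uniformity)"

lemma cinner_summable: "(\<lambda>i. cnj (ell2_coeff x i) * ell2_coeff y i) summable_on UNIV"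
  by (intro ell2_summable_cnj_mult ell2_coeff_summable)

lemma ell2_eqI: "(\<And>i. ell2_coeff x i = ell2_coeff y i) \<Longrightarrow> x = y"
  by (simp add: ell2_coeff_inject[symmetric] fun_eq_iff)

lemmas ell2_rep_eqs = zero_ell2.rep_eq plus_ell2.rep_eq uminus_ell2.rep_eq minus_ell2.rep_eq
  scaleR_ell2.rep_eq

lemma ell2_inner_self: "inner (x :: 'a ell2) x = (\<Sum>\<^sub>\<infinity>i. (cmod (ell2_coeff x i))\<^sup>2)"
proof -
  have "(\<Sum>\<^sub>\<infinity>i. cnj (ell2_coeff x i) * ell2_coeff x i)
      = (\<Sum>\<^sub>\<infinity>i. complex_of_real ((cmod (ell2_coeff x i))\<^sup>2))"
    by (rule infsum_cong) (metis complex_norm_square mult.commute)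
  also have "\<dots> = complex_of_real (\<Sum>\<^sub>\<infinity>i. (cmod (ell2_coeff x i))\<^sup>2)"
    by (rule infsumI) (subst has_sum_of_real_iff, rule has_sum_infsum[OF ell2_coeff_summable])
  finally show ?thesis unfolding inner_ell2_def by simp
qed

lemma ell2_norm_eq: "norm (x :: 'a ell2) = sqrt (\<Sum>\<^sub>\<infinity>i. (cmod (ell2_coeff x i))\<^sup>2)"
  unfolding norm_ell2_def ell2_inner_self by simp

lemma ell2_norm_sq: "(norm (x :: 'a ell2))\<^sup>2 = (\<Sum>\<^sub>\<infinity>i. (cmod (ell2_coeff x i))\<^sup>2)"
  by (simp add: ell2_norm_eq infsum_nonneg)

lemma ell2_sum_le_norm:
  assumes "finite F"
  shows "(\<Sum>i\<in>F. (cmod (ell2_coeff (x :: 'a ell2) i))\<^sup>2) \<le> (norm x)\<^sup>2"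
  unfolding ell2_norm_sq
  by (rule finite_sum_le_infsum[OF ell2_coeff_summable assms]) auto

lemma ell2_coeff_le_norm: "cmod (ell2_coeff (x :: 'a ell2) i) \<le> norm x"
proof -
  have "(cmod (ell2_coeff x i))\<^sup>2 \<le> (norm x)\<^sup>2"
    using ell2_sum_le_norm[of "{i}" x] by simp
  then show ?thesis
    using power2_le_imp_le[of "cmod (ell2_coeff x i)" "norm x"]
    by (simp add: ell2_norm_eq infsum_nonneg)
qed

instance
proof
  fix x y z :: "'a ell2" and r s :: real
  show "x + y + z = x + (y + z)" by (rule ell2_eqI) (simp add: ell2_rep_eqs)
  show "x + y = y + x" by (rule ell2_eqI) (simp add: ell2_rep_eqs)
  show "0 + x = x" by (rule ell2_eqI) (simp add: ell2_rep_eqs)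
  show "- x + x = 0" by (rule ell2_eqI) (simp add: ell2_rep_eqs)
  show "x - y = x + - y" by (rule ell2_eqI) (simp add: ell2_rep_eqs)
  show "r *\<^sub>R (x + y) = r *\<^sub>R x + r *\<^sub>R y"
    by (rule ell2_eqI) (simp add: ell2_rep_eqs algebra_simps)
  show "(r + s) *\<^sub>R x = r *\<^sub>R x + s *\<^sub>R x"
    by (rule ell2_eqI) (simp add: ell2_rep_eqs algebra_simps)
  show "r *\<^sub>R s *\<^sub>R x = (r * s) *\<^sub>R x" by (rule ell2_eqI) (simp add: ell2_rep_eqs)
  show "1 *\<^sub>R x = x" by (rule ell2_eqI) (simp add: ell2_rep_eqs)
  show "dist x y = norm (x - y)" by (rule dist_ell2_def)
  show "sgn x = inverse (norm x) *\<^sub>R x" by (rule sgn_ell2_def)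
  show "uniformity = (INF e\<in>{0<..}. principal {(x, y :: 'a ell2). dist x y < e})"
    by (rule uniformity_ell2_def)
  show "norm x = sqrt (inner x x)" by (rule norm_ell2_def)
  show "open U = (\<forall>x\<in>U. eventually (\<lambda>(x', y). x' = x \<longrightarrow> y \<in> U) uniformity)"
    for U :: "'a ell2 set" by (rule open_ell2_def)
  have comm: "inner u v = inner v u" for u v :: "'a ell2"
  proof -
    have "(\<Sum>\<^sub>\<infinity>i. cnj (ell2_coeff u i) * ell2_coeff v i)
        = (\<Sum>\<^sub>\<infinity>i. cnj (cnj (ell2_coeff v i) * ell2_coeff u i))"
      by (simp add: mult.commute)
    then show ?thesis unfolding inner_ell2_def infsum_cnj by simp
  qed
  then show "inner x y = inner y x" .
  have "inner z (x + y) = inner z x + inner z y"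
    unfolding inner_ell2_def
    by (simp add: ell2_rep_eqs distrib_left infsum_add cinner_summable)
  then show "inner (x + y) z = inner x z + inner y z" by (simp only: comm[of _ z])
  have "(\<Sum>\<^sub>\<infinity>i. cnj (ell2_coeff y i) * ell2_coeff (r *\<^sub>R x) i)
      = (\<Sum>\<^sub>\<infinity>i. of_real r * (cnj (ell2_coeff y i) * ell2_coeff x i))"
    by (simp add: ell2_rep_eqs mult.left_commute)
  then have "inner y (r *\<^sub>R x) = r * inner y x"
    unfolding inner_ell2_def infsum_cmult_right' by simp
  then show "inner (r *\<^sub>R x) y = r * inner x y" by (simp only: comm[of _ y])
  show "0 \<le> inner x x" by (simp add: ell2_inner_self infsum_nonneg)
  show "(inner x x = 0) = (x = 0)"
  proof
    assume "inner x x = 0"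
    then have "cmod (ell2_coeff x i) \<le> 0" for i
      using ell2_coeff_le_norm[of x i] by (simp add: norm_ell2_def)
    then show "x = 0" by (intro ell2_eqI) (simp add: ell2_rep_eqs)
  next
    assume "x = 0" then show "inner x x = 0" by (simp add: ell2_inner_self ell2_rep_eqs)
  qed
qed

end

lemma ell2_complete:
  fixes X :: "nat \<Rightarrow> 'a ell2"
  assumes "\<forall>e>0. \<exists>M. \<forall>m\<ge>M. \<forall>n\<ge>M. norm (X m - X n) < e"
  shows "\<exists>L. \<forall>e>0. \<exists>M. \<forall>n\<ge>M. norm (X n - L) < e"
proof -
  have conv: "convergent (\<lambda>n. ell2_coeff (X n) i)" for i
  proof (rule Cauchy_convergent, rule metric_CauchyI)
    fix e :: real assume "e > 0"
    then obtain M where M: "\<And>m n. m \<ge> M \<Longrightarrow> n \<ge> M \<Longrightarrow> norm (X m - X n) < e"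
      using assms by blast
    have "dist (ell2_coeff (X m) i) (ell2_coeff (X n) i) < e" if "m \<ge> M" "n \<ge> M" for m n
      using M[OF that] ell2_coeff_le_norm[of "X m - X n" i]
      by (simp add: dist_norm minus_ell2.rep_eq)
    then show "\<exists>M. \<forall>m\<ge>M. \<forall>n\<ge>M. dist (ell2_coeff (X m) i) (ell2_coeff (X n) i) < e"
      by blast
  qed
  define f where "f i = lim (\<lambda>n. ell2_coeff (X n) i)" for i
  have f: "(\<lambda>n. ell2_coeff (X n) i) \<longlonglongrightarrow> f i" for i
    using conv unfolding f_def by (simp add: convergent_LIMSEQ_iff)
  have fin: "(\<Sum>i\<in>F. (cmod (ell2_coeff (X n) i - f i))\<^sup>2) \<le> e\<^sup>2"
    if e: "e > 0" and M: "\<And>m n. m \<ge> M \<Longrightarrow> n \<ge> M \<Longrightarrow> norm (X m - X n) < e"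
      and n: "n \<ge> M" and F: "finite F" for e M n F
  proof (rule LIMSEQ_le_const2)
    show "(\<lambda>m. \<Sum>i\<in>F. (cmod (ell2_coeff (X n) i - ell2_coeff (X m) i))\<^sup>2)
        \<longlonglongrightarrow> (\<Sum>i\<in>F. (cmod (ell2_coeff (X n) i - f i))\<^sup>2)"
      by (intro tendsto_intros f)
    have "(\<Sum>i\<in>F. (cmod (ell2_coeff (X n) i - ell2_coeff (X m) i))\<^sup>2) \<le> e\<^sup>2"
      if "m \<ge> M" for m
    proof -
      have "(\<Sum>i\<in>F. (cmod (ell2_coeff (X n) i - ell2_coeff (X m) i))\<^sup>2) \<le> (norm (X n - X m))\<^sup>2"
        using ell2_sum_le_norm[OF F, of "X n - X m"] by (simp add: minus_ell2.rep_eq)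
      also have "\<dots> \<le> e\<^sup>2"
        using M[OF n that] by (intro power_mono) (auto simp: ell2_norm_eq infsum_nonneg)
      finally show ?thesis .
    qed
    then show "\<exists>N. \<forall>m\<ge>N. (\<Sum>i\<in>F. (cmod (ell2_coeff (X n) i - ell2_coeff (X m) i))\<^sup>2) \<le> e\<^sup>2"
      by blast
  qed
  have summ: "(\<lambda>i. (cmod (ell2_coeff (X n) i - f i))\<^sup>2) summable_on UNIV"
    if e: "e > 0" and M: "\<And>m n. m \<ge> M \<Longrightarrow> n \<ge> M \<Longrightarrow> norm (X m - X n) < e"
      and n: "n \<ge> M" for e M n
    by (rule nonneg_bdd_above_summable_on) (auto intro!: bdd_aboveI2[where M = "e\<^sup>2"] fin[OF e M n])
  obtain M1 where M1: "\<And>m n. m \<ge> M1 \<Longrightarrow> n \<ge> M1 \<Longrightarrow> norm (X m - X n) < 1"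
    using assms zero_less_one by blast
  have "(\<lambda>i. (cmod (ell2_coeff (X M1) i + (- 1) * (ell2_coeff (X M1) i - f i)))\<^sup>2) summable_on UNIV"
    by (rule ell2_summable_add[OF ell2_coeff_summable],
        rule ell2_summable_mult, rule summ[OF zero_less_one M1]) auto
  then have fsum: "(\<lambda>i. (cmod (f i))\<^sup>2) summable_on UNIV" by simp
  define L where "L = Abs_ell2 f"
  have L: "ell2_coeff L i = f i" for i
    unfolding L_def using fsum by (subst Abs_ell2_inverse) auto
  show ?thesis
  proof (rule exI[of _ L], intro allI impI)
    fix e :: real assume "e > 0"
    then have e: "e / 2 > 0" by simp
    then obtain M where M: "\<And>m n. m \<ge> M \<Longrightarrow> n \<ge> M \<Longrightarrow> norm (X m - X n) < e / 2"
      using assms by blast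
    have "norm (X n - L) < e" if n: "n \<ge> M" for n
    proof -
      have "(\<Sum>i\<in>F. (cmod (ell2_coeff (X n - L) i))\<^sup>2) \<le> (e / 2)\<^sup>2" if "finite F" for F
        using fin[OF e M n that] by (simp only: minus_ell2.rep_eq L)
      then have "(norm (X n - L))\<^sup>2 \<le> (e / 2)\<^sup>2"
        unfolding ell2_norm_sq
        by (rule infsum_le_finite_sums[OF ell2_coeff_summable])
      then have "norm (X n - L) \<le> e / 2"
        using e by (auto intro: power2_le_imp_le less_imp_le)
      then show ?thesis using \<open>e > 0\<close> by linarith
    qed
    then show "\<exists>M. \<forall>n\<ge>M. norm (X n - L) < e" by blast
  qed
qed

instance ell2 :: (type) complete_space
proof
  fix X :: "nat \<Rightarrow> 'a ell2"
  assume "Cauchy X"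
  then have "\<forall>e>0. \<exists>M. \<forall>m\<ge>M. \<forall>n\<ge>M. norm (X m - X n) < e"
    by (simp add: Cauchy_def dist_norm)
  from ell2_complete[OF this] show "convergent X"
    by (simp add: convergent_def LIMSEQ_def dist_norm)
qed

instantiation ell2 :: (type) complex_hilbert
begin

lift_definition scaleC_ell2 :: "complex \<Rightarrow> 'a ell2 \<Rightarrow> 'a ell2" is "\<lambda>c f i. c * f i"
  by (rule ell2_summable_mult)

definition cinner_ell2 :: "'a ell2 \<Rightarrow> 'a ell2 \<Rightarrow> complex" where
  "cinner_ell2 x y = (\<Sum>\<^sub>\<infinity>i. cnj (ell2_coeff x i) * ell2_coeff y i)"

instance
proof
  fix x y z :: "'a ell2" and c d :: complex and r :: real
  show "c *\<^sub>C (x + y) = c *\<^sub>C x + c *\<^sub>C y"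
    by (rule ell2_eqI) (simp add: ell2_rep_eqs scaleC_ell2.rep_eq algebra_simps)
  show "(c + d) *\<^sub>C x = c *\<^sub>C x + d *\<^sub>C x"
    by (rule ell2_eqI) (simp add: ell2_rep_eqs scaleC_ell2.rep_eq algebra_simps)
  show "c *\<^sub>C d *\<^sub>C x = (c * d) *\<^sub>C x" by (rule ell2_eqI) (simp add: scaleC_ell2.rep_eq)
  show "1 *\<^sub>C x = x" by (rule ell2_eqI) (simp add: scaleC_ell2.rep_eq)
  show "r *\<^sub>R x = complex_of_real r *\<^sub>C x"
    by (rule ell2_eqI) (simp add: ell2_rep_eqs scaleC_ell2.rep_eq)
  show "cinner x y = cnj (cinner y x)"
    unfolding cinner_ell2_def infsum_cnj[symmetric] by (simp add: mult.commute)
  show "cinner x (y + z) = cinner x y + cinner x z"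
    unfolding cinner_ell2_def
    by (simp add: ell2_rep_eqs distrib_left infsum_add cinner_summable)
  show "cinner x (c *\<^sub>C y) = c * cinner x y"
    unfolding cinner_ell2_def infsum_cmult_right'[symmetric]
    by (simp add: scaleC_ell2.rep_eq mult.left_commute)
  show "inner x y = Re (cinner x y)" by (simp add: inner_ell2_def cinner_ell2_def)
qed

end

lift_definition ket :: "'i \<Rightarrow> 'i ell2" is "\<lambda>i k. if k = i then 1 else 0"
proof -
  fix i :: 'i
  have "(\<lambda>k. (cmod (if k = i then 1 else 0))\<^sup>2) summable_on UNIV \<longleftrightarrow> (\<lambda>_. 1 :: real) summable_on {i}"
    by (rule summable_on_cong_neutral) auto
  then show "(\<lambda>k. (cmod (if k = i then 1 else 0))\<^sup>2) summable_on UNIV" by simp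
qed

text \<open>\<open>'i ell2\<close> and \<open>'j ell2\<close> have the tensor product \<open>('i \<times> 'j) ell2\<close>.\<close>

lift_definition tensor :: "'i ell2 \<Rightarrow> 'j ell2 \<Rightarrow> ('i \<times> 'j) ell2" (infixr \<open>\<otimes>\<^sub>2\<close> 70)
  is "\<lambda>f g (i, j). f i * g j"
proof -
  fix f :: "'i \<Rightarrow> complex" and g :: "'j \<Rightarrow> complex"
  assume f: "(\<lambda>i. (cmod (f i))\<^sup>2) summable_on UNIV" and g: "(\<lambda>i. (cmod (g i))\<^sup>2) summable_on UNIV"
  have "(\<lambda>(i, j). (cmod (f i))\<^sup>2 * (cmod (g j))\<^sup>2) summable_on UNIV \<times> UNIV"
  proof (rule summable_on_SigmaI)
    show "((\<lambda>j. case (i, j) of (i, j) \<Rightarrow> (cmod (f i))\<^sup>2 * (cmod (g j))\<^sup>2)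
        has_sum (cmod (f i))\<^sup>2 * (\<Sum>\<^sub>\<infinity>j. (cmod (g j))\<^sup>2)) UNIV" for i
      unfolding prod.case by (intro has_sum_cmult_right has_sum_infsum g)
    show "(\<lambda>i. (cmod (f i))\<^sup>2 * (\<Sum>\<^sub>\<infinity>j. (cmod (g j))\<^sup>2)) summable_on UNIV"
      by (intro summable_on_cmult_left f)
  qed auto
  then show "(\<lambda>p. (cmod (case p of (i, j) \<Rightarrow> f i * g j))\<^sup>2) summable_on UNIV"
    by (simp add: case_prod_unfold norm_mult power_mult_distrib)
qed

text \<open>The bounded operator, if there is one, that maps each basis vector \<open>ket i\<close> to \<open>F i\<close>.\<close>

definition extend_basis :: "('i \<Rightarrow> 'h::complex_hilbert) \<Rightarrow> 'i ell2 \<Rightarrow> 'h" where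
  "extend_basis F x = (\<Sum>\<^sub>\<infinity>i. ell2_coeff x i *\<^sub>C F i)"

lemma extend_basis_ket: "extend_basis F (ket i) = F i"
proof -
  have "(\<Sum>\<^sub>\<infinity>k. ell2_coeff (ket i) k *\<^sub>C F k) = (\<Sum>\<^sub>\<infinity>k\<in>{i}. F k)"
    by (rule infsum_cong_neutral) (auto simp: ket.rep_eq scaleC_one)
  then show ?thesis by (simp add: extend_basis_def)
qed

definition tensor_op ::
  "('i ell2 \<Rightarrow> 'k ell2) \<Rightarrow> ('j ell2 \<Rightarrow> 'l ell2) \<Rightarrow> ('i \<times> 'j) ell2 \<Rightarrow> ('k \<times> 'l) ell2" where
  "tensor_op S T = extend_basis (\<lambda>(i, j). S (ket i) \<otimes>\<^sub>2 T (ket j))"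


section \<open>Operators on Hilbert spaces\<close>

definition bounded_clinear :: "('h::complex_hilbert \<Rightarrow> 'k::complex_hilbert) \<Rightarrow> bool" where
  "bounded_clinear T \<longleftrightarrow> bounded_linear T \<and> (\<forall>c x. T (c *\<^sub>C x) = c *\<^sub>C T x)"

definition cadjoint :: "('h::complex_hilbert \<Rightarrow> 'h) \<Rightarrow> 'h \<Rightarrow> 'h" where
  "cadjoint T = (THE S. \<forall>x y. cinner (S x) y = cinner x (T y))"

definition positive_op :: "('h::complex_hilbert \<Rightarrow> 'h) \<Rightarrow> bool" where
  "positive_op T \<longleftrightarrow> (\<forall>x. cinner x (T x) \<in> \<real> \<and> 0 \<le> Re (cinner x (T x)))"

definition compact_op :: "('h::complex_hilbert \<Rightarrow> 'h) \<Rightarrow> bool" where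
  "compact_op T \<longleftrightarrow> bounded_clinear T \<and> compact (closure (T ` cball 0 1))"

text \<open>\<open>s\<close> lists the singular values of the compact operator \<open>T\<close> (square roots of the
  eigenvalues of \<open>T\<^sup>*T\<close>) in decreasing order, each positive one repeated according to its
  multiplicity; if there are only finitely many positive ones, zeros follow.\<close>

definition singular_values :: "('h::complex_hilbert \<Rightarrow> 'h) \<Rightarrow> (nat \<Rightarrow> real) \<Rightarrow> bool" where
  "singular_values T s \<longleftrightarrow> compact_op T \<and> decseq s \<and> (\<forall>n. 0 \<le> s n) \<and>
     (\<forall>t>0. finite {n. s n = t} \<and>
        card {n. s n = t} = complex_vector.dim {x. cadjoint T (T x) = complex_of_real (t\<^sup>2) *\<^sub>C x})"

text \<open>Unbounded operators; \<open>app D\<close> is meaningful on \<open>dom D\<close> only.\<close>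

record 'h lin_op =
  dom :: "'h set"
  app :: "'h \<Rightarrow> 'h"

definition densely_defined :: "'h::complex_hilbert lin_op \<Rightarrow> bool" where
  "densely_defined D \<longleftrightarrow> complex_vector.subspace (dom D) \<and> closure (dom D) = UNIV \<and>
     (\<forall>x\<in>dom D. \<forall>y\<in>dom D. app D (x + y) = app D x + app D y) \<and>
     (\<forall>c. \<forall>x\<in>dom D. app D (c *\<^sub>C x) = c *\<^sub>C app D x)"

definition op_graph :: "'h lin_op \<Rightarrow> ('h \<times> 'h) set" where
  "op_graph D = {(x, app D x) |x. x \<in> dom D}"

definition adjoint_graph :: "'h::complex_hilbert lin_op \<Rightarrow> ('h \<times> 'h) set" where
  "adjoint_graph D = {(y, z). \<forall>x\<in>dom D. cinner (app D x) y = cinner x z}"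

definition selfadjoint :: "'h::complex_hilbert lin_op \<Rightarrow> bool" where
  "selfadjoint D \<longleftrightarrow> densely_defined D \<and> op_graph D = adjoint_graph D"

definition bounded_inverse :: "'h::complex_hilbert lin_op \<Rightarrow> ('h \<Rightarrow> 'h) \<Rightarrow> bool" where
  "bounded_inverse D R \<longleftrightarrow> bounded_clinear R \<and>
     (\<forall>x. R x \<in> dom D \<and> app D (R x) = x) \<and> (\<forall>x\<in>dom D. R (app D x) = x)"

definition minus_scalar :: "'h::complex_hilbert lin_op \<Rightarrow> complex \<Rightarrow> 'h lin_op" where
  "minus_scalar D z = \<lparr>dom = dom D, app = (\<lambda>x. app D x - z *\<^sub>C x)\<rparr>"

definition compact_resolvent :: "'h::complex_hilbert lin_op \<Rightarrow> bool" where
  "compact_resolvent D \<longleftrightarrow> (\<exists>z R. bounded_inverse (minus_scalar D z) R) \<and>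
     (\<forall>z R. bounded_inverse (minus_scalar D z) R \<longrightarrow> compact_op R)"

definition one_plus_square :: "'h::complex_hilbert lin_op \<Rightarrow> 'h lin_op" where
  "one_plus_square D =
     \<lparr>dom = {x \<in> dom D. app D x \<in> dom D}, app = (\<lambda>x. x + app D (app D x))\<rparr>"

text \<open>\<open>K = (1 + D\<^sup>2)\<^sup>-\<^sup>1\<^sup>/\<^sup>2\<close>, the positive square root of the bounded inverse.\<close>

definition inv_sqrt_one_plus_square :: "'h::complex_hilbert lin_op \<Rightarrow> ('h \<Rightarrow> 'h) \<Rightarrow> bool" where
  "inv_sqrt_one_plus_square D K \<longleftrightarrow>
     bounded_clinear K \<and> positive_op K \<and> bounded_inverse (one_plus_square D) (K \<circ> K)"

definition commutator_bounded :: "'h::complex_hilbert lin_op \<Rightarrow> ('h \<Rightarrow> 'h) \<Rightarrow> bool" where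
  "commutator_bounded D T \<longleftrightarrow> (\<forall>x\<in>dom D. T x \<in> dom D) \<and>
     (\<exists>B. bounded_clinear B \<and> (\<forall>x\<in>dom D. B x = app D (T x) - T (app D x)))"

text \<open>The operator with eigenvectors \<open>e k\<close> and eigenvalues \<open>d k\<close> on its maximal domain, for an
  orthonormal basis \<open>e\<close> indexed by \<open>K\<close>.\<close>

definition diagonal_op :: "'k set \<Rightarrow> ('k \<Rightarrow> 'h::complex_hilbert) \<Rightarrow> ('k \<Rightarrow> real) \<Rightarrow> 'h lin_op" where
  "diagonal_op K e d =
     \<lparr>dom = {x. (\<lambda>k. (d k)\<^sup>2 * (cmod (cinner (e k) x))\<^sup>2) summable_on K},
      app = (\<lambda>x. \<Sum>\<^sub>\<infinity>k\<in>K. (complex_of_real (d k) * cinner (e k) x) *\<^sub>C e k)\<rparr>"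


section \<open>Unital *-algebras and their representations\<close>

record 'a star_alg = "'a ring" +
  scal :: "complex \<Rightarrow> 'a \<Rightarrow> 'a"
  star :: "'a \<Rightarrow> 'a"

locale star_algebra = ring A for A :: "('a, 'm) star_alg_scheme" (structure) +
  assumes scal_closed: "x \<in> carrier A \<Longrightarrow> scal A c x \<in> carrier A"
    and scal_add_right: "\<lbrakk>x \<in> carrier A; y \<in> carrier A\<rbrakk> \<Longrightarrow> scal A c (x \<oplus> y) = scal A c x \<oplus> scal A c y"
    and scal_add_left: "x \<in> carrier A \<Longrightarrow> scal A (c + d) x = scal A c x \<oplus> scal A d x"
    and scal_scal: "x \<in> carrier A \<Longrightarrow> scal A c (scal A d x) = scal A (c * d) x"
    and scal_one: "x \<in> carrier A \<Longrightarrow> scal A 1 x = x"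
    and scal_mult_left: "\<lbrakk>x \<in> carrier A; y \<in> carrier A\<rbrakk> \<Longrightarrow> scal A c x \<otimes> y = scal A c (x \<otimes> y)"
    and scal_mult_right: "\<lbrakk>x \<in> carrier A; y \<in> carrier A\<rbrakk> \<Longrightarrow> x \<otimes> scal A c y = scal A c (x \<otimes> y)"
    and star_closed: "x \<in> carrier A \<Longrightarrow> star A x \<in> carrier A"
    and star_star: "x \<in> carrier A \<Longrightarrow> star A (star A x) = x"
    and star_add: "\<lbrakk>x \<in> carrier A; y \<in> carrier A\<rbrakk> \<Longrightarrow> star A (x \<oplus> y) = star A x \<oplus> star A y"
    and star_mult: "\<lbrakk>x \<in> carrier A; y \<in> carrier A\<rbrakk> \<Longrightarrow> star A (x \<otimes> y) = star A y \<otimes> star A x"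
    and star_scal: "x \<in> carrier A \<Longrightarrow> star A (scal A c x) = scal A (cnj c) (star A x)"

definition star_representation ::
  "('a, 'm) star_alg_scheme \<Rightarrow> ('a \<Rightarrow> 'h::complex_hilbert \<Rightarrow> 'h) \<Rightarrow> bool" where
  "star_representation A \<rho> \<longleftrightarrow>
     (\<forall>x\<in>carrier A. bounded_clinear (\<rho> x)) \<and>
     \<rho> \<one>\<^bsub>A\<^esub> = id \<and>
     (\<forall>x\<in>carrier A. \<forall>y\<in>carrier A. \<rho> (x \<oplus>\<^bsub>A\<^esub> y) = (\<lambda>v. \<rho> x v + \<rho> y v)) \<and>
     (\<forall>x\<in>carrier A. \<forall>y\<in>carrier A. \<rho> (x \<otimes>\<^bsub>A\<^esub> y) = \<rho> x \<circ> \<rho> y) \<and>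
     (\<forall>c. \<forall>x\<in>carrier A. \<rho> (scal A c x) = (\<lambda>v. c *\<^sub>C \<rho> x v)) \<and>
     (\<forall>x\<in>carrier A. \<forall>v w. cinner (\<rho> (star A x) v) w = cinner v (\<rho> x w))"

definition spectral_triple ::
  "('a, 'm) star_alg_scheme \<Rightarrow> ('a \<Rightarrow> 'h::complex_hilbert \<Rightarrow> 'h) \<Rightarrow> 'h lin_op \<Rightarrow> bool" where
  "spectral_triple A \<rho> D \<longleftrightarrow> star_algebra A \<and> star_representation A \<rho> \<and>
     selfadjoint D \<and> compact_resolvent D \<and> (\<forall>x\<in>carrier A. commutator_bounded D (\<rho> x))"

text \<open>\<open>p\<^sup>+\<close>-summability: the singular values of \<open>(1 + D\<^sup>2)\<^sup>-\<^sup>1\<^sup>/\<^sup>2\<close> are \<open>O(n\<^sup>-\<^sup>1\<^sup>/\<^sup>p)\<close>.\<close>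

definition plus_summable :: "real \<Rightarrow> 'h::complex_hilbert lin_op \<Rightarrow> bool" where
  "plus_summable p D \<longleftrightarrow>
     (\<exists>K s. inv_sqrt_one_plus_square D K \<and> singular_values K s \<and> s \<in> O(\<lambda>n. real n powr (- 1 / p)))"


section \<open>Unital *-algebras given by generators and relations\<close>

datatype 'g star_poly =
    Gen 'g
  | Scalar complex
  | Add "'g star_poly" "'g star_poly"
  | Mult "'g star_poly" "'g star_poly"
  | Star "'g star_poly"

text \<open>The least congruence that contains the relations \<open>R\<close> and makes the quotient a unital
  complex *-algebra, in which \<open>Scalar c\<close> represents \<open>c\<close> times the unit.\<close>

inductive star_cong :: "('g star_poly \<times> 'g star_poly) set \<Rightarrow> 'g star_poly \<Rightarrow> 'g star_poly \<Rightarrow> bool"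
  for R where
  rel: "(x, y) \<in> R \<Longrightarrow> star_cong R x y"
| refl: "star_cong R x x"
| sym: "star_cong R x y \<Longrightarrow> star_cong R y x"
| trans: "star_cong R x y \<Longrightarrow> star_cong R y z \<Longrightarrow> star_cong R x z"
| cong_Add: "star_cong R x x' \<Longrightarrow> star_cong R y y' \<Longrightarrow> star_cong R (Add x y) (Add x' y')"
| cong_Mult: "star_cong R x x' \<Longrightarrow> star_cong R y y' \<Longrightarrow> star_cong R (Mult x y) (Mult x' y')"
| cong_Star: "star_cong R x x' \<Longrightarrow> star_cong R (Star x) (Star x')"
| Add_assoc: "star_cong R (Add (Add x y) z) (Add x (Add y z))"
| Add_commute: "star_cong R (Add x y) (Add y x)"
| Add_zero: "star_cong R (Add (Scalar 0) x) x"
| Add_inverse: "star_cong R (Add (Mult (Scalar (- 1)) x) x) (Scalar 0)"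
| Mult_assoc: "star_cong R (Mult (Mult x y) z) (Mult x (Mult y z))"
| Mult_one: "star_cong R (Mult (Scalar 1) x) x"
| distrib_left: "star_cong R (Mult x (Add y z)) (Add (Mult x y) (Mult x z))"
| distrib_right: "star_cong R (Mult (Add x y) z) (Add (Mult x z) (Mult y z))"
| Scalar_add: "star_cong R (Add (Scalar c) (Scalar d)) (Scalar (c + d))"
| Scalar_mult: "star_cong R (Mult (Scalar c) (Scalar d)) (Scalar (c * d))"
| Scalar_central: "star_cong R (Mult (Scalar c) x) (Mult x (Scalar c))"
| Star_Star: "star_cong R (Star (Star x)) x"
| Star_Add: "star_cong R (Star (Add x y)) (Add (Star x) (Star y))"
| Star_Mult: "star_cong R (Star (Mult x y)) (Mult (Star y) (Star x))"
| Star_Scalar: "star_cong R (Star (Scalar c)) (Scalar (cnj c))"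

definition star_class :: "('g star_poly \<times> 'g star_poly) set \<Rightarrow> 'g star_poly \<Rightarrow> 'g star_poly set" where
  "star_class R x = {y. star_cong R x y}"

definition presented_star_alg :: "('g star_poly \<times> 'g star_poly) set \<Rightarrow> 'g star_poly set star_alg" where
  "presented_star_alg R =
     \<lparr>carrier = range (star_class R),
      mult = (\<lambda>X Y. \<Union>x\<in>X. \<Union>y\<in>Y. star_class R (Mult x y)),
      one = star_class R (Scalar 1),
      zero = star_class R (Scalar 0),
      add = (\<lambda>X Y. \<Union>x\<in>X. \<Union>y\<in>Y. star_class R (Add x y)),
      scal = (\<lambda>c X. \<Union>x\<in>X. star_class R (Mult (Scalar c) x)),
      star = (\<lambda>X. \<Union>x\<in>X. star_class R (Star x))\<rparr>"

lemma star_class_eq_iff: "star_class R x = star_class R y \<longleftrightarrow> star_cong R x y"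
  unfolding star_class_def by (blast intro: star_cong.refl star_cong.sym star_cong.trans)

lemma star_class_UN:
  assumes "\<And>y. star_cong R x y \<Longrightarrow> f y = f x"
  shows "(\<Union>y\<in>star_class R x. f y) = f x"
  using assms star_cong.refl[of R x] unfolding star_class_def by blast

lemma presented_star_alg_simps:
  "carrier (presented_star_alg R) = range (star_class R)"
  "\<one>\<^bsub>presented_star_alg R\<^esub> = star_class R (Scalar 1)"
  "\<zero>\<^bsub>presented_star_alg R\<^esub> = star_class R (Scalar 0)"
  "star_class R x \<otimes>\<^bsub>presented_star_alg R\<^esub> star_class R y = star_class R (Mult x y)"
  "star_class R x \<oplus>\<^bsub>presented_star_alg R\<^esub> star_class R y = star_class R (Add x y)"
  "scal (presented_star_alg R) c (star_class R x) = star_class R (Mult (Scalar c) x)"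
  "star (presented_star_alg R) (star_class R x) = star_class R (Star x)"
proof -
  have 2: "(\<Union>x'\<in>star_class R x. \<Union>y'\<in>star_class R y. star_class R (g x' y')) = star_class R (g x y)"
    if "\<And>x x' y y'. star_cong R x x' \<Longrightarrow> star_cong R y y' \<Longrightarrow> star_cong R (g x y) (g x' y')" for g
  proof -
    have "(\<Union>y'\<in>star_class R y. star_class R (g x' y')) = star_class R (g x' y)" for x'
      by (rule star_class_UN, unfold star_class_eq_iff)
         (blast intro: that star_cong.refl star_cong.sym)
    moreover have "(\<Union>x'\<in>star_class R x. star_class R (g x' y)) = star_class R (g x y)"
      by (rule star_class_UN, unfold star_class_eq_iff)
         (blast intro: that star_cong.refl star_cong.sym)
    ultimately show ?thesis by simp
  qed
  have 1: "(\<Union>x'\<in>star_class R x. star_class R (g x')) = star_class R (g x)"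
    if "\<And>x x'. star_cong R x x' \<Longrightarrow> star_cong R (g x) (g x')" for g
    by (rule star_class_UN, unfold star_class_eq_iff) (blast intro: that star_cong.sym)
  show
    "carrier (presented_star_alg R) = range (star_class R)"
    "\<one>\<^bsub>presented_star_alg R\<^esub> = star_class R (Scalar 1)"
    "\<zero>\<^bsub>presented_star_alg R\<^esub> = star_class R (Scalar 0)"
    "star_class R x \<otimes>\<^bsub>presented_star_alg R\<^esub> star_class R y = star_class R (Mult x y)"
    "star_class R x \<oplus>\<^bsub>presented_star_alg R\<^esub> star_class R y = star_class R (Add x y)"
    "scal (presented_star_alg R) c (star_class R x) = star_class R (Mult (Scalar c) x)"
    "star (presented_star_alg R) (star_class R x) = star_class R (Star x)"
    unfolding presented_star_alg_def
    by (simp_all add: 1 2 star_cong.refl star_cong.cong_Add star_cong.cong_Mult star_cong.cong_Star)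
qed

lemma presented_star_algebra: "star_algebra (presented_star_alg R)"
proof -
  let ?A = "presented_star_alg R"
  note simps = presented_star_alg_simps star_class_eq_iff
  have Mult_one': "star_cong R (Mult x (Scalar 1)) x" for x
    using star_cong.Scalar_central star_cong.Mult_one star_cong.sym star_cong.trans by blast
  have scal_right: "star_cong R (Mult x (Mult (Scalar c) y)) (Mult (Scalar c) (Mult x y))" for c x y
  proof -
    have "star_cong R (Mult x (Mult (Scalar c) y)) (Mult (Mult x (Scalar c)) y)"
      by (rule star_cong.sym) (rule star_cong.Mult_assoc)
    also have "star_cong R \<dots> (Mult (Mult (Scalar c) x) y)"
      by (intro star_cong.cong_Mult star_cong.sym[OF star_cong.Scalar_central] star_cong.refl)
    also (star_cong.trans) have "star_cong R \<dots> (Mult (Scalar c) (Mult x y))"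
      by (rule star_cong.Mult_assoc)
    finally (star_cong.trans) show ?thesis .
  qed
  have star_scal: "star_cong R (Star (Mult (Scalar c) x)) (Mult (Scalar (cnj c)) (Star x))" for c x
  proof -
    have "star_cong R (Star (Mult (Scalar c) x)) (Mult (Star x) (Star (Scalar c)))"
      by (rule star_cong.Star_Mult)
    also have "star_cong R \<dots> (Mult (Star x) (Scalar (cnj c)))"
      by (intro star_cong.cong_Mult star_cong.Star_Scalar star_cong.refl)
    also (star_cong.trans) have "star_cong R \<dots> (Mult (Scalar (cnj c)) (Star x))"
      by (rule star_cong.sym) (rule star_cong.Scalar_central)
    finally (star_cong.trans) show ?thesis .
  qed
  have scal_add: "star_cong R (Mult (Scalar (c + d)) x) (Add (Mult (Scalar c) x) (Mult (Scalar d) x))" for c d x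
    by (meson star_cong.cong_Mult star_cong.Scalar_add star_cong.refl star_cong.sym star_cong.trans
        star_cong.distrib_right)
  have scal_scal: "star_cong R (Mult (Scalar c) (Mult (Scalar d) x)) (Mult (Scalar (c * d)) x)" for c d x
    by (meson star_cong.cong_Mult star_cong.Scalar_mult star_cong.refl star_cong.sym star_cong.trans
        star_cong.Mult_assoc)
  have "abelian_group ?A"
  proof (rule abelian_groupI)
    fix x assume "x \<in> carrier ?A"
    then show "\<exists>y\<in>carrier ?A. y \<oplus>\<^bsub>?A\<^esub> x = \<zero>\<^bsub>?A\<^esub>"
      using star_cong.Add_inverse by (fastforce simp: simps)
  qed (auto simp: simps star_cong.Add_assoc star_cong.Add_commute star_cong.Add_zero intro!: rangeI del: equalityI)
  moreover have "monoid ?A"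
    by (rule monoidI) (auto simp: simps star_cong.Mult_assoc star_cong.Mult_one Mult_one' intro!: rangeI del: equalityI)
  ultimately have "Ring.ring ?A"
    by (rule ringI)
       (auto simp: simps star_cong.distrib_left star_cong.distrib_right intro!: rangeI del: equalityI)
  then show ?thesis
    by (rule star_algebra.intro, unfold_locales)
       (auto simp: simps star_cong.distrib_left star_cong.Mult_one star_cong.Mult_assoc
         star_cong.Star_Star star_cong.Star_Add star_cong.Star_Mult
         scal_right star_scal scal_add scal_scal intro!: rangeI del: equalityI)
qed

fun star_eval :: "('g \<Rightarrow> 'h::complex_hilbert \<Rightarrow> 'h) \<Rightarrow> 'g star_poly \<Rightarrow> 'h \<Rightarrow> 'h" where
  "star_eval \<phi> (Gen g) = \<phi> g"
| "star_eval \<phi> (Scalar c) = (\<lambda>v. c *\<^sub>C v)"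
| "star_eval \<phi> (Add x y) = (\<lambda>v. star_eval \<phi> x v + star_eval \<phi> y v)"
| "star_eval \<phi> (Mult x y) = star_eval \<phi> x \<circ> star_eval \<phi> y"
| "star_eval \<phi> (Star x) = cadjoint (star_eval \<phi> x)"

text \<open>The representation of a presented *-algebra that extends \<open>\<phi>\<close>. If the operators \<open>\<phi> g\<close>
  are bounded and satisfy the relations, then \<open>star_eval \<phi>\<close> is constant on each class \<open>X\<close>.\<close>

definition induced_rep :: "('g \<Rightarrow> 'h::complex_hilbert \<Rightarrow> 'h) \<Rightarrow> 'g star_poly set \<Rightarrow> 'h \<Rightarrow> 'h" where
  "induced_rep \<phi> X = the_elem (star_eval \<phi> ` X)"


section \<open>The algebra of the quantum group SU_q(2) and its left regular representation\<close>

datatype suq2_gen = gen_a | gen_b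

definition suq2_relations :: "real \<Rightarrow> (suq2_gen star_poly \<times> suq2_gen star_poly) set" where
  "suq2_relations q =
     (let a = Gen gen_a; b = Gen gen_b; q' = complex_of_real q in
      {(Mult b a, Mult (Scalar q') (Mult a b)),
       (Mult (Star b) a, Mult (Scalar q') (Mult a (Star b))),
       (Mult b (Star b), Mult (Star b) b),
       (Add (Mult (Star a) a) (Mult (Scalar (q'\<^sup>2)) (Mult (Star b) b)), Scalar 1),
       (Add (Mult a (Star a)) (Mult b (Star b)), Scalar 1)})"

definition A_SUq2 :: "real \<Rightarrow> suq2_gen star_poly set star_alg" where
  "A_SUq2 q = presented_star_alg (suq2_relations q)"

definition qnum :: "real \<Rightarrow> real \<Rightarrow> real" where
  "qnum q x = (q powr x - q powr (- x)) / (q - inverse q)"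

typedef lmn = "{(l :: real, m :: real, n :: real).
    2 * l \<in> \<nat> \<and> l + m \<in> \<nat> \<and> l - m \<in> \<nat> \<and> l + n \<in> \<nat> \<and> l - n \<in> \<nat>}"
  by (rule exI[of _ "(0, 0, 0)"]) simp

text \<open>The basis vector \<open>|lmn\<rangle>\<close>, or \<open>0\<close> if the indices are out of range.\<close>

definition ket_lmn :: "real \<Rightarrow> real \<Rightarrow> real \<Rightarrow> lmn ell2" where
  "ket_lmn l m n = (if (l, m, n) \<in> range Rep_lmn then ket (Abs_lmn (l, m, n)) else 0)"

definition A_plus :: "real \<Rightarrow> real \<Rightarrow> real \<Rightarrow> real \<Rightarrow> real" where
  "A_plus q l m n = q powr ((- 2 * l + m + n - 1) / 2) *
     sqrt (qnum q (l + m + 1) * qnum q (l + n + 1) / (qnum q (2 * l + 1) * qnum q (2 * l + 2)))"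

definition A_minus :: "real \<Rightarrow> real \<Rightarrow> real \<Rightarrow> real \<Rightarrow> real" where
  "A_minus q l m n = q powr ((2 * l + m + n + 1) / 2) *
     sqrt (qnum q (l - m) * qnum q (l - n) / (qnum q (2 * l) * qnum q (2 * l + 1)))"

definition B_plus :: "real \<Rightarrow> real \<Rightarrow> real \<Rightarrow> real \<Rightarrow> real" where
  "B_plus q l m n = q powr ((m + n - 1) / 2) *
     sqrt (qnum q (l + m + 1) * qnum q (l - n + 1) / (qnum q (2 * l + 1) * qnum q (2 * l + 2)))"

definition B_minus :: "real \<Rightarrow> real \<Rightarrow> real \<Rightarrow> real \<Rightarrow> real" where
  "B_minus q l m n = - (q powr ((m + n - 1) / 2)) *
     sqrt (qnum q (l - m) * qnum q (l + n) / (qnum q (2 * l) * qnum q (2 * l + 1)))"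

fun pi_gen :: "real \<Rightarrow> suq2_gen \<Rightarrow> lmn ell2 \<Rightarrow> lmn ell2" where
  "pi_gen q gen_a = extend_basis (\<lambda>i. case Rep_lmn i of (l, m, n) \<Rightarrow>
       complex_of_real (A_plus q l m n) *\<^sub>C ket_lmn (l + 1/2) (m + 1/2) (n + 1/2)
     + complex_of_real (A_minus q l m n) *\<^sub>C ket_lmn (l - 1/2) (m + 1/2) (n + 1/2))"
| "pi_gen q gen_b = extend_basis (\<lambda>i. case Rep_lmn i of (l, m, n) \<Rightarrow>
       complex_of_real (B_plus q l m n) *\<^sub>C ket_lmn (l + 1/2) (m + 1/2) (n - 1/2)
     + complex_of_real (B_minus q l m n) *\<^sub>C ket_lmn (l - 1/2) (m + 1/2) (n - 1/2))"

definition pi_rep :: "real \<Rightarrow> suq2_gen star_poly set \<Rightarrow> lmn ell2 \<Rightarrow> lmn ell2" where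
  "pi_rep q = induced_rep (pi_gen q)"


section \<open>Spinors and the Dirac operator\<close>

text \<open>\<open>spin ell2\<close> is the two-dimensional space with orthonormal basis
  \<open>ket Plus = |1/2, 1/2\<rangle>\<close>, \<open>ket Minus = |1/2, -1/2\<rangle>\<close>.\<close>

datatype spin = Minus | Plus

type_synonym spinors = "(lmn \<times> spin) ell2"

definition spinor_rep :: "real \<Rightarrow> suq2_gen star_poly set \<Rightarrow> spinors \<Rightarrow> spinors" where
  "spinor_rep q X = tensor_op (pi_rep q X) id"

definition C_coeff :: "real \<Rightarrow> real \<Rightarrow> real \<Rightarrow> real" where
  "C_coeff q j \<mu> = q powr (- (j + \<mu>) / 2) * sqrt (qnum q (j - \<mu>)) / sqrt (qnum q (2 * j))"

definition S_coeff :: "real \<Rightarrow> real \<Rightarrow> real \<Rightarrow> real" where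
  "S_coeff q j \<mu> = q powr ((j - \<mu>) / 2) * sqrt (qnum q (j + \<mu>)) / sqrt (qnum q (2 * j))"

datatype arrow = Up | Down

fun spinor :: "real \<Rightarrow> arrow \<times> real \<times> real \<times> real \<Rightarrow> spinors" where
  "spinor q (Down, j, \<mu>, n) =
       complex_of_real (C_coeff q j \<mu>) *\<^sub>C (ket_lmn (j - 1/2) (\<mu> + 1/2) n \<otimes>\<^sub>2 ket Minus)
     + complex_of_real (S_coeff q j \<mu>) *\<^sub>C (ket_lmn (j - 1/2) (\<mu> - 1/2) n \<otimes>\<^sub>2 ket Plus)"
| "spinor q (Up, j, \<mu>, n) =
       complex_of_real (- S_coeff q (j + 1) \<mu>) *\<^sub>C (ket_lmn (j + 1/2) (\<mu> + 1/2) n \<otimes>\<^sub>2 ket Minus)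
     + complex_of_real (C_coeff q (j + 1) \<mu>) *\<^sub>C (ket_lmn (j + 1/2) (\<mu> - 1/2) n \<otimes>\<^sub>2 ket Plus)"

text \<open>For \<open>Down\<close>, the bounds \<open>-(j - 1/2) \<le> n \<le> j - 1/2\<close> force \<open>j \<ge> 1/2\<close>.\<close>

definition spinor_index :: "(arrow \<times> real \<times> real \<times> real) set" where
  "spinor_index =
     {(Down, j, \<mu>, n) |j \<mu> n. 2 * j \<in> \<nat> \<and> j + \<mu> \<in> \<nat> \<and> j - \<mu> \<in> \<nat> \<and>
        (j - 1/2) + n \<in> \<nat> \<and> (j - 1/2) - n \<in> \<nat>} \<union>
     {(Up, j, \<mu>, n) |j \<mu> n. 2 * j \<in> \<nat> \<and> j + \<mu> \<in> \<nat> \<and> j - \<mu> \<in> \<nat> \<and>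
        (j + 1/2) + n \<in> \<nat> \<and> (j + 1/2) - n \<in> \<nat>}"

definition dirac :: "real \<Rightarrow> real \<Rightarrow> real \<Rightarrow> real \<Rightarrow> real \<Rightarrow> spinors lin_op" where
  "dirac q c1_up c2_up c1_down c2_down =
     diagonal_op spinor_index (spinor q)
       (\<lambda>(s, j, \<mu>, n). case s of Up \<Rightarrow> c1_up * j + c2_up | Down \<Rightarrow> c1_down * j + c2_down)"

end

theory Submission
  imports Defs
begin

text \<open>The hypotheses on the constants mean that \<open>D = F L\<close>, where \<open>L\<close> is multiplication by
  \<open>c\<^sub>1 (l - 1/2) + c\<^sub>2\<close> and \<open>F\<close> is \<open>1\<close> on up and \<open>- 1\<close> on down spinors. A generator changes \<open>l\<close> by
  \<open>\<plusminus>1/2\<close>, so within the up and within the down spinors the matrix elements of its commutator with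
  \<open>D\<close> are bounded. Between up and down spinors the eigenvalues differ by \<open>O(l)\<close>, but there the
  matrix elements of the generators either vanish or are \<open>O(q\<^sup>l)\<close>. All matrices have a bounded number
  of nonzero entries in each row and column, so bounds on the entries suffice for boundedness.
  Operators with bounded commutator form a *-algebra, hence the generators suffice. There are
  \<open>O(r\<^sup>3)\<close> spinors with eigenvalue of modulus at most \<open>r\<close>, which gives the compact resolvent and the
  decay of the singular values.\<close>

section \<open>Complex Hilbert spaces\<close>

text \<open>Two kinds of cancellation carry the proof. Applied to a ket, each defining relation of
  the algebra compares the coefficients of kets with \<open>l\<close> changed by 1, 0 and -1; the
  outer ones agree or cancel term by term, the middle ones reduce to identities between q-numbers.
  The relation \<open>aa* + bb* = 1\<close> also says that four squares add up to 1, which bounds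
  all coefficients and hence the generators. For fixed \<open>l\<close>, \<open>\<mu>\<close>,
  \<open>n\<close> the up and down spinors arise from two kets by a rotation with entries
  \<open>C\<close>, \<open>S\<close>. Of the four kinds of entries that mix arrows, two vanish
  exactly, and in the other two a difference of q-numbers collapses to one power of
  \<open>q\<close>; the decay then follows from bounds at the extremal \<open>m\<close>. A bound on
  the matrix of the formal commutator does not by itself show that a generator preserves the domain
  of \<open>D\<close>. Explicit adjoints are carried along for this purpose: symmetry of
  \<open>D\<close> gives the statement for the adjoint and then for the generator. The basis is
  enumerated by increasing modulus of the eigenvalue, so the singular values come out sorted and
  their decay is read off from the counting function.\<close>

lemma cinner_add_left: "cinner (x + y) (z::'a::complex_hilbert) = cinner x z + cinner y z"
  by (metis cinner_add_right cinner_commute complex_cnj_add)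

lemma cinner_scaleC_left: "cinner (c *\<^sub>C x) (y::'a::complex_hilbert) = cnj c * cinner x y"
  by (metis cinner_scaleC_right cinner_commute complex_cnj_mult)

lemma scaleC_minus_one: "(-1) *\<^sub>C (x::'a::complex_hilbert) = - x"
  using scaleR_scaleC[of "-1" x] by simp

lemma scaleC_zero_left [simp]: "0 *\<^sub>C (x::'a::complex_hilbert) = 0"
  using scaleR_scaleC[of "0" x] by simp

lemma scaleC_zero_right [simp]: "c *\<^sub>C (0::'a::complex_hilbert) = 0"
  using scaleC_add_right[of c 0 "0::'a"] by simp

lemma cinner_zero_right [simp]: "cinner (x::'a::complex_hilbert) 0 = 0"
  using cinner_add_right[of x 0 0] by simp

lemma cinner_zero_left [simp]: "cinner 0 (x::'a::complex_hilbert) = 0"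
  using cinner_add_left[of 0 0 x] by simp

lemma cinner_minus_right: "cinner (x::'a::complex_hilbert) (- y) = - cinner x y"
  using cinner_scaleC_right[of x "-1" y] by (simp add: scaleC_minus_one)

lemma cinner_diff_right: "cinner (x::'a::complex_hilbert) (y - z) = cinner x y - cinner x z"
  using cinner_add_right[of x y "- z"] by (simp add: cinner_minus_right)

lemma cinner_self: "cinner (x::'a::complex_hilbert) x = complex_of_real ((norm x)\<^sup>2)"
proof -
  have "Re (cinner x x) = (norm x)\<^sup>2"
    by (metis inner_eq_Re_cinner power2_norm_eq_inner)
  moreover have "Im (cinner x x) = 0"
    using arg_cong[OF cinner_commute[of x x], of Im] by simp
  ultimately show ?thesis by (simp add: complex_eq_iff)
qed

lemma norm_scaleC: "norm (c *\<^sub>C (x::'a::complex_hilbert)) = cmod c * norm x"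
proof -
  have "complex_of_real ((norm (c *\<^sub>C x))\<^sup>2) = (c * cnj c) * complex_of_real ((norm x)\<^sup>2)"
    unfolding cinner_self[symmetric] by (simp add: cinner_scaleC_right cinner_scaleC_left)
  also have "\<dots> = complex_of_real ((cmod c * norm x)\<^sup>2)"
    by (simp add: complex_norm_square[symmetric] power_mult_distrib del: of_real_power)
  finally have "(norm (c *\<^sub>C x))\<^sup>2 = (cmod c * norm x)\<^sup>2"
    by (simp only: of_real_eq_iff)
  then show ?thesis by (simp add: power2_eq_iff_nonneg)
qed

lemma cinner_eqI:
  assumes "\<And>y. cinner y (x::'a::complex_hilbert) = cinner y x'"
  shows "x = x'"
proof -
  have "cinner (x - x') (x - x') = 0" using assms by (simp add: cinner_diff_right)
  then show ?thesis by (simp add: cinner_self)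
qed

lemma cmod_cinner_le: "cmod (cinner x (y::'a::complex_hilbert)) \<le> norm x * norm y"
proof -
  let ?c = "cinner x y"
  \<comment> \<open>The phase \<open>u\<close> turns the inner product into its modulus, so that the
    real Cauchy-Schwarz inequality applies. If the inner product is 0, so is \<open>u\<close>, as
    \<open>sgn 0 = 0\<close>.\<close>
  define u where "u = cnj (sgn ?c)"
  have "cinner x (u *\<^sub>C y) = complex_of_real (cmod ?c)"
  proof (cases "?c = 0")
    case False
    have "cnj ?c * ?c = complex_of_real ((cmod ?c)\<^sup>2)"
      by (metis complex_norm_square mult.commute)
    then show ?thesis using False
      by (simp add: cinner_scaleC_right u_def sgn_div_norm scaleR_conv_of_real field_simps power2_eq_square)
  qed (simp add: cinner_scaleC_right)
  then have "cmod ?c = inner x (u *\<^sub>C y)" by (simp add: inner_eq_Re_cinner)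
  also have "\<dots> \<le> norm x * norm (u *\<^sub>C y)" by (rule norm_cauchy_schwarz)
  also have "\<dots> \<le> norm x * norm y"
    by (simp add: norm_scaleC u_def norm_sgn)
  finally show ?thesis .
qed

lemma bounded_clinearI:
  assumes "\<And>x y. T (x + y) = T x + T y" "\<And>c x. T (c *\<^sub>C x) = c *\<^sub>C T x"
    and "\<And>x. norm (T x) \<le> norm x * K"
  shows "bounded_clinear (T :: 'a::complex_hilbert \<Rightarrow> 'b::complex_hilbert)"
  unfolding bounded_clinear_def
proof (intro conjI allI assms(2))
  show "bounded_linear T"
    by (rule bounded_linear_intro[where K = K]) (auto simp: assms scaleR_scaleC)
qed

lemma bounded_clinear_scaleC: "bounded_clinear (\<lambda>x::'a::complex_hilbert. c *\<^sub>C x)"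
  by (rule bounded_clinearI[where K = "cmod c"])
    (auto simp: scaleC_add_right scaleC_scaleC norm_scaleC mult.commute)

lemma bounded_clinear_imp_bounded_linear [dest]: "bounded_clinear T \<Longrightarrow> bounded_linear T"
  by (simp add: bounded_clinear_def)

lemma bounded_clinear_simps:
  assumes "bounded_clinear T"
  shows "T (x + y) = T x + T y" "T (c *\<^sub>C x) = c *\<^sub>C T x" "T 0 = 0" "T (x - y) = T x - T y"
    "T (r *\<^sub>R x) = r *\<^sub>R T x" "T (sum f A) = (\<Sum>i\<in>A. T (f i))" "T (- x) = - T x"
proof -
  have "linear T" using assms by (auto simp: bounded_clinear_def bounded_linear.linear)
  then show "T (x + y) = T x + T y" "T 0 = 0" "T (x - y) = T x - T y"
    "T (r *\<^sub>R x) = r *\<^sub>R T x" "T (sum f A) = (\<Sum>i\<in>A. T (f i))" "T (- x) = - T x"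
    by (rule linear_add linear_0 linear_diff linear_scale linear_sum linear_neg)+
  show "T (c *\<^sub>C x) = c *\<^sub>C T x" using assms by (simp add: bounded_clinear_def)
qed

lemma bounded_clinear_add:
  "bounded_clinear S \<Longrightarrow> bounded_clinear T \<Longrightarrow> bounded_clinear (\<lambda>x. S x + T x)"
  by (simp add: bounded_clinear_def bounded_linear_add scaleC_add_right)

lemma bounded_clinear_compose:
  "bounded_clinear S \<Longrightarrow> bounded_clinear T \<Longrightarrow> bounded_clinear (S \<circ> T)"
  by (simp add: bounded_clinear_def bounded_linear_compose o_def)

lemma bounded_clinear_id: "bounded_clinear id"
  by (simp add: bounded_clinear_def id_def)

text \<open>Adjointability of every operator used here is witnessed by an explicit adjoint, so that no
  form of the Riesz representation theorem is needed.\<close>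

definition adjoint_pair :: "('h::complex_hilbert \<Rightarrow> 'k::complex_hilbert) \<Rightarrow> ('k \<Rightarrow> 'h) \<Rightarrow> bool" where
  "adjoint_pair T S \<longleftrightarrow> bounded_clinear T \<and> bounded_clinear S \<and>
     (\<forall>x y. cinner (S x) y = cinner x (T y))"

lemma adjoint_pairD:
  assumes "adjoint_pair T S"
  shows "bounded_clinear T" "bounded_clinear S" "cinner (S x) y = cinner x (T y)"
    "cinner (T y) x = cinner y (S x)"
proof -
  show "bounded_clinear T" "bounded_clinear S" and *: "cinner (S x) y = cinner x (T y)" for x y
    using assms by (auto simp: adjoint_pair_def)
  show "cinner (T y) x = cinner y (S x)"
    using *[of x y] cinner_commute by metis
qed

lemma adjoint_pair_sym: "adjoint_pair T S \<Longrightarrow> adjoint_pair S T"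
  using adjoint_pairD(4) unfolding adjoint_pair_def by blast

text \<open>An adjoint is unique, because a vector is determined by its inner products; so the
  description in \<open>cadjoint\<close> resolves to any adjoint that is exhibited.\<close>

lemma cadjoint_eqI:
  assumes "adjoint_pair T S"
  shows "cadjoint T = S"
  unfolding cadjoint_def
proof (rule the_equality)
  show "\<forall>x y. cinner (S x) y = cinner x (T y)" using assms by (simp add: adjoint_pair_def)
  fix S' assume "\<forall>x y. cinner (S' x) y = cinner x (T y)"
  then have "cinner y (S' x) = cinner y (S x)" for x y
    using adjoint_pairD(3)[OF assms, of x y] cinner_commute by metis
  then show "S' = S" by (intro ext cinner_eqI)
qed

lemma adjoint_pair_add:
  assumes "adjoint_pair T S" "adjoint_pair T' S'"
  shows "adjoint_pair (\<lambda>x. T x + T' x) (\<lambda>x. S x + S' x)"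
  using assms by (auto simp: adjoint_pair_def bounded_clinear_add cinner_add_left cinner_add_right)

lemma adjoint_pair_compose:
  assumes "adjoint_pair T S" "adjoint_pair T' S'"
  shows "adjoint_pair (T \<circ> T') (S' \<circ> S)"
  using assms by (auto simp: adjoint_pair_def bounded_clinear_compose)

lemma adjoint_pair_scaleC: "adjoint_pair (\<lambda>x::'a::complex_hilbert. c *\<^sub>C x) (\<lambda>x. cnj c *\<^sub>C x)"
  by (auto simp: adjoint_pair_def bounded_clinear_scaleC cinner_scaleC_left cinner_scaleC_right)


section \<open>Operators given by band matrices\<close>

lemma cinner_ket: "cinner (ket i) x = ell2_coeff x i"
proof -
  have "cinner (ket i) x = (\<Sum>\<^sub>\<infinity>k\<in>{i}. ell2_coeff x k)"
    unfolding cinner_ell2_def by (rule infsum_cong_neutral) (auto simp: ket.rep_eq)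
  then show ?thesis by simp
qed

lemma ell2_coeff_simps [simp]:
  "ell2_coeff (x + y) i = ell2_coeff x i + ell2_coeff y i"
  "ell2_coeff (x - y) i = ell2_coeff x i - ell2_coeff y i"
  "ell2_coeff (c *\<^sub>C x) i = c * ell2_coeff x i"
  "ell2_coeff (r *\<^sub>R x) i = of_real r * ell2_coeff x i"
  "ell2_coeff 0 i = 0"
  "ell2_coeff (- x) i = - ell2_coeff x i"
  by (simp_all add: ell2_rep_eqs scaleC_ell2.rep_eq)

lemma ell2_coeff_sum: "ell2_coeff (sum f A) i = (\<Sum>k\<in>A. ell2_coeff (f k) i)"
  by (induction A rule: infinite_finite_induct) auto

lemma ell2_coeff_ket: "ell2_coeff (ket i) k = (if k = i then 1 else 0)"
  by (simp add: ket.rep_eq)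

text \<open>The partial sum over \<open>F\<close> keeps the coefficients in \<open>F\<close> and
  drops the others, so its squared distance from \<open>x\<close> is the tail of a convergent series
  of squares.\<close>

lemma ket_has_sum: "((\<lambda>i. ell2_coeff x i *\<^sub>C ket i) has_sum (x :: 'i ell2)) UNIV"
proof -
  define P where "P F = (\<Sum>i\<in>F. ell2_coeff x i *\<^sub>C ket i)" for F
  have coeff_P: "ell2_coeff (P F) i = (if i \<in> F then ell2_coeff x i else 0)" if "finite F" for F i
    using that by (simp add: P_def ell2_coeff_sum ell2_coeff_ket if_distrib sum.delta cong: if_cong)
  have dist: "(norm (P F - x))\<^sup>2 = (norm x)\<^sup>2 - (\<Sum>i\<in>F. (cmod (ell2_coeff x i))\<^sup>2)" if "finite F" for F
  proof -
    have "(norm (P F - x))\<^sup>2 + (\<Sum>i\<in>F. (cmod (ell2_coeff x i))\<^sup>2)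
       = (\<Sum>\<^sub>\<infinity>i\<in>UNIV - F. (cmod (ell2_coeff x i))\<^sup>2) + (\<Sum>\<^sub>\<infinity>i\<in>F. (cmod (ell2_coeff x i))\<^sup>2)"
      unfolding ell2_norm_sq using that
      by (intro arg_cong2[of _ _ _ _ "(+)"] infsum_cong_neutral) (auto simp: coeff_P)
    also have "\<dots> = (\<Sum>\<^sub>\<infinity>i\<in>(UNIV - F) \<union> F. (cmod (ell2_coeff x i))\<^sup>2)"
      using that ell2_coeff_summable[of x]
      by (intro infsum_Un_disjoint[symmetric]) (auto intro: summable_on_subset_banach)
    finally show ?thesis by (simp add: ell2_norm_sq)
  qed
  have "((\<lambda>F. (norm x)\<^sup>2 - (\<Sum>i\<in>F. (cmod (ell2_coeff x i))\<^sup>2)) \<longlongrightarrow> (norm x)\<^sup>2 - (norm x)\<^sup>2)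
      (finite_subsets_at_top UNIV)"
    using has_sum_infsum[OF ell2_coeff_summable[of x]]
    by (intro tendsto_diff tendsto_const) (simp add: has_sum_def ell2_norm_sq)
  then have "((\<lambda>F. (norm (P F - x))\<^sup>2) \<longlongrightarrow> 0) (finite_subsets_at_top UNIV)"
    by (subst tendsto_cong[where g = "\<lambda>F. (norm x)\<^sup>2 - (\<Sum>i\<in>F. (cmod (ell2_coeff x i))\<^sup>2)"])
      (auto intro!: eventually_finite_subsets_at_top_weakI simp: dist)
  then have "((\<lambda>F. sqrt ((norm (P F - x))\<^sup>2)) \<longlongrightarrow> sqrt 0) (finite_subsets_at_top UNIV)"
    by (rule tendsto_real_sqrt)
  then have "((\<lambda>F. P F - x) \<longlongrightarrow> 0) (finite_subsets_at_top UNIV)"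
    by (simp add: tendsto_norm_zero_iff)
  then show ?thesis
    unfolding has_sum_def P_def[symmetric] by (simp add: LIM_zero_iff)
qed

text \<open>Only real linearity is available here, because the lemma also serves for functionals
  with values in \<open>complex\<close>, which is not made an instance of
  \<open>complex_hilbert\<close>; hence agreement is asked for all complex multiples of
  kets.\<close>

lemma bounded_linear_eq_on_kets:
  fixes f g :: "'i ell2 \<Rightarrow> 'b::real_normed_vector"
  assumes "bounded_linear f" "bounded_linear g" "\<And>c i. f (c *\<^sub>C ket i) = g (c *\<^sub>C ket i)"
  shows "f = g"
proof
  fix x
  have "((f \<circ> (\<lambda>i. ell2_coeff x i *\<^sub>C ket i)) has_sum f x) UNIV"
    "((g \<circ> (\<lambda>i. ell2_coeff x i *\<^sub>C ket i)) has_sum g x) UNIV"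
    using has_sum_bounded_linear[OF _ ket_has_sum[of x]] assms(1,2) unfolding o_def by blast+
  then show "f x = g x" using assms(3) by (simp add: o_def has_sum_unique)
qed

lemma bounded_clinear_eq_on_kets:
  assumes "bounded_clinear S" "bounded_clinear T" "\<And>i. S (ket i) = T (ket i)"
  shows "S = T"
  by (rule bounded_linear_eq_on_kets) (use assms in \<open>auto simp: bounded_clinear_simps\<close>)

text \<open>\<open>extend_basis\<close> is an infinite sum whose convergence is not clear for
  arbitrary \<open>F\<close>. An operator with the right values on kets settles it: by continuity it
  passes through the expansion of \<open>x\<close>.\<close>

lemma extend_basis_eq:
  assumes "bounded_clinear T" "\<And>i. T (ket i) = F i"
  shows "extend_basis F = T"
proof
  fix x
  have "((T \<circ> (\<lambda>i. ell2_coeff x i *\<^sub>C ket i)) has_sum T x) UNIV"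
    using has_sum_bounded_linear[OF _ ket_has_sum[of x], of T] assms(1) by (auto simp: o_def)
  then have "((\<lambda>i. ell2_coeff x i *\<^sub>C F i) has_sum T x) UNIV"
    using assms by (simp add: o_def bounded_clinear_simps)
  then show "extend_basis F x = T x" unfolding extend_basis_def by (rule infsumI)
qed

lemma bounded_linear_cinner_right: "bounded_linear (\<lambda>y::'a::complex_hilbert. cinner x y)"
  by (rule bounded_linear_intro[where K = "norm x"])
    (auto simp: cinner_add_right cinner_scaleC_right scaleR_scaleC scaleR_conv_of_real
      cmod_cinner_le mult.commute[of "norm _" "norm x"])

text \<open>The matrix relation extends by density in one variable at a time. Since
  \<open>cinner\<close> is conjugate linear in its first slot, both density arguments run in the
  second slot.\<close>

lemma adjoint_pairI_ket:
  assumes T: "bounded_clinear T" and S: "bounded_clinear S"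
    and M: "\<And>i k. ell2_coeff (S (ket k)) i = cnj (ell2_coeff (T (ket i)) k)"
  shows "adjoint_pair T S"
proof -
  note comp = bounded_linear_compose[OF bounded_linear_cinner_right]
  have 1: "cinner (ket i) (S y) = cinner (T (ket i)) y" for i y
  proof -
    have "(\<lambda>y. cinner (ket i) (S y)) = (\<lambda>y. cinner (T (ket i)) y)"
    proof (rule bounded_linear_eq_on_kets)
      show "bounded_linear (\<lambda>y. cinner (ket i) (S y))" using S by (intro comp) auto
      show "cinner (ket i) (S (c *\<^sub>C ket k)) = cinner (T (ket i)) (c *\<^sub>C ket k)" for c k
        using cinner_commute[of "T (ket i)" "ket k"]
        by (simp add: bounded_clinear_simps[OF S] cinner_scaleC_right cinner_ket M)
    qed (rule bounded_linear_cinner_right)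
    then show ?thesis by (rule fun_cong)
  qed
  have "cinner (S y) x = cinner y (T x)" for x y
  proof -
    have "(\<lambda>x. cinner (S y) x) = (\<lambda>x. cinner y (T x))"
    proof (rule bounded_linear_eq_on_kets)
      show "bounded_linear (\<lambda>x. cinner y (T x))" using T by (intro comp) auto
      show "cinner (S y) (c *\<^sub>C ket k) = cinner y (T (c *\<^sub>C ket k))" for c k
        using cinner_commute[of "S y" "ket k"] cinner_commute[of "y" "T (ket k)"]
        by (simp add: bounded_clinear_simps[OF T] cinner_scaleC_right 1)
    qed (rule bounded_linear_cinner_right)
    then show ?thesis by (rule fun_cong)
  qed
  then show ?thesis using S T by (simp add: adjoint_pair_def)
qed


text \<open>A Schur-type estimate: Cauchy-Schwarz in each row costs a factor \<open>N\<close>, and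
  exchanging the order of summation costs another, since each coefficient of \<open>x\<close> enters
  at most \<open>N\<close> rows. The resulting norm bound is \<open>N * C\<close>.\<close>

lemma band_bounded_clinear:
  fixes M :: "'k \<Rightarrow> 'i \<Rightarrow> complex"
  assumes bound: "\<And>k i. cmod (M k i) \<le> C"
    and rows: "\<And>k. finite {i. M k i \<noteq> 0}" "\<And>k. card {i. M k i \<noteq> 0} \<le> N"
    and cols: "\<And>i. finite {k. M k i \<noteq> 0}" "\<And>i. card {k. M k i \<noteq> 0} \<le> N"
  shows "\<exists>T. bounded_clinear T \<and>
    (\<forall>x k. ell2_coeff (T x) k = (\<Sum>i | M k i \<noteq> 0. M k i * ell2_coeff x i))"
proof -
  have C: "0 \<le> C" using bound[of undefined undefined] norm_ge_zero order_trans by blast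
  define f where "f x k = (\<Sum>i | M k i \<noteq> 0. M k i * ell2_coeff x i)" for x k
  have f_le: "(cmod (f x k))\<^sup>2 \<le> N * C\<^sup>2 * (\<Sum>i | M k i \<noteq> 0. (cmod (ell2_coeff x i))\<^sup>2)" for x k
  proof -
    have "cmod (f x k) \<le> (\<Sum>i | M k i \<noteq> 0. C * cmod (ell2_coeff x i))"
      unfolding f_def
      by (rule order_trans[OF norm_sum], rule sum_mono) (auto simp: norm_mult intro!: mult_right_mono bound)
    then have "(cmod (f x k))\<^sup>2 \<le> (\<Sum>i | M k i \<noteq> 0. C * cmod (ell2_coeff x i))\<^sup>2"
      by (intro power_mono) auto
    also have "\<dots> \<le> (\<Sum>i | M k i \<noteq> 0. C\<^sup>2) * (\<Sum>i | M k i \<noteq> 0. (cmod (ell2_coeff x i))\<^sup>2)"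
      by (rule Cauchy_Schwarz_ineq_sum)
    also have "\<dots> \<le> (N * C\<^sup>2) * (\<Sum>i | M k i \<noteq> 0. (cmod (ell2_coeff x i))\<^sup>2)"
      using rows(2)[of k] by (intro mult_right_mono sum_nonneg) (auto intro!: mult_right_mono)
    finally show ?thesis .
  qed
  have sum_le: "(\<Sum>k\<in>F. (cmod (f x k))\<^sup>2) \<le> (N * C * norm x)\<^sup>2" if F: "finite F" for F x
  proof -
    \<comment> \<open>Only the finitely many columns met by the rows in \<open>F\<close> matter, so
      the sums to be exchanged are finite.\<close>
    define I where "I = (\<Union>k\<in>F. {i. M k i \<noteq> 0})"
    have I: "finite I" using F rows by (auto simp: I_def)
    have "(\<Sum>k\<in>F. \<Sum>i | M k i \<noteq> 0. (cmod (ell2_coeff x i))\<^sup>2)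
        = (\<Sum>k\<in>F. \<Sum>i\<in>I. if M k i \<noteq> 0 then (cmod (ell2_coeff x i))\<^sup>2 else 0)"
      using I by (intro sum.cong sum.mono_neutral_cong_left) (auto simp: I_def)
    also have "\<dots> = (\<Sum>i\<in>I. \<Sum>k\<in>F. if M k i \<noteq> 0 then (cmod (ell2_coeff x i))\<^sup>2 else 0)"
      by (rule sum.swap)
    also have "\<dots> \<le> (\<Sum>i\<in>I. N * (cmod (ell2_coeff x i))\<^sup>2)"
    proof (rule sum_mono)
      fix i
      have "(\<Sum>k\<in>F. if M k i \<noteq> 0 then (cmod (ell2_coeff x i))\<^sup>2 else 0)
          = card {k\<in>F. M k i \<noteq> 0} * (cmod (ell2_coeff x i))\<^sup>2"
        using F by (simp add: sum.inter_filter[symmetric])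
      also have "card {k\<in>F. M k i \<noteq> 0} \<le> card {k. M k i \<noteq> 0}"
        by (rule card_mono) (use cols in auto)
      then have "card {k\<in>F. M k i \<noteq> 0} * (cmod (ell2_coeff x i))\<^sup>2 \<le> N * (cmod (ell2_coeff x i))\<^sup>2"
        using cols(2)[of i] by (intro mult_right_mono) auto
      finally show "(\<Sum>k\<in>F. if M k i \<noteq> 0 then (cmod (ell2_coeff x i))\<^sup>2 else 0)
          \<le> N * (cmod (ell2_coeff x i))\<^sup>2" .
    qed
    also have "\<dots> \<le> N * (norm x)\<^sup>2"
      unfolding sum_distrib_left[symmetric] by (intro mult_left_mono ell2_sum_le_norm I) auto
    finally have *: "(\<Sum>k\<in>F. \<Sum>i | M k i \<noteq> 0. (cmod (ell2_coeff x i))\<^sup>2) \<le> N * (norm x)\<^sup>2" .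
    have "(\<Sum>k\<in>F. (cmod (f x k))\<^sup>2)
        \<le> N * C\<^sup>2 * (\<Sum>k\<in>F. \<Sum>i | M k i \<noteq> 0. (cmod (ell2_coeff x i))\<^sup>2)"
      unfolding sum_distrib_left by (intro sum_mono) (use f_le in \<open>simp add: sum_distrib_left\<close>)
    also have "\<dots> \<le> N * C\<^sup>2 * (N * (norm x)\<^sup>2)" by (intro mult_left_mono *) auto
    finally show ?thesis by (simp add: power2_eq_square ac_simps)
  qed
  have summ: "(\<lambda>k. (cmod (f x k))\<^sup>2) summable_on UNIV" for x
    by (rule nonneg_bdd_above_summable_on)
      (auto intro!: bdd_aboveI2[where M = "(N * C * norm x)\<^sup>2"] sum_le)
  define T where "T x = Abs_ell2 (f x)" for x
  have T: "ell2_coeff (T x) k = f x k" for x k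
    unfolding T_def using summ[of x] by (subst Abs_ell2_inverse) auto
  have "bounded_clinear T"
  proof (rule bounded_clinearI)
    show "T (x + y) = T x + T y" for x y
      by (rule ell2_eqI) (simp add: T f_def algebra_simps sum.distrib)
    show "T (c *\<^sub>C x) = c *\<^sub>C T x" for c x
      by (rule ell2_eqI) (simp add: T f_def sum_distrib_left ac_simps)
    show "norm (T x) \<le> norm x * (N * C)" for x
    proof -
      have "(norm (T x))\<^sup>2 \<le> (N * C * norm x)\<^sup>2"
        unfolding ell2_norm_sq T by (rule infsum_le_finite_sums[OF summ]) (rule sum_le)
      then have "norm (T x) \<le> N * C * norm x"
        using C by (auto intro: power2_le_imp_le)
      then show ?thesis by (simp add: ac_simps)
    qed
  qed
  then show ?thesis using T unfolding f_def by blast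
qed

text \<open>The hypotheses are symmetric in rows and columns, so the conjugate transpose is bounded
  by the same estimate.\<close>

lemma band_adjoint_pair:
  fixes M :: "'k \<Rightarrow> 'i \<Rightarrow> complex"
  assumes bound: "\<And>k i. cmod (M k i) \<le> C"
    and rows: "\<And>k. finite {i. M k i \<noteq> 0}" "\<And>k. card {i. M k i \<noteq> 0} \<le> N"
    and cols: "\<And>i. finite {k. M k i \<noteq> 0}" "\<And>i. card {k. M k i \<noteq> 0} \<le> N"
  obtains T S where "adjoint_pair T S" "\<And>i k. ell2_coeff (T (ket i)) k = M k i"
    "\<And>i k. ell2_coeff (S (ket k)) i = cnj (M k i)"
proof -
  obtain T where T: "bounded_clinear T"
    "\<And>x k. ell2_coeff (T x) k = (\<Sum>i | M k i \<noteq> 0. M k i * ell2_coeff x i)"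
    using band_bounded_clinear[of M C N] assms by blast
  obtain S where S: "bounded_clinear S"
    "\<And>x i. ell2_coeff (S x) i = (\<Sum>k | M k i \<noteq> 0. cnj (M k i) * ell2_coeff x k)"
    using band_bounded_clinear[of "\<lambda>i k. cnj (M k i)" C N] assms by auto
  have 1: "ell2_coeff (T (ket i)) k = M k i" for i k
    using rows by (simp add: T ell2_coeff_ket if_distrib sum.delta cong: if_cong)
  have 2: "ell2_coeff (S (ket k)) i = cnj (M k i)" for i k
    using cols by (simp add: S ell2_coeff_ket if_distrib sum.delta cong: if_cong)
  show thesis
    by (rule that[of T S]) (auto intro!: adjoint_pairI_ket T S simp: 1 2)
qed

text \<open>This is how a formula on kets becomes an operator with a known adjoint: the two families
  are conjugate transposes, and the band operators given by the matrix agree with the sums in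
  \<open>extend_basis\<close>.\<close>

lemma adjoint_pair_extend_basis:
  fixes F :: "'i \<Rightarrow> 'k ell2" and G :: "'k \<Rightarrow> 'i ell2"
  assumes adj: "\<And>i k. ell2_coeff (G k) i = cnj (ell2_coeff (F i) k)"
    and bound: "\<And>k i. cmod (ell2_coeff (F i) k) \<le> C"
    and F: "\<And>i. finite {k. ell2_coeff (F i) k \<noteq> 0}" "\<And>i. card {k. ell2_coeff (F i) k \<noteq> 0} \<le> N"
    and G: "\<And>k. finite {i. ell2_coeff (G k) i \<noteq> 0}" "\<And>k. card {i. ell2_coeff (G k) i \<noteq> 0} \<le> N"
  shows "adjoint_pair (extend_basis F) (extend_basis G)"
proof -
  obtain T S where TS: "adjoint_pair T S" and T: "\<And>i k. ell2_coeff (T (ket i)) k = ell2_coeff (F i) k"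
    and S: "\<And>i k. ell2_coeff (S (ket k)) i = cnj (ell2_coeff (F i) k)"
    using band_adjoint_pair[of "\<lambda>k i. ell2_coeff (F i) k" C N] assms by auto
  have "extend_basis F = T"
    by (rule extend_basis_eq) (auto intro!: adjoint_pairD[OF TS] ell2_eqI simp: T)
  moreover have "extend_basis G = S"
    by (rule extend_basis_eq) (auto intro!: adjoint_pairD[OF TS] ell2_eqI simp: S adj)
  ultimately show ?thesis using TS by simp
qed


section \<open>Representations of presented *-algebras\<close>

text \<open>\<open>cadjoint\<close> has meaning only where an adjoint exists, so the induction
  produces one for every polynomial; for \<open>Star x\<close> the pair for \<open>x\<close> is
  reversed.\<close>

lemma star_eval_adjoint_pair:
  assumes "\<And>g. \<exists>S. adjoint_pair (\<phi> g) S"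
  shows "adjoint_pair (star_eval \<phi> x) (star_eval \<phi> (Star x))"
proof -
  have "\<exists>S. adjoint_pair (star_eval \<phi> x) S"
  proof (induction x)
    case (Star x)
    then obtain S where "adjoint_pair (star_eval \<phi> x) S" by blast
    then have "adjoint_pair (star_eval \<phi> (Star x)) (star_eval \<phi> x)"
      using cadjoint_eqI[of "star_eval \<phi> x"] adjoint_pair_sym by simp
    then show ?case by blast
  qed (use assms in \<open>auto simp del: comp_apply intro: adjoint_pair_scaleC adjoint_pair_add adjoint_pair_compose\<close>)
  then show ?thesis using cadjoint_eqI by auto
qed

text \<open>Every clause of the congruence holds for bounded operators with adjoints; the algebraic
  laws about \<open>Star\<close> hold by uniqueness of the adjoint. Hence evaluation descends to the
  quotient algebra.\<close>

lemma star_eval_cong: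
  assumes adj: "\<And>g. \<exists>S. adjoint_pair (\<phi> g) S"
    and rel: "\<And>x y. (x, y) \<in> R \<Longrightarrow> star_eval \<phi> x = star_eval \<phi> y"
    and "star_cong R x y"
  shows "star_eval \<phi> x = star_eval \<phi> y"
proof -
  note pair = star_eval_adjoint_pair[of \<phi>, OF adj]
  note lin = bounded_clinear_simps[OF adjoint_pairD(1)[OF pair]]
  from assms(3) show ?thesis
  proof (induction rule: star_cong.induct)
    case (rel x y) then show ?case by (rule assms(2))
  next
    case (Star_Star x)
    show ?case using cadjoint_eqI[OF adjoint_pair_sym[OF pair[of x]]] by simp
  next
    case (Star_Add x y)
    show ?case using cadjoint_eqI[OF adjoint_pair_add[OF pair[of x] pair[of y]]] by simp
  next
    case (Star_Mult x y)
    show ?case using cadjoint_eqI[OF adjoint_pair_compose[OF pair[of x] pair[of y]]] by simp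
  next
    case (Star_Scalar c)
    show ?case using cadjoint_eqI[OF adjoint_pair_scaleC[of c]] by simp
  next
    case (Add_inverse x)
    show ?case by (simp add: scaleC_minus_one o_def)
  qed (auto simp: o_def lin scaleC_add_left scaleC_scaleC scaleC_one add.assoc
      intro!: ext add.commute)
qed

lemma induced_rep_star_class:
  assumes "\<And>g. \<exists>S. adjoint_pair (\<phi> g) S"
    and "\<And>x y. (x, y) \<in> R \<Longrightarrow> star_eval \<phi> x = star_eval \<phi> y"
  shows "induced_rep \<phi> (star_class R x) = star_eval \<phi> x"
proof -
  have "star_eval \<phi> y = star_eval \<phi> x" if "y \<in> star_class R x" for y
    using star_eval_cong[OF assms, of R x y] that by (simp add: star_class_def)
  moreover have "x \<in> star_class R x" by (simp add: star_class_def star_cong.refl)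
  ultimately have "star_eval \<phi> ` star_class R x = {star_eval \<phi> x}" by blast
  then show ?thesis by (simp add: induced_rep_def)
qed

lemma star_representation_induced_rep:
  assumes "\<And>g. \<exists>S. adjoint_pair (\<phi> g) S"
    and "\<And>x y. (x, y) \<in> R \<Longrightarrow> star_eval \<phi> x = star_eval \<phi> y"
  shows "star_representation (presented_star_alg R) (induced_rep \<phi>)"
proof -
  note pair = star_eval_adjoint_pair[of \<phi>, OF assms(1)]
  show ?thesis
    unfolding star_representation_def
    by (auto simp: presented_star_alg_simps induced_rep_star_class[OF assms] o_def scaleC_one
        adjoint_pairD(1)[OF pair] adjoint_pairD(3)[OF pair, simplified])
qed


section \<open>Tensoring with the identity of the spin space\<close>

text \<open>The spinor space is the sum of two copies of the first factor: \<open>I s\<close> embeds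
  the copy with spin \<open>s\<close>, and its adjoint \<open>L s\<close> reads off that
  component.\<close>

lemma spin_embedding:
  obtains I :: "spin \<Rightarrow> 'i ell2 \<Rightarrow> ('i \<times> spin) ell2" and L
  where "\<And>s. adjoint_pair (I s) (L s)"
    "\<And>s x. I s x = x \<otimes>\<^sub>2 ket s" "\<And>s i s'. L s (ket (i, s')) = (if s' = s then ket i else 0)"
    "\<And>s v i. ell2_coeff (L s v) i = ell2_coeff v (i, s)"
    "\<And>s s' x. L s (I s' x) = (if s' = s then x else 0)"
proof -
  define I :: "spin \<Rightarrow> 'i ell2 \<Rightarrow> ('i \<times> spin) ell2" where "I s = extend_basis (\<lambda>i. ket (i, s))" for s
  define G :: "spin \<Rightarrow> 'i \<times> spin \<Rightarrow> 'i ell2" where "G s = (\<lambda>(i, s'). if s' = s then ket i else 0)" for s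
  define L where "L s = extend_basis (G s)" for s
  have pair: "adjoint_pair (I s) (L s)" for s
    unfolding I_def L_def
  proof (rule adjoint_pair_extend_basis[where C = 1 and N = 1])
    show "finite {k. ell2_coeff (ket (i, s)) k \<noteq> 0}" "card {k. ell2_coeff (ket (i, s)) k \<noteq> 0} \<le> 1" for i
      by (auto simp: ell2_coeff_ket)
    have *: "{i. ell2_coeff (G s k) i \<noteq> 0} \<subseteq> {fst k}" for k
      by (auto simp: G_def ell2_coeff_ket split: prod.splits if_splits)
    show "finite {i. ell2_coeff (G s k) i \<noteq> 0}" for k by (rule finite_subset[OF *]) simp
    show "card {i. ell2_coeff (G s k) i \<noteq> 0} \<le> 1" for k using card_mono[OF _ *, of k] by simp
  qed (auto simp: G_def ell2_coeff_ket split: if_splits)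
  have I: "I s x = x \<otimes>\<^sub>2 ket s" for s x
  proof (rule ell2_eqI)
    fix k
    have "ell2_coeff (I s x) k = cinner (G s k) x"
      unfolding cinner_ket[symmetric] adjoint_pairD(3)[OF pair, symmetric]
      by (simp add: L_def extend_basis_ket)
    then show "ell2_coeff (I s x) k = ell2_coeff (x \<otimes>\<^sub>2 ket s) k"
      by (auto simp: G_def tensor.rep_eq ell2_coeff_ket cinner_ket split: prod.splits)
  qed
  have L: "ell2_coeff (L s v) i = ell2_coeff v (i, s)" for s v i
    unfolding cinner_ket[symmetric] adjoint_pairD(4)[OF pair, symmetric]
    by (simp add: I_def extend_basis_ket)
  show thesis
  proof (rule that[of I L])
    show "L s (ket (i, s')) = (if s' = s then ket i else 0)" for s i s'
      by (simp add: L_def extend_basis_ket G_def)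
    show "L s (I s' x) = (if s' = s then x else 0)" for s s' x
      by (rule ell2_eqI) (auto simp: L I tensor.rep_eq ell2_coeff_ket)
  qed (use pair I L in auto)
qed

text \<open>Replaces the infinite sum in \<open>tensor_op\<close> by two copies of \<open>T\<close>,
  from which boundedness, adjoints and products can be read off.\<close>

lemma tensor_op_id:
  assumes T: "bounded_clinear T"
    and I: "\<And>s. adjoint_pair (I s) (L s)"
    "\<And>s x. I s x = x \<otimes>\<^sub>2 ket s" "\<And>s i s'. L s (ket (i, s')) = (if s' = s then ket i else 0)"
  shows "tensor_op T id v = I Minus (T (L Minus v)) + I Plus (T (L Plus v))"
proof -
  note lin = bounded_clinear_simps[OF adjoint_pairD(1)[OF I(1)]] bounded_clinear_simps[OF T]
  have "tensor_op T id = (\<lambda>v. I Minus (T (L Minus v)) + I Plus (T (L Plus v)))"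
    unfolding tensor_op_def
  proof (rule extend_basis_eq)
    have "bounded_clinear (I s \<circ> (T \<circ> L s))" for s
      by (intro bounded_clinear_compose T adjoint_pairD(1,2)[OF I(1)])
    then show "bounded_clinear (\<lambda>v. I Minus (T (L Minus v)) + I Plus (T (L Plus v)))"
      using bounded_clinear_add by (fastforce simp: o_def)
    show "I Minus (T (L Minus (ket i))) + I Plus (T (L Plus (ket i)))
      = (case i of (i, j) \<Rightarrow> T (ket i) \<otimes>\<^sub>2 id (ket j))" for i
      by (cases i; cases "snd i") (auto simp: lin I(3) I(2)[symmetric])
  qed
  then show ?thesis by simp
qed

lemma adjoint_pair_tensor_op_id:
  fixes T :: "'i ell2 \<Rightarrow> 'i ell2"
  assumes "adjoint_pair T S"
  shows "adjoint_pair (tensor_op T id :: ('i \<times> spin) ell2 \<Rightarrow> _) (tensor_op S id)"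
proof -
  obtain I :: "spin \<Rightarrow> 'i ell2 \<Rightarrow> ('i \<times> spin) ell2" and L
  where I: "\<And>s. adjoint_pair (I s) (L s)"
    "\<And>s x. I s x = x \<otimes>\<^sub>2 ket s" "\<And>s i s'. L s (ket (i, s')) = (if s' = s then ket i else 0)"
    using spin_embedding by metis
  have "adjoint_pair (\<lambda>v. (I Minus \<circ> (T \<circ> L Minus)) v + (I Plus \<circ> (T \<circ> L Plus)) v)
      (\<lambda>v. ((I Minus \<circ> S) \<circ> L Minus) v + ((I Plus \<circ> S) \<circ> L Plus) v)"
    by (intro adjoint_pair_add adjoint_pair_compose assms I(1) adjoint_pair_sym[OF I(1)])
  moreover have "tensor_op T id v = (I Minus \<circ> (T \<circ> L Minus)) v + (I Plus \<circ> (T \<circ> L Plus)) v"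
    "tensor_op S id v = ((I Minus \<circ> S) \<circ> L Minus) v + ((I Plus \<circ> S) \<circ> L Plus) v" for v
    using tensor_op_id[OF adjoint_pairD(1)[OF assms] I] tensor_op_id[OF adjoint_pairD(2)[OF assms] I]
    by auto
  ultimately show ?thesis by presburger
qed

lemma star_representation_tensor_op_id:
  fixes \<rho> :: "'a \<Rightarrow> 'i ell2 \<Rightarrow> 'i ell2"
  assumes "star_representation A \<rho>"
    and adj: "\<And>x. x \<in> carrier A \<Longrightarrow> \<exists>S. adjoint_pair (\<rho> x) S"
    and "\<And>x. x \<in> carrier A \<Longrightarrow> star A x \<in> carrier A"
  shows "star_representation A (\<lambda>x. tensor_op (\<rho> x) id :: ('i \<times> spin) ell2 \<Rightarrow> ('i \<times> spin) ell2)"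
proof -
  obtain I :: "spin \<Rightarrow> 'i ell2 \<Rightarrow> ('i \<times> spin) ell2" and L
  where I: "\<And>s. adjoint_pair (I s) (L s)"
    "\<And>s x. I s x = x \<otimes>\<^sub>2 ket s" "\<And>s i s'. L s (ket (i, s')) = (if s' = s then ket i else 0)"
    and LI: "\<And>s s' x. L s (I s' x) = (if s' = s then x else 0)"
    using spin_embedding by metis
  note T = tensor_op_id[OF _ I]
  note lin = bounded_clinear_simps[OF adjoint_pairD(1)[OF I(1)]] bounded_clinear_simps[OF adjoint_pairD(2)[OF I(1)]]
  have rho: "bounded_clinear (\<rho> x)" if "x \<in> carrier A" for x
    using assms(1) that by (simp add: star_representation_def)
  have star: "adjoint_pair (\<rho> x) (\<rho> (star A x))" if "x \<in> carrier A" for x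
    using assms(1,3) that rho by (auto simp: star_representation_def adjoint_pair_def)
  have id: "tensor_op id id = (id :: ('i \<times> spin) ell2 \<Rightarrow> _)"
    unfolding tensor_op_def
    by (rule extend_basis_eq[OF bounded_clinear_id])
      (auto intro!: ell2_eqI simp: tensor.rep_eq ell2_coeff_ket split: prod.splits)
  have T_add: "tensor_op (\<lambda>v. S v + S' v) id v = tensor_op S id v + tensor_op S' id v"
    if "bounded_clinear S" "bounded_clinear S'" for S S' :: "'i ell2 \<Rightarrow> 'i ell2" and v :: "('i \<times> spin) ell2"
    unfolding T[OF bounded_clinear_add[OF that]] T[OF that(1)] T[OF that(2)] by (simp add: lin)
  \<comment> \<open>The mixed terms drop out because \<open>L s (I s' x)\<close> is 0 for different
    spins.\<close>
  have T_comp: "tensor_op (S \<circ> S') id v = tensor_op S id (tensor_op S' id v)"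
    if "bounded_clinear S" "bounded_clinear S'" for S S' :: "'i ell2 \<Rightarrow> 'i ell2" and v :: "('i \<times> spin) ell2"
    using T[OF bounded_clinear_compose[OF that]] by (simp add: T that lin LI)
  have T_scal: "tensor_op (\<lambda>v. c *\<^sub>C S v) id v = c *\<^sub>C tensor_op S id v"
    if "bounded_clinear S" for c and S :: "'i ell2 \<Rightarrow> 'i ell2" and v :: "('i \<times> spin) ell2"
    using T[OF bounded_clinear_compose[OF bounded_clinear_scaleC that, of c]] T[OF that]
    by (simp add: o_def lin scaleC_add_right)
  have T_rho: "adjoint_pair (tensor_op (\<rho> x) id :: ('i \<times> spin) ell2 \<Rightarrow> _) (tensor_op (\<rho> (star A x)) id)"
    if "x \<in> carrier A" for x
    by (rule adjoint_pair_tensor_op_id[OF star[OF that]])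
  have hom: "\<rho> \<one>\<^bsub>A\<^esub> = id"
    "\<And>x y. x \<in> carrier A \<Longrightarrow> y \<in> carrier A \<Longrightarrow> \<rho> (x \<oplus>\<^bsub>A\<^esub> y) = (\<lambda>v. \<rho> x v + \<rho> y v)"
    "\<And>x y. x \<in> carrier A \<Longrightarrow> y \<in> carrier A \<Longrightarrow> \<rho> (x \<otimes>\<^bsub>A\<^esub> y) = \<rho> x \<circ> \<rho> y"
    "\<And>c x. x \<in> carrier A \<Longrightarrow> \<rho> (scal A c x) = (\<lambda>v. c *\<^sub>C \<rho> x v)"
    using assms(1) unfolding star_representation_def by blast+
  show ?thesis
    unfolding star_representation_def
    by (intro conjI ballI allI ext)
      (simp_all add: hom id adjoint_pairD(1)[OF T_rho] adjoint_pairD(3)[OF T_rho]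
        T_add T_comp T_scal rho del: comp_apply, simp_all)
qed


section \<open>Diagonal operators\<close>

text \<open>In the induction step the compact set grows to its Minkowski sum with the image of a
  disc under \<open>\<lambda>z. z *\<^sub>C g N\<close>, which is again compact.\<close>

lemma compact_bounded_combinations:
  "\<exists>K. compact K \<and> (\<forall>c. (\<forall>n. cmod (c n) \<le> r) \<longrightarrow> (\<Sum>n<N. c n *\<^sub>C g n) \<in> K)"
  for g :: "nat \<Rightarrow> 'h::complex_hilbert"
proof (induction N)
  case 0
  show ?case by (rule exI[of _ "{0}"]) auto
next
  case (Suc N)
  then obtain K where K: "compact K" "\<And>c. (\<And>n. cmod (c n) \<le> r) \<Longrightarrow> (\<Sum>n<N. c n *\<^sub>C g n) \<in> K" by blast
  have "bounded_linear (\<lambda>z. z *\<^sub>C g N)"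
    by (rule bounded_linear_intro[where K = "norm (g N)"])
      (auto simp: scaleC_add_left norm_scaleC scaleR_scaleC scaleC_scaleC scaleR_conv_of_real)
  then have "compact ((\<lambda>z. z *\<^sub>C g N) ` cball 0 r)"
    by (intro compact_continuous_image linear_continuous_on) auto
  from compact_sums[OF K(1) this]
  have "compact {x + y |x y. x \<in> K \<and> y \<in> (\<lambda>z. z *\<^sub>C g N) ` cball 0 r}" (is "compact ?K") .
  moreover have "(\<Sum>n<Suc N. c n *\<^sub>C g n) \<in> ?K" if "\<And>n. cmod (c n) \<le> r" for c
  proof -
    have "c N *\<^sub>C g N \<in> (\<lambda>z. z *\<^sub>C g N) ` cball 0 r" using that by (intro imageI) simp
    then show ?thesis using K(2)[of c, OF that] unfolding sum.lessThan_Suc by blast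
  qed
  ultimately show ?case by blast
qed

text \<open>Half the radius is reserved for the closure: finitely many closed balls of radius
  \<open>r / 2\<close> form a closed set and therefore cover the closure as well.\<close>

lemma compact_closure_if_totally_bounded:
  fixes S :: "'a::{complete_space} set"
  assumes "\<And>r. 0 < r \<Longrightarrow> \<exists>k. finite k \<and> S \<subseteq> (\<Union>x\<in>k. ball x r)"
  shows "compact (closure S)"
  unfolding compact_eq_totally_bounded
proof (intro conjI allI impI)
  show "complete (closure S)" by (simp add: complete_eq_closed)
  fix r :: real assume r: "0 < r"
  then obtain k where k: "finite k" "S \<subseteq> (\<Union>x\<in>k. ball x (r / 2))" using assms[of "r / 2"] by auto
  have "closure S \<subseteq> (\<Union>x\<in>k. cball x (r / 2))"
  proof (rule closure_minimal)
    show "S \<subseteq> (\<Union>x\<in>k. cball x (r / 2))" using k(2) by force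
    show "closed (\<Union>x\<in>k. cball x (r / 2))" using k(1) by (intro closed_UN) auto
  qed
  also have "\<dots> \<subseteq> (\<Union>x\<in>k. ball x r)" using r by fastforce
  finally show "\<exists>k. finite k \<and> closure S \<subseteq> (\<Union>x\<in>k. ball x r)" using k(1) by blast
qed

section \<open>Coordinates with respect to an orthonormal basis\<close>

text \<open>The basis is given as a unitary map: \<open>V\<close> takes coordinates,
  \<open>W\<close> is both its adjoint and its inverse. Orthonormality is
  \<open>V (W y) = y\<close>, completeness is \<open>W (V x) = x\<close>.\<close>

locale orthonormal_basis =
  fixes e :: "nat \<Rightarrow> 'h::complex_hilbert" and V :: "'h \<Rightarrow> nat ell2" and W :: "nat ell2 \<Rightarrow> 'h"
  assumes VW: "adjoint_pair V W"
    and W_ket: "W (ket n) = e n"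
    and W_V [simp]: "W (V x) = x"
    and V_W [simp]: "V (W y) = y"
begin

abbreviation crd :: "'h \<Rightarrow> nat \<Rightarrow> complex" where "crd x n \<equiv> ell2_coeff (V x) n"

lemmas V_lin = bounded_clinear_simps[OF adjoint_pairD(1)[OF VW]]
lemmas W_lin = bounded_clinear_simps[OF adjoint_pairD(2)[OF VW]]

lemma cinner_e: "cinner (e n) x = crd x n"
  using adjoint_pairD(3)[OF VW, of "ket n" x] by (simp add: W_ket cinner_ket)

lemma crd_eqI: "(\<And>n. crd x n = crd y n) \<Longrightarrow> x = y"
  by (metis ell2_eqI W_V)

lemma V_e: "V (e n) = ket n"
  by (metis W_ket V_W)

lemma cinner_V: "cinner x y = cinner (V x) (V y)"
  by (simp add: adjoint_pairD(3)[OF VW, symmetric])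

lemma norm_V: "norm (V x) = norm x"
  using cinner_V[of x x] unfolding cinner_self of_real_eq_iff by (simp add: power2_eq_iff_nonneg)

lemma e_has_sum: "((\<lambda>n. crd x n *\<^sub>C e n) has_sum x) UNIV"
proof -
  have "bounded_linear W" using VW by (auto simp: adjoint_pair_def)
  from has_sum_bounded_linear[OF this ket_has_sum[of "V x"]] show ?thesis
    by (simp add: W_lin W_ket)
qed

lemma vector_with_crd:
  assumes "(\<lambda>n. (cmod (f n))\<^sup>2) summable_on UNIV"
  obtains x where "\<And>n. crd x n = f n"
proof
  show "crd (W (Abs_ell2 f)) n = f n" for n
    using assms by (simp add: Abs_ell2_inverse)
qed

text \<open>Intended for bounded \<open>s\<close>; otherwise the sum in \<open>extend_basis\<close>
  may diverge and the value is a default.\<close>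

definition Diag :: "(nat \<Rightarrow> complex) \<Rightarrow> 'h \<Rightarrow> 'h" where
  "Diag s x = W (extend_basis (\<lambda>n. s n *\<^sub>C ket n) (V x))"

lemma Diag:
  assumes "\<And>n. cmod (s n) \<le> C"
  shows adjoint_pair_Diag: "adjoint_pair (Diag s) (Diag (\<lambda>n. cnj (s n)))"
    and crd_Diag: "crd (Diag s x) n = s n * crd x n"
proof -
  have pair: "adjoint_pair (extend_basis (\<lambda>n. s n *\<^sub>C ket n)) (extend_basis (\<lambda>n. cnj (s n) *\<^sub>C ket n))"
  proof (rule adjoint_pair_extend_basis[where C = C and N = 1])
    have "0 \<le> C" using assms[of 0] norm_ge_zero order_trans by blast
    then show "cmod (ell2_coeff (s i *\<^sub>C ket i) k) \<le> C" for i k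
      by (simp add: ell2_coeff_ket assms)
    have *: "{k. ell2_coeff (c *\<^sub>C ket i) k \<noteq> 0} \<subseteq> {i}" for i :: nat and c
      by (auto simp: ell2_coeff_ket split: if_splits)
    show "finite {k. ell2_coeff (s i *\<^sub>C ket i) k \<noteq> 0}"
      "finite {k. ell2_coeff (cnj (s i) *\<^sub>C ket i) k \<noteq> 0}" for i
      by (rule finite_subset[OF *]; simp)+
    show "card {k. ell2_coeff (s i *\<^sub>C ket i) k \<noteq> 0} \<le> 1"
      "card {k. ell2_coeff (cnj (s i) *\<^sub>C ket i) k \<noteq> 0} \<le> 1" for i
      using card_mono[OF _ *[of "s i" i]] card_mono[OF _ *[of "cnj (s i)" i]] by auto
  qed (auto simp: ell2_coeff_ket)
  show "adjoint_pair (Diag s) (Diag (\<lambda>n. cnj (s n)))"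
    using adjoint_pair_compose[OF adjoint_pair_compose[OF adjoint_pair_sym[OF VW] pair] VW]
    by (simp add: Diag_def[abs_def] o_def)
  show "crd (Diag s x) n = s n * crd x n"
    using adjoint_pairD(3)[OF pair, of "ket n" "V x"]
    by (simp add: Diag_def extend_basis_ket cinner_ket cinner_scaleC_left)
qed

text \<open>Kets determine a bounded operator, and \<open>W\<close> carries them to the basis. This
  identifies an arbitrary resolvent as a diagonal operator.\<close>

lemma Diag_eqI:
  assumes "bounded_clinear R" "\<And>n. cmod (s n) \<le> C" "\<And>n. R (e n) = s n *\<^sub>C e n"
  shows "R = Diag s"
proof -
  have D: "bounded_clinear (Diag s)" using adjoint_pair_Diag assms(2) adjoint_pairD(1) by blast
  have "R \<circ> W = Diag s \<circ> W"
  proof (rule bounded_clinear_eq_on_kets)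
    show "bounded_clinear (R \<circ> W)" "bounded_clinear (Diag s \<circ> W)"
      by (intro bounded_clinear_compose assms D adjoint_pairD(2)[OF VW])+
    show "(R \<circ> W) (ket n) = (Diag s \<circ> W) (ket n)" for n
      by (rule crd_eqI) (auto simp: W_ket assms(3) crd_Diag[OF assms(2)] V_lin V_e ell2_coeff_ket)
  qed
  then show ?thesis by (metis (no_types, lifting) W_V comp_apply ext)
qed

lemma norm_le_if_crd_le:
  assumes "\<And>n. cmod (crd y n) \<le> c * cmod (crd x n)" "0 \<le> c"
  shows "norm y \<le> c * norm x"
proof -
  have "(norm (V y))\<^sup>2 \<le> (\<Sum>\<^sub>\<infinity>n. c\<^sup>2 * (cmod (crd x n))\<^sup>2)"
    unfolding ell2_norm_sq
  proof (rule infsum_mono)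
    show "(cmod (crd y n))\<^sup>2 \<le> c\<^sup>2 * (cmod (crd x n))\<^sup>2" for n
      using power_mono[OF assms(1)[of n], of 2] by (simp add: power_mult_distrib)
  qed (intro summable_on_cmult_right ell2_coeff_summable)+
  also have "\<dots> = (c * norm (V x))\<^sup>2"
    by (simp add: infsum_cmult_right' ell2_norm_sq power_mult_distrib)
  finally have "norm (V y) \<le> c * norm (V x)"
    using assms(2) by (auto intro: power2_le_imp_le)
  then show ?thesis by (simp add: norm_V)
qed

text \<open>For each \<open>r\<close> the operator is cut off at an index \<open>N\<close> beyond
  which the entries are below \<open>r / 2\<close>. The cut-off values have coefficients bounded by
  \<open>C\<close>, hence lie in a compact set, and a finite net of radius \<open>r / 2\<close> for
  that set is a net of radius \<open>r\<close> for the image of the unit ball.\<close>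

lemma compact_op_Diag:
  assumes "s \<longlonglongrightarrow> 0"
  shows "compact_op (Diag s)"
proof -
  obtain C where C: "\<And>n. cmod (s n) \<le> C"
    using convergent_imp_Bseq[of s] assms by (auto simp: convergent_def Bseq_def)
  have *: "\<exists>k. finite k \<and> Diag s ` cball 0 1 \<subseteq> (\<Union>x\<in>k. ball x r)" if r: "0 < r" for r
  proof -
    obtain N where N: "\<And>n. n \<ge> N \<Longrightarrow> cmod (s n) < r / 2"
      using LIMSEQ_D[OF assms, of "r / 2"] r by auto
    obtain K where K: "compact K" "\<And>c. (\<And>n. cmod (c n) \<le> C) \<Longrightarrow> (\<Sum>n<N. c n *\<^sub>C e n) \<in> K"
      using compact_bounded_combinations[where r = C and N = N and g = e] by blast
    obtain k where k: "finite k" "K \<subseteq> (\<Union>x\<in>k. ball x (r / 2))"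
      using compact_eq_totally_bounded[THEN iffD1, OF K(1), THEN conjunct2, rule_format, of "r / 2"] r
      by auto
    have "Diag s x \<in> (\<Union>x\<in>k. ball x r)" if x: "norm x \<le> 1" for x
    proof -
      define y where "y = (\<Sum>n<N. (s n * crd x n) *\<^sub>C e n)"
      have crd_le: "cmod (crd x n) \<le> 1" for n
        using ell2_coeff_le_norm[of "V x" n] x by (simp add: norm_V)
      have "cmod (s n * crd x n) \<le> C" for n
        using mult_mono[OF C[of n] crd_le[of n]] C[of n] norm_ge_zero[of "s n"]
        unfolding norm_mult by simp
      then have "y \<in> K" unfolding y_def by (rule K(2))
      then obtain z where z: "z \<in> k" "dist z y < r / 2" using k by auto
      have crd_y: "crd y n = (if n < N then s n * crd x n else 0)" for n
        by (simp add: y_def V_lin V_e ell2_coeff_sum ell2_coeff_ket if_distrib sum.delta cong: if_cong)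
      have "norm (Diag s x - y) \<le> r / 2 * norm x"
      proof (rule norm_le_if_crd_le)
        show "cmod (crd (Diag s x - y) n) \<le> r / 2 * cmod (crd x n)" for n
          using mult_right_mono[OF less_imp_le[OF N[of n]] norm_ge_zero[of "crd x n"]] r
          by (cases "n < N") (simp_all add: V_lin crd_Diag[OF C] crd_y norm_mult)
      qed (use r in simp)
      also have "\<dots> \<le> r / 2" using x r by (simp add: mult_left_le)
      finally have "dist y (Diag s x) \<le> r / 2" by (simp add: dist_norm norm_minus_commute)
      then have "dist z (Diag s x) < r" using z(2) dist_triangle[of z "Diag s x" y] by linarith
      then show ?thesis using z(1) by (intro UN_I[of z]) simp_all
    qed
    then show ?thesis using k(1) by (intro exI[of _ k]) auto
  qed
  show ?thesis
    unfolding compact_op_def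
    using compact_closure_if_totally_bounded[OF *] adjoint_pairD(1)[OF adjoint_pair_Diag[OF C]]
    by (intro conjI)
qed

end

section \<open>Unbounded diagonal operators\<close>

locale diagonal_dirac = orthonormal_basis e V W
  for e :: "nat \<Rightarrow> 'h::complex_hilbert" and V W +
  fixes d :: "nat \<Rightarrow> real" and D :: "'h lin_op"
  defines "D \<equiv> diagonal_op UNIV e d"
begin

lemma dom_iff: "x \<in> dom D \<longleftrightarrow> (\<lambda>n. (cmod (d n * crd x n))\<^sup>2) summable_on UNIV"
  by (simp add: D_def diagonal_op_def cinner_e norm_mult power_mult_distrib)

lemma crd_app:
  assumes "x \<in> dom D"
  shows "crd (app D x) n = d n * crd x n"
proof -
  obtain y where y: "\<And>n. crd y n = d n * crd x n"
    using vector_with_crd assms[unfolded dom_iff] by metis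
  have "app D x = (\<Sum>\<^sub>\<infinity>n. crd y n *\<^sub>C e n)"
    by (simp add: D_def diagonal_op_def cinner_e y)
  also have "\<dots> = y" by (rule infsumI[OF e_has_sum])
  finally show ?thesis by (simp add: y)
qed

text \<open>The coordinates of a vector \<open>y\<close> are square summable, so exhibiting
  \<open>y\<close> proves membership in the domain and computes the value at once. Later domain
  questions are settled this way.\<close>

lemma domI:
  assumes "\<And>n. d n * crd x n = crd y n"
  shows "x \<in> dom D" "app D x = y"
proof -
  show "x \<in> dom D"
    unfolding dom_iff assms by (rule ell2_coeff_summable)
  then show "app D x = y" by (intro crd_eqI) (simp add: crd_app assms)
qed

lemma e_in_dom: "e n \<in> dom D" "app D (e n) = of_real (d n) *\<^sub>C e n"
  using domI[of "e n" "of_real (d n) *\<^sub>C e n"] by (auto simp: V_e V_lin ell2_coeff_ket)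

lemma dom_add: "x \<in> dom D \<Longrightarrow> y \<in> dom D \<Longrightarrow> x + y \<in> dom D \<and> app D (x + y) = app D x + app D y"
  using domI[of "x + y" "app D x + app D y"] by (auto simp: V_lin crd_app algebra_simps)

lemma dom_scaleC: "x \<in> dom D \<Longrightarrow> c *\<^sub>C x \<in> dom D \<and> app D (c *\<^sub>C x) = c *\<^sub>C app D x"
  using domI[of "c *\<^sub>C x" "c *\<^sub>C app D x"] by (auto simp: V_lin crd_app)

lemma zero_in_dom: "0 \<in> dom D" "app D 0 = 0"
  using domI[of 0 0] by (auto simp: V_lin)

lemma symmetric:
  assumes "x \<in> dom D" "y \<in> dom D"
  shows "cinner (app D x) y = cinner x (app D y)"
  unfolding cinner_V[of "app D x"] cinner_V[of x "app D y"] cinner_ell2_def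
  by (simp add: crd_app assms ac_simps)

lemma selfadjoint: "selfadjoint D"
  unfolding selfadjoint_def densely_defined_def
proof (intro conjI)
  show "complex_vector.subspace (dom D)"
    using dom_add dom_scaleC zero_in_dom by (auto simp: complex_vector.subspace_def)
  have "x \<in> closure (dom D)" for x
  proof (rule Lim_in_closed_set)
    have "(\<Sum>n\<in>F. crd x n *\<^sub>C e n) \<in> dom D" for F
      by (induction F rule: infinite_finite_induct) (auto simp: zero_in_dom dom_add dom_scaleC e_in_dom)
    then show "\<forall>\<^sub>F F in finite_subsets_at_top UNIV. (\<Sum>n\<in>F. crd x n *\<^sub>C e n) \<in> closure (dom D)"
      using closure_subset by (fastforce intro!: always_eventually)
    show "((\<lambda>F. \<Sum>n\<in>F. crd x n *\<^sub>C e n) \<longlongrightarrow> x) (finite_subsets_at_top UNIV)"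
      using e_has_sum[of x] by (simp add: has_sum_def)
  qed auto
  then show "closure (dom D) = UNIV" by auto
  show "op_graph D = adjoint_graph D"
  proof (intro equalityI subrelI)
    fix y z assume "(y, z) \<in> op_graph D"
    then show "(y, z) \<in> adjoint_graph D"
      by (auto simp: op_graph_def adjoint_graph_def symmetric)
  next
    \<comment> \<open>Testing the adjoint relation on basis vectors alone shows that the coordinates
      of \<open>z\<close> are those expected of \<open>D y\<close>; then \<open>domI\<close> puts
      \<open>y\<close> into the domain.\<close>
    fix y z assume "(y, z) \<in> adjoint_graph D"
    then have "cinner (app D (e n)) y = cinner (e n) z" for n
      using e_in_dom(1) by (auto simp: adjoint_graph_def)
    then have "d n * crd y n = crd z n" for n
      by (simp add: e_in_dom cinner_scaleC_left cinner_e)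
    from domI[OF this] show "(y, z) \<in> op_graph D" by (auto simp: op_graph_def)
  qed
qed (use dom_add dom_scaleC in auto)

lemma compact_resolvent:
  assumes d: "filterlim (\<lambda>n. \<bar>d n\<bar>) at_top sequentially"
  shows "compact_resolvent D"
proof -
  let ?r = "\<lambda>z n. inverse (complex_of_real (d n) - z)"
  \<comment> \<open>This covers every \<open>z\<close>: at an eigenvalue the convention
    \<open>inverse 0 = 0\<close> applies, and only finitely many indices are affected.\<close>
  have tendsto: "?r z \<longlonglongrightarrow> 0" for z
  proof (rule filterlim_compose[OF tendsto_inverse_0])
    have "filterlim (\<lambda>n. - cmod z + \<bar>d n\<bar>) at_top sequentially"
      by (rule filterlim_tendsto_add_at_top[OF tendsto_const d])
    then have "filterlim (\<lambda>n. cmod (complex_of_real (d n) - z)) at_top sequentially"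
      by (rule filterlim_at_top_mono)
        (use norm_triangle_ineq2[of "complex_of_real (d n)" z for n] in \<open>auto intro!: always_eventually\<close>)
    then show "filterlim (\<lambda>n. complex_of_real (d n) - z) at_infinity sequentially"
      by (simp add: filterlim_at_infinity_conv_norm_at_top)
  qed
  then have "\<exists>C. \<forall>n. cmod (?r z n) \<le> C" for z
    using convergent_imp_Bseq[of "?r z"]
    by (metis Bseq_def convergent_def)
  then obtain C where C: "\<And>n z. cmod (?r z n) \<le> C z" by metis
  \<comment> \<open>The eigenvalues are real, so \<open>\<i>\<close> lies in the resolvent
    set.\<close>
  have "bounded_inverse (minus_scalar D \<i>) (Diag (?r \<i>))"
    (is "bounded_inverse _ ?R")
  proof -
    have nz: "complex_of_real (d n) - \<i> \<noteq> 0" for n by (auto simp: complex_eq_iff)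
    have *: "d n * crd (?R x) n = crd (x + \<i> *\<^sub>C ?R x) n" for x n
      unfolding V_lin ell2_coeff_simps crd_Diag[OF C] using nz[of n] by (simp add: field_simps)
    show ?thesis
      unfolding bounded_inverse_def minus_scalar_def
    proof (intro conjI allI ballI; (simp only: lin_op.simps)?)
      show "bounded_clinear ?R" by (rule adjoint_pairD(1)[OF adjoint_pair_Diag[OF C]])
      show "?R x \<in> dom D" "app D (?R x) - \<i> *\<^sub>C ?R x = x" for x
        using domI[OF *] by auto
      show "?R (app D x - \<i> *\<^sub>C x) = x" if "x \<in> dom D" for x
      proof (rule crd_eqI)
        fix n
        have "crd (?R (app D x - \<i> *\<^sub>C x)) n
            = ?r \<i> n * ((complex_of_real (d n) - \<i>) * crd x n)"
          unfolding V_lin ell2_coeff_simps crd_Diag[OF C] crd_app[OF that]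
          by (simp only: left_diff_distrib)
        then show "crd (?R (app D x - \<i> *\<^sub>C x)) n = crd x n"
          using nz[of n] by (simp add: mult.assoc[symmetric])
      qed
    qed
  qed
  moreover have "compact_op R" if R: "bounded_inverse (minus_scalar D z) R" for z R
  proof -
    have lin: "bounded_clinear R" using R by (simp add: bounded_inverse_def)
    have eq: "R ((complex_of_real (d n) - z) *\<^sub>C e n) = e n" for n
      using R e_in_dom[of n]
      by (auto simp: bounded_inverse_def minus_scalar_def complex_vector.scale_left_diff_distrib)
    \<comment> \<open>If \<open>z\<close> were an eigenvalue, the inverse would send 0 to a basis
      vector.\<close>
    have nz: "complex_of_real (d n) - z \<noteq> 0" for n
    proof
      assume "complex_of_real (d n) - z = 0"
      then have "e n = 0" using eq[of n] by (simp add: bounded_clinear_simps[OF lin])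
      then have "crd (e n) n = 0" by (simp add: V_lin)
      then show False by (simp add: V_e ell2_coeff_ket)
    qed
    have "R (e n) = ?r z n *\<^sub>C e n" for n
    proof -
      have "?r z n *\<^sub>C e n
          = ?r z n *\<^sub>C (complex_of_real (d n) - z) *\<^sub>C R (e n)"
        using eq[of n] by (simp add: bounded_clinear_simps[OF lin])
      then show ?thesis using nz[of n] by (simp add: scaleC_scaleC scaleC_one)
    qed
    then have "R = Diag (?r z)"
      by (rule Diag_eqI[OF lin C])
    then show ?thesis using compact_op_Diag[OF tendsto] by simp
  qed
  ultimately show ?thesis unfolding compact_resolvent_def by blast
qed

text \<open>The operator \<open>K\<close> is diagonal with entries
  \<open>s n = 1 / sqrt (1 + (d n)\<^sup>2)\<close>, which \<open>mono\<close> makes decreasing, so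
  \<open>s\<close> itself is the list of singular values. The hypothesis \<open>growth\<close> says
  that \<open>n\<close> is at most \<open>(C / s n) powr p\<close>, and this is solved for
  \<open>s n\<close>.\<close>

lemma plus_summable:
  assumes d: "filterlim (\<lambda>n. \<bar>d n\<bar>) at_top sequentially" and mono: "mono (\<lambda>n. \<bar>d n\<bar>)"
    and p: "0 < p" and growth: "\<And>n. real n \<le> (C * sqrt (1 + (d n)\<^sup>2)) powr p" and C: "0 \<le> C"
  shows "plus_summable p D"
proof -
  define s where "s n = 1 / sqrt (1 + (d n)\<^sup>2)" for n
  define K where "K = Diag (\<lambda>n. complex_of_real (s n))"
  have pos: "0 < 1 + (d n)\<^sup>2" for n by (simp add: add_pos_nonneg)
  have s_pos: "0 < s n" for n using pos by (simp add: s_def)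
  have s_sq: "s n * s n = 1 / (1 + (d n)\<^sup>2)" for n
    using pos[of n] by (simp add: s_def)
  have s_le: "s n \<le> 1" for n
    unfolding s_def using pos[of n] by (subst divide_le_eq_1_pos) auto
  then have s_le': "cmod (complex_of_real (s n)) \<le> 1" for n using s_pos[of n] by simp
  have crd_K: "crd (K x) n = complex_of_real (s n) * crd x n" for x n
    unfolding K_def by (rule crd_Diag[OF s_le'])
  have K: "adjoint_pair K K" using adjoint_pair_Diag[OF s_le'] by (simp add: K_def)
  have s_lim: "s \<longlonglongrightarrow> 0"
  proof (rule Lim_null_comparison)
    show "\<forall>\<^sub>F n in sequentially. norm (s n) \<le> inverse \<bar>d n\<bar>"
      using filterlim_at_top_dense[THEN iffD1, OF d, rule_format, of 0]
    proof eventually_elim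
      case (elim n)
      have "\<bar>d n\<bar> \<le> sqrt (1 + (d n)\<^sup>2)" by (rule real_le_rsqrt) simp
      then have "inverse (sqrt (1 + (d n)\<^sup>2)) \<le> inverse \<bar>d n\<bar>" using elim by (intro le_imp_inverse_le) auto
      then show ?case using s_pos[of n] unfolding s_def by (simp add: divide_inverse)
    qed
    show "(\<lambda>n. inverse \<bar>d n\<bar>) \<longlonglongrightarrow> 0"
      by (rule tendsto_inverse_0_at_top[OF d])
  qed
  have compact: "compact_op K"
    unfolding K_def by (rule compact_op_Diag) (use tendsto_of_real[OF s_lim] in simp)
  have KK: "crd (K (K x)) n = complex_of_real (1 / (1 + (d n)\<^sup>2)) * crd x n" for x n
    unfolding crd_K s_sq[symmetric] by simp
  have "inv_sqrt_one_plus_square D K"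
    unfolding inv_sqrt_one_plus_square_def
  proof (intro conjI)
    show "bounded_clinear K" by (rule adjoint_pairD(1)[OF K])
    show "positive_op K"
    proof -
      have s_root: "cmod (complex_of_real (sqrt (s n))) \<le> 1" for n
        using s_pos[of n] s_le[of n] by simp
      \<comment> \<open>Positivity: \<open>K\<close> is the square of the selfadjoint operator
        \<open>L\<close> with entries \<open>sqrt (s n)\<close>.\<close>
      define L where "L = Diag (\<lambda>n. complex_of_real (sqrt (s n)))"
      have L: "adjoint_pair L L" using adjoint_pair_Diag[OF s_root] by (simp add: L_def)
      have "K x = L (L x)" for x
        using s_pos by (intro crd_eqI)
          (simp add: crd_K L_def crd_Diag[OF s_root] mult.assoc[symmetric] less_imp_le flip: of_real_mult)
      then have "cinner x (K x) = complex_of_real ((norm (L x))\<^sup>2)" for x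
        using adjoint_pairD(3)[OF L, of x "L x"] cinner_self by metis
      then show ?thesis by (simp add: positive_op_def)
    qed
    show "bounded_inverse (one_plus_square D) (K \<circ> K)"
      unfolding bounded_inverse_def one_plus_square_def
    proof (intro conjI allI ballI; (simp only: lin_op.simps mem_Collect_eq o_apply)?)
      show "bounded_clinear (K \<circ> K)" by (intro bounded_clinear_compose adjoint_pairD(1)[OF K])
      fix x
      \<comment> \<open>\<open>t\<close> gives the entries of \<open>D K K\<close>. They are bounded
        because \<open>2 * \<bar>d n\<bar> \<le> 1 + (d n)\<^sup>2\<close>, so
        \<open>Diag t x\<close> is the value of \<open>D\<close> at \<open>K (K x)\<close>, and
        \<open>x - K (K x)\<close> is the value of \<open>D\<close> there.\<close>
      define t where "t n = complex_of_real (d n / (1 + (d n)\<^sup>2))" for n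
      have t: "cmod (t n) \<le> 1" for n
      proof -
        have "\<bar>d n\<bar> * 2 \<le> 1 + (d n)\<^sup>2"
          using sum_squares_bound[of 1 "\<bar>d n\<bar>"] by simp
        then have "\<bar>d n\<bar> \<le> 1 + (d n)\<^sup>2" using abs_ge_zero[of "d n"] by linarith
        then show ?thesis using pos[of n] unfolding t_def norm_of_real abs_divide by simp
      qed
      have 1: "d n * crd (K (K x)) n = crd (Diag t x) n" for n
        by (simp add: KK crd_Diag[OF t] t_def)
      have 2: "d n * crd (Diag t x) n = crd (x - K (K x)) n" for n
      proof -
        have eq: "complex_of_real (d n) * t n = 1 - complex_of_real (1 / (1 + (d n)\<^sup>2))"
          using arg_cong[of "d n * (d n / (1 + (d n)\<^sup>2))" "1 - 1 / (1 + (d n)\<^sup>2)" complex_of_real] pos[of n]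
          unfolding t_def by (simp add: field_simps power2_eq_square)
        show ?thesis
          unfolding crd_Diag[OF t] V_lin ell2_coeff_simps KK mult.assoc[symmetric] eq
          by (simp only: left_diff_distrib mult_1)
      qed
      show "K (K x) \<in> dom D \<and> app D (K (K x)) \<in> dom D" "K (K x) + app D (app D (K (K x))) = x"
        using domI[OF 1] domI[OF 2] by auto
    next
      fix x assume x: "x \<in> dom D \<and> app D x \<in> dom D"
      show "K (K (x + app D (app D x))) = x"
      proof (rule crd_eqI)
        fix n
        have "crd x n + complex_of_real (d n) * (complex_of_real (d n) * crd x n)
            = complex_of_real (1 + (d n)\<^sup>2) * crd x n"
          by (simp add: algebra_simps power2_eq_square)
        moreover have "complex_of_real (1 / (1 + (d n)\<^sup>2)) * complex_of_real (1 + (d n)\<^sup>2) = 1"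
          using pos[of n] by (simp only: of_real_mult[symmetric]) simp
        ultimately show "crd (K (K (x + app D (app D x)))) n = crd x n"
          unfolding KK V_lin ell2_coeff_simps crd_app[OF conjunct1[OF x]] crd_app[OF conjunct2[OF x]]
          by (simp only: mult.assoc[symmetric] mult_1)
      qed
    qed
  qed
  moreover have "singular_values K s"
    unfolding singular_values_def
  proof (intro conjI allI impI compact)
    show "decseq s"
      unfolding decseq_def s_def
    proof (intro allI impI divide_left_mono)
      fix m n :: nat assume "m \<le> n"
      then have "(d m)\<^sup>2 \<le> (d n)\<^sup>2" using monoD[OF mono, of m n] by (simp add: abs_le_square_iff)
      then show "sqrt (1 + (d m)\<^sup>2) \<le> sqrt (1 + (d n)\<^sup>2)" by simp
    qed (use pos in auto)
    show "0 \<le> s n" for n using s_pos[of n] by simp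
    fix t :: real assume t: "0 < t"
    \<comment> \<open>Since \<open>s\<close> tends to 0, a positive value is taken only finitely
      often.\<close>
    obtain N where N: "\<And>n. n \<ge> N \<Longrightarrow> s n < t"
      using order_tendstoD(2)[OF s_lim t] by (auto simp: eventually_sequentially)
    then have "{n. s n = t} \<subseteq> {..<N}" by (force simp: not_less[symmetric])
    then show fin: "finite {n. s n = t}" by (rule finite_subset) auto
    \<comment> \<open>As \<open>s n\<close> and \<open>t\<close> are positive, equality of squares
      means equality; so the eigenspace consists of the vectors supported where
      \<open>s n = t\<close>.\<close>
    have "crd (K (K x)) n = crd (of_real (t\<^sup>2) *\<^sub>C x) n \<longleftrightarrow> s n = t \<or> crd x n = 0" for x n
      using s_pos[of n] t by (auto simp: crd_K V_lin power2_eq_square simp flip: of_real_mult mult.assoc)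
        (metis abs_of_pos power2_eq_square real_sqrt_abs)
    then have eigen: "{x. cadjoint K (K x) = of_real (t\<^sup>2) *\<^sub>C x} = {x. \<forall>n. s n \<noteq> t \<longrightarrow> crd x n = 0}"
      unfolding cadjoint_eqI[OF K] by (auto intro: crd_eqI) metis
    have inj: "inj e" by (rule injI) (metis V_e ell2_coeff_ket zero_neq_one)
    have "{x. \<forall>n. s n \<noteq> t \<longrightarrow> crd x n = 0} = complex_vector.span (e ` {n. s n = t})"
    proof (intro equalityI subsetI)
      fix x assume "x \<in> {x. \<forall>n. s n \<noteq> t \<longrightarrow> crd x n = 0}"
      then have "x = (\<Sum>n | s n = t. crd x n *\<^sub>C e n)"
        using fin by (intro crd_eqI)
          (auto simp: V_lin V_e ell2_coeff_sum ell2_coeff_ket if_distrib sum.delta cong: if_cong)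
      moreover have "(\<Sum>n | s n = t. crd x n *\<^sub>C e n) \<in> complex_vector.span (e ` {n. s n = t})"
        by (intro complex_vector.span_sum complex_vector.span_scale complex_vector.span_base) auto
      ultimately show "x \<in> complex_vector.span (e ` {n. s n = t})" by simp
    next
      fix x assume "x \<in> complex_vector.span (e ` {n. s n = t})"
      then show "x \<in> {x. \<forall>n. s n \<noteq> t \<longrightarrow> crd x n = 0}"
      proof (induction rule: complex_vector.span_induct_alt)
        case base then show ?case by (simp add: V_lin)
      next
        case (step c x y) then show ?case by (auto simp: V_lin V_e ell2_coeff_ket split: if_splits)
      qed
    qed
    moreover have "complex_vector.independent (e ` {n. s n = t})"
    proof (rule complex_vector.independent_if_scalars_zero)
      show "finite (e ` {n. s n = t})" using fin by simp
      fix f x assume 0: "(\<Sum>x\<in>e ` {n. s n = t}. f x *\<^sub>C x) = 0" and "x \<in> e ` {n. s n = t}"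
      then obtain m where m: "x = e m" "s m = t" by auto
      have "(\<Sum>n | s n = t. f (e n) *\<^sub>C e n) = 0"
        using 0 inj by (subst (asm) sum.reindex) (auto intro: inj_on_subset)
      then have "crd (\<Sum>n | s n = t. f (e n) *\<^sub>C e n) m = 0" by (simp add: V_lin)
      then show "f x = 0"
        using fin m by (simp add: V_lin V_e ell2_coeff_sum ell2_coeff_ket if_distrib sum.delta cong: if_cong)
    qed
    ultimately show "card {n. s n = t} = complex_vector.dim {x. cadjoint K (K x) = of_real (t\<^sup>2) *\<^sub>C x}"
      using inj unfolding eigen
      by (simp add: complex_vector.dim_eq_card_independent card_image inj_on_subset)
  qed
  moreover have "s \<in> O(\<lambda>n. real n powr (- 1 / p))"
  proof (rule bigoI[where c = C])
    show "\<forall>\<^sub>F n in at_top. norm (s n) \<le> C * norm (real n powr (- 1 / p))"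
      using eventually_gt_at_top[of 0]
    proof eventually_elim
      case (elim n)
      have "real n powr (1 / p) \<le> ((C * sqrt (1 + (d n)\<^sup>2)) powr p) powr (1 / p)"
        using p by (intro powr_mono2 growth) auto
      also have "\<dots> = C * sqrt (1 + (d n)\<^sup>2)"
        using p C by (simp add: powr_powr)
      finally have "real n powr (1 / p) * s n \<le> C"
        using pos[of n] by (simp add: s_def field_simps)
      then show ?case
        using elim s_pos[of n] by (simp add: powr_minus field_simps)
    qed
  qed
  ultimately show ?thesis unfolding plus_summable_def by blast
qed

section \<open>The *-algebra of operators with bounded commutator\<close>

text \<open>\<open>B\<close> extends the commutator of \<open>D\<close> with \<open>T\<close>, and
  \<open>- B'\<close> that with the adjoint \<open>S\<close>, in accordance with
  \<open>[D, T*] = - [D, T]*\<close>. Recording both makes the class visibly closed under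
  adjoints.\<close>

definition commutator_data :: "('h \<Rightarrow> 'h) \<Rightarrow> ('h \<Rightarrow> 'h) \<Rightarrow> ('h \<Rightarrow> 'h) \<Rightarrow> ('h \<Rightarrow> 'h) \<Rightarrow> bool" where
  "commutator_data T S B B' \<longleftrightarrow> adjoint_pair T S \<and> adjoint_pair B B' \<and>
     (\<forall>x\<in>dom D. (T x \<in> dom D \<and> app D (T x) = T (app D x) + B x) \<and>
        (S x \<in> dom D \<and> app D (S x) = S (app D x) - B' x))"

definition has_commutator :: "('h \<Rightarrow> 'h) \<Rightarrow> bool" where
  "has_commutator T \<longleftrightarrow> (\<exists>S B B'. commutator_data T S B B')"

lemma commutator_dataD:
  assumes "commutator_data T S B B'"
  shows "adjoint_pair T S" "adjoint_pair B B'"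
    "x \<in> dom D \<Longrightarrow> T x \<in> dom D \<and> app D (T x) = T (app D x) + B x"
    "x \<in> dom D \<Longrightarrow> S x \<in> dom D \<and> app D (S x) = S (app D x) - B' x"
  using assms unfolding commutator_data_def by blast+

lemma has_commutatorI:
  assumes "adjoint_pair T S" "adjoint_pair B B'"
    and "\<And>x. x \<in> dom D \<Longrightarrow> T x \<in> dom D \<and> app D (T x) = T (app D x) + B x"
    and "\<And>x. x \<in> dom D \<Longrightarrow> S x \<in> dom D \<and> app D (S x) = S (app D x) - B' x"
  shows "has_commutator T"
  using assms unfolding has_commutator_def commutator_data_def by blast

lemma has_commutator_imp_commutator_bounded:
  assumes "has_commutator T"
  shows "commutator_bounded D T"
proof -
  obtain S B B' where "commutator_data T S B B'" using assms unfolding has_commutator_def by blast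
  note T = commutator_dataD[OF this]
  show ?thesis
    unfolding commutator_bounded_def by (auto simp: T(3) intro!: exI[of _ B] adjoint_pairD(1)[OF T(2)])
qed

lemma has_commutator_adjoint:
  assumes "has_commutator T" "adjoint_pair T S"
  shows "has_commutator S"
proof -
  obtain S' B B' where "commutator_data T S' B B'" using assms(1) unfolding has_commutator_def by blast
  note T = commutator_dataD[OF this]
  have S: "S' = S" using cadjoint_eqI T(1) assms(2) by metis
  have "adjoint_pair (\<lambda>x. - B' x) (\<lambda>x. - B x)"
    using adjoint_pair_compose[OF adjoint_pair_scaleC[of "-1"] adjoint_pair_sym[OF T(2)]]
    by (simp add: o_def scaleC_minus_one bounded_clinear_simps[OF adjoint_pairD(1)[OF T(2)]])
  from has_commutatorI[OF adjoint_pair_sym[OF assms(2)] this] show ?thesis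
    by (simp add: T(3) T(4)[unfolded S])
qed

lemma has_commutator_scaleC: "has_commutator (\<lambda>x. c *\<^sub>C x)"
  by (rule has_commutatorI[OF adjoint_pair_scaleC[of c] adjoint_pair_scaleC[of 0]]) (simp_all add: dom_scaleC)

lemma has_commutator_add:
  assumes "has_commutator T" "has_commutator T'"
  shows "has_commutator (\<lambda>x. T x + T' x)"
proof -
  obtain S B C S' B' C' where "commutator_data T S B C" "commutator_data T' S' B' C'"
    using assms unfolding has_commutator_def by blast
  note T = commutator_dataD[OF this(1)] and T' = commutator_dataD[OF this(2)]
  show ?thesis
    by (rule has_commutatorI[OF adjoint_pair_add[OF T(1) T'(1)] adjoint_pair_add[OF T(2) T'(2)]])
      (simp_all add: T(3,4) T'(3,4) dom_add)
qed

text \<open>The Leibniz rule \<open>[D, T T'] = T [D, T'] + [D, T] T'\<close>; its adjoint supplies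
  the data for the adjoint of the product.\<close>

lemma has_commutator_compose:
  assumes "has_commutator T" "has_commutator T'"
  shows "has_commutator (T \<circ> T')"
proof -
  obtain S B C S' B' C' where "commutator_data T S B C" "commutator_data T' S' B' C'"
    using assms unfolding has_commutator_def by blast
  note T = commutator_dataD[OF this(1)] and T' = commutator_dataD[OF this(2)]
  note lin = bounded_clinear_simps[OF adjoint_pairD(1)[OF T(1)]] bounded_clinear_simps[OF adjoint_pairD(2)[OF T'(1)]]
  show ?thesis
    by (rule has_commutatorI[OF adjoint_pair_compose[OF T(1) T'(1)]
          adjoint_pair_add[OF adjoint_pair_compose[OF T(1) T'(2)] adjoint_pair_compose[OF T(2) T'(1)]]])
      (simp_all add: T(3,4) T'(3,4) lin)
qed

text \<open>The formal commutator has the entries of \<open>T\<close> multiplied by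
  \<open>d m - d n\<close>, again a bounded band matrix, which defines \<open>B\<close>. That
  \<open>S\<close> and \<open>T\<close> preserve the whole domain follows from the symmetry of
  \<open>D\<close>: knowing it for all \<open>T (e n)\<close> gives it for \<open>S x\<close>, and
  then knowing it for all \<open>S (e n)\<close> gives it for \<open>T x\<close>.\<close>

lemma has_commutator_if_band:
  assumes T: "adjoint_pair T S"
    and bound: "\<And>m n. cmod ((d m - d n) * crd (T (e n)) m) \<le> C"
    and rows: "\<And>m. finite {n. crd (T (e n)) m \<noteq> 0}" "\<And>m. card {n. crd (T (e n)) m \<noteq> 0} \<le> N"
    and cols: "\<And>n. finite {m. crd (T (e n)) m \<noteq> 0}" "\<And>n. card {m. crd (T (e n)) m \<noteq> 0} \<le> N"
  shows "has_commutator T"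
proof -
  let ?M = "\<lambda>m n. (d m - d n) * crd (T (e n)) m"
  have rows': "finite {n. ?M m n \<noteq> 0}" "card {n. ?M m n \<noteq> 0} \<le> N" for m
  proof -
    have *: "{n. ?M m n \<noteq> 0} \<subseteq> {n. crd (T (e n)) m \<noteq> 0}" by auto
    show "finite {n. ?M m n \<noteq> 0}" by (rule finite_subset[OF * rows(1)])
    show "card {n. ?M m n \<noteq> 0} \<le> N" by (rule order_trans[OF card_mono[OF rows(1) *] rows(2)])
  qed
  have cols': "finite {m. ?M m n \<noteq> 0}" "card {m. ?M m n \<noteq> 0} \<le> N" for n
  proof -
    have *: "{m. ?M m n \<noteq> 0} \<subseteq> {m. crd (T (e n)) m \<noteq> 0}" by auto
    show "finite {m. ?M m n \<noteq> 0}" by (rule finite_subset[OF * cols(1)])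
    show "card {m. ?M m n \<noteq> 0} \<le> N" by (rule order_trans[OF card_mono[OF cols(1) *] cols(2)])
  qed
  obtain B0 B0' where B0: "adjoint_pair B0 B0'" "\<And>n m. ell2_coeff (B0 (ket n)) m = ?M m n"
    using band_adjoint_pair[of ?M C N] bound rows' cols' by metis
  define B B' where "B = W \<circ> (B0 \<circ> V)" and "B' = (W \<circ> B0') \<circ> V"
  have B: "adjoint_pair B B'"
    unfolding B_def B'_def by (intro adjoint_pair_compose B0 VW adjoint_pair_sym[OF VW])
  have crd_B: "crd (B (e n)) m = ?M m n" for m n by (simp add: B_def V_e B0)
  have T_e: "T (e n) \<in> dom D" "app D (T (e n)) = B (e n) + of_real (d n) *\<^sub>C T (e n)" for n
    using domI[of "T (e n)" "B (e n) + of_real (d n) *\<^sub>C T (e n)"]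
    by (auto simp: V_lin crd_B algebra_simps)
  have S: "S x \<in> dom D" "app D (S x) = S (app D x) - B' x" if x: "x \<in> dom D" for x
  proof -
    have "d n * crd (S x) n = crd (S (app D x) - B' x) n" for n
    proof -
      have "crd (S (app D x)) n = cinner (app D (T (e n))) x"
        by (simp add: cinner_e[symmetric] adjoint_pairD(4)[OF T, symmetric] symmetric T_e(1) x)
      also have "\<dots> = crd (B' x) n + d n * crd (S x) n"
        by (simp add: T_e(2) cinner_add_left cinner_scaleC_left adjoint_pairD(4)[OF T]
            adjoint_pairD(4)[OF B] cinner_e)
      finally show ?thesis by (simp add: V_lin)
    qed
    from domI[OF this] show "S x \<in> dom D" "app D (S x) = S (app D x) - B' x" by auto
  qed
  have "T x \<in> dom D" "app D (T x) = T (app D x) + B x" if x: "x \<in> dom D" for x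
  proof -
    have "d n * crd (T x) n = crd (T (app D x) + B x) n" for n
    proof -
      have "d n * crd (T x) n = cinner (app D (e n)) (T x)"
        by (simp add: e_in_dom cinner_scaleC_left cinner_e)
      also have "\<dots> = cinner (app D (S (e n))) x + cinner (B' (e n)) x"
        by (simp add: adjoint_pairD(3)[OF T, symmetric] S(2)[OF e_in_dom(1)] cinner_add_left[symmetric])
      also have "\<dots> = crd (T (app D x) + B x) n"
        by (simp add: symmetric S(1) e_in_dom(1) x adjoint_pairD(3)[OF T] adjoint_pairD(3)[OF B] cinner_e V_lin)
      finally show ?thesis .
    qed
    from domI[OF this] show "T x \<in> dom D" "app D (T x) = T (app D x) + B x" by auto
  qed
  then show ?thesis by (intro has_commutatorI[OF T B]) (simp_all add: S)
qed

end


section \<open>The relations of SU_q(2)\<close>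

definition valid_lmn :: "real \<Rightarrow> real \<Rightarrow> real \<Rightarrow> bool" where
  "valid_lmn l m n \<longleftrightarrow> 2 * l \<in> \<nat> \<and> l + m \<in> \<nat> \<and> l - m \<in> \<nat> \<and> l + n \<in> \<nat> \<and> l - n \<in> \<nat>"

lemma range_Rep_lmn: "range Rep_lmn = {(l, m, n). valid_lmn l m n}"
  using type_definition.Rep_range[OF type_definition_lmn] by (simp add: valid_lmn_def)

lemma valid_Rep_lmn: "Rep_lmn i = (l, m, n) \<Longrightarrow> valid_lmn l m n"
  using range_Rep_lmn by (metis (mono_tags, lifting) case_prod_conv mem_Collect_eq rangeI)

text \<open>For indices out of range both sides are 0, since no element of the index type represents
  the triple; so shifted kets can be handled uniformly.\<close>

lemma ell2_coeff_ket_lmn: "ell2_coeff (ket_lmn l m n) k = (if Rep_lmn k = (l, m, n) then 1 else 0)"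
proof (cases "(l, m, n) \<in> range Rep_lmn")
  case True
  then show ?thesis
    by (metis Rep_lmn_inverse ell2_coeff_ket f_inv_into_f ket_lmn_def)
next
  case False
  then have "Rep_lmn k \<noteq> (l, m, n)" by (metis rangeI)
  then show ?thesis using False by (simp add: ket_lmn_def)
qed

lemma ket_lmn_Rep: "Rep_lmn i = (l, m, n) \<Longrightarrow> ket_lmn l m n = ket i"
  by (rule ell2_eqI) (auto simp: ell2_coeff_ket_lmn ell2_coeff_ket Rep_lmn_inject[symmetric])

lemma ket_lmn_cases:
  assumes "valid_lmn l m n"
  obtains i where "Rep_lmn i = (l, m, n)" "ket_lmn l m n = ket i"
proof -
  have "(l, m, n) \<in> range Rep_lmn" using assms by (simp add: range_Rep_lmn)
  then show thesis using that ket_lmn_Rep by (metis rangeE)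
qed

lemma Nats_plus_one: "(x::real) \<in> \<nat> \<Longrightarrow> x + 1 \<in> \<nat>"
  by (intro Nats_add) auto

lemma Nats_minus_one: "(x::real) \<in> \<nat> \<Longrightarrow> x \<noteq> 0 \<Longrightarrow> x - 1 \<in> \<nat>"
proof -
  assume "x \<in> \<nat>" "x \<noteq> 0"
  then obtain k where "x = real (Suc k)" by (metis Nats_cases not0_implies_Suc of_nat_0)
  then show ?thesis by simp
qed

lemma valid_lmn_up:
  assumes "valid_lmn l m n" "s = 1/2 \<or> s = -1/2" "t = 1/2 \<or> t = -1/2"
  shows "valid_lmn (l + 1/2) (m + s) (n + t)"
proof -
  have *: "2 * l + 1 \<in> \<nat>" "l + m + 1 \<in> \<nat>" "l - m + 1 \<in> \<nat>" "l + n + 1 \<in> \<nat>" "l - n + 1 \<in> \<nat>"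
    using assms(1) Nats_plus_one by (auto simp: valid_lmn_def)
  show ?thesis
    using assms(2,3) by (elim disjE; hypsubst) (use * assms(1) in \<open>simp_all add: valid_lmn_def algebra_simps\<close>)
qed

text \<open>The equation \<open>l = 2 * s * m\<close> says that \<open>m\<close> is at the end of
  its range towards which \<open>s\<close> points. Away from such ends for \<open>m\<close> and
  \<open>n\<close> there is room to lower \<open>l\<close>; in particular \<open>l\<close> is not
  0.\<close>

lemma valid_lmn_down:
  assumes "valid_lmn l m n" "s = 1/2 \<or> s = -1/2" "t = 1/2 \<or> t = -1/2"
    and "l \<noteq> 2 * s * m" "l \<noteq> 2 * t * n"
  shows "valid_lmn (l - 1/2) (m + s) (n + t)"
proof -
  have "0 \<le> x" if "x \<in> \<nat>" for x :: real using that by (auto elim: Nats_cases)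
  then have nn: "0 \<le> l + m" "0 \<le> l - m" using assms(1) unfolding valid_lmn_def by blast+
  have s: "s = 1/2 \<and> l - m - 1 \<in> \<nat> \<or> s = -1/2 \<and> l + m - 1 \<in> \<nat>"
    using assms(2)
  proof
    assume s: "s = 1/2"
    have "l - m \<noteq> 0" using assms(4) unfolding s by simp
    then show ?thesis using s assms(1) Nats_minus_one[of "l - m"] unfolding valid_lmn_def by blast
  next
    assume s: "s = -1/2"
    have "l + m \<noteq> 0" using assms(4) unfolding s by simp
    then show ?thesis using s assms(1) Nats_minus_one[of "l + m"] unfolding valid_lmn_def by blast
  qed
  have t: "t = 1/2 \<and> l - n - 1 \<in> \<nat> \<or> t = -1/2 \<and> l + n - 1 \<in> \<nat>"
    using assms(3)
  proof
    assume t: "t = 1/2"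
    have "l - n \<noteq> 0" using assms(5) unfolding t by simp
    then show ?thesis using t assms(1) Nats_minus_one[of "l - n"] unfolding valid_lmn_def by blast
  next
    assume t: "t = -1/2"
    have "l + n \<noteq> 0" using assms(5) unfolding t by simp
    then show ?thesis using t assms(1) Nats_minus_one[of "l + n"] unfolding valid_lmn_def by blast
  qed
  have "2 * l \<noteq> 0" using nn assms(2,4) by auto
  then have "2 * l - 1 \<in> \<nat>" using assms(1) Nats_minus_one[of "2 * l"] by (auto simp: valid_lmn_def)
  then show ?thesis
    using s t by (elim disjE conjE; hypsubst) (use assms(1) in \<open>simp_all add: valid_lmn_def algebra_simps\<close>)
qed

lemma valid_lmn_bounds:
  assumes "valid_lmn l m n"
  shows "0 \<le> l" "- l \<le> m" "m \<le> l" "- l \<le> n" "n \<le> l"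
proof -
  have "0 \<le> x" if "x \<in> \<nat>" for x :: real using that by (auto elim: Nats_cases)
  then have "0 \<le> 2 * l" "0 \<le> l + m" "0 \<le> l - m" "0 \<le> l + n" "0 \<le> l - n"
    using assms unfolding valid_lmn_def by blast+
  then show "0 \<le> l" "- l \<le> m" "m \<le> l" "- l \<le> n" "n \<le> l" by auto
qed

text \<open>Both generators and their adjoints change \<open>l\<close>, \<open>m\<close>, \<open>n\<close> by \<open>\<plusminus>1/2\<close>, where the changes \<open>s\<close>
  of \<open>m\<close> and \<open>t\<close> of \<open>n\<close> are fixed.\<close>

definition ladder_vec ::
  "real \<Rightarrow> real \<Rightarrow> (real \<Rightarrow> real \<Rightarrow> real \<Rightarrow> real) \<Rightarrow> (real \<Rightarrow> real \<Rightarrow> real \<Rightarrow> real) \<Rightarrow>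
     real \<Rightarrow> real \<Rightarrow> real \<Rightarrow> lmn ell2" where
  "ladder_vec s t u d l m n =
     of_real (u l m n) *\<^sub>C ket_lmn (l + 1/2) (m + s) (n + t)
   + of_real (d l m n) *\<^sub>C ket_lmn (l - 1/2) (m + s) (n + t)"

definition ladder where
  "ladder s t u d = extend_basis (\<lambda>i. case Rep_lmn i of (l, m, n) \<Rightarrow> ladder_vec s t u d l m n)"

text \<open>Transposition exchanges raising and lowering, so the adjoint has the old coefficients in
  exchanged roles, each evaluated at the target of its move.\<close>

lemma adjoint_pair_ladder:
  assumes u: "\<And>l m n. valid_lmn l m n \<Longrightarrow> \<bar>u l m n\<bar> \<le> C" and d: "\<And>l m n. valid_lmn l m n \<Longrightarrow> \<bar>d l m n\<bar> \<le> C"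
  shows "adjoint_pair (ladder s t u d)
    (ladder (- s) (- t) (\<lambda>l m n. d (l + 1/2) (m - s) (n - t)) (\<lambda>l m n. u (l - 1/2) (m - s) (n - t)))"
  (is "adjoint_pair _ (ladder _ _ ?u ?d)")
  unfolding ladder_def
proof (rule adjoint_pair_extend_basis[where C = "C + C" and N = 2])
  have Rep_iff: "Rep_lmn i = p \<longleftrightarrow> i = Abs_lmn p" if "p \<in> range Rep_lmn" for i p
    using that by (metis Rep_lmn_inverse rangeE)
  have supp: "finite {k. ell2_coeff (ladder_vec s t u d l m n) k \<noteq> 0}"
    "card {k. ell2_coeff (ladder_vec s t u d l m n) k \<noteq> 0} \<le> 2" for s t u d l m n
  proof -
    have *: "{k. ell2_coeff (ladder_vec s t u d l m n) k \<noteq> 0}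
      \<subseteq> {Abs_lmn (l + 1/2, m + s, n + t), Abs_lmn (l - 1/2, m + s, n + t)}"
    proof
      fix k assume "k \<in> {k. ell2_coeff (ladder_vec s t u d l m n) k \<noteq> 0}"
      then have "Rep_lmn k = (l + 1/2, m + s, n + t) \<or> Rep_lmn k = (l - 1/2, m + s, n + t)"
        by (auto simp: ladder_vec_def ell2_coeff_ket_lmn split: if_splits)
      then show "k \<in> {Abs_lmn (l + 1/2, m + s, n + t), Abs_lmn (l - 1/2, m + s, n + t)}"
        by (metis Rep_lmn_inverse insertCI)
    qed
    show "finite {k. ell2_coeff (ladder_vec s t u d l m n) k \<noteq> 0}" by (rule finite_subset[OF *]) simp
    have "card {k. ell2_coeff (ladder_vec s t u d l m n) k \<noteq> 0}
      \<le> card {Abs_lmn (l + 1/2, m + s, n + t), Abs_lmn (l - 1/2, m + s, n + t)}"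
      by (rule card_mono[OF _ *]) simp
    then show "card {k. ell2_coeff (ladder_vec s t u d l m n) k \<noteq> 0} \<le> 2"
      using card_insert_le_m1[of 2 "{Abs_lmn (l - 1/2, m + s, n + t)}" "Abs_lmn (l + 1/2, m + s, n + t)"]
      by simp
  qed
  show "finite {k. ell2_coeff (case Rep_lmn i of (l, m, n) \<Rightarrow> ladder_vec s t u d l m n) k \<noteq> 0}"
    "card {k. ell2_coeff (case Rep_lmn i of (l, m, n) \<Rightarrow> ladder_vec s t u d l m n) k \<noteq> 0} \<le> 2"
    "finite {k. ell2_coeff (case Rep_lmn i of (l, m, n) \<Rightarrow> ladder_vec (- s) (- t) ?u ?d l m n) k \<noteq> 0}"
    "card {k. ell2_coeff (case Rep_lmn i of (l, m, n) \<Rightarrow> ladder_vec (- s) (- t) ?u ?d l m n) k \<noteq> 0} \<le> 2" for i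
    using supp by (simp_all split: prod.splits)
  show "ell2_coeff (case Rep_lmn k of (l, m, n) \<Rightarrow> ladder_vec (- s) (- t) ?u ?d l m n) i
      = cnj (ell2_coeff (case Rep_lmn i of (l, m, n) \<Rightarrow> ladder_vec s t u d l m n) k)" for i k
  proof -
    obtain l m n l' m' n' where i: "Rep_lmn i = (l, m, n)" and k: "Rep_lmn k = (l', m', n')"
      by (metis prod_cases3)
    consider "l' = l + 1/2 \<and> m' = m + s \<and> n' = n + t" | "l' = l - 1/2 \<and> m' = m + s \<and> n' = n + t"
      | "\<not> (l' = l + 1/2 \<and> m' = m + s \<and> n' = n + t)" "\<not> (l' = l - 1/2 \<and> m' = m + s \<and> n' = n + t)"
      by blast
    then show ?thesis
    proof cases
      case 3
      then have "\<not> (l = l' - 1/2 \<and> m = m' - s \<and> n = n' - t)" "\<not> (l = l' + 1/2 \<and> m = m' - s \<and> n = n' - t)"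
        by auto
      with 3 show ?thesis by (auto simp: i k ladder_vec_def ell2_coeff_ket_lmn)
    qed (auto simp: i k ladder_vec_def ell2_coeff_ket_lmn)
  qed
  show "cmod (ell2_coeff (case Rep_lmn i of (l, m, n) \<Rightarrow> ladder_vec s t u d l m n) k) \<le> C + C" for i k
  proof -
    obtain l m n where i: "Rep_lmn i = (l, m, n)" by (metis prod_cases3)
    have C: "0 \<le> C" using u[OF valid_Rep_lmn[OF i]] by linarith
    have "cmod (ell2_coeff (ladder_vec s t u d l m n) k) \<le> \<bar>u l m n\<bar> + \<bar>d l m n\<bar>"
      by (auto simp: ladder_vec_def ell2_coeff_ket_lmn)
    then show ?thesis using u[OF valid_Rep_lmn[OF i]] d[OF valid_Rep_lmn[OF i]] by (simp add: i)
  qed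
qed

lemma ladder_ket:
  assumes "valid_lmn l m n"
  shows "ladder s t u d (ket_lmn l m n) = ladder_vec s t u d l m n"
  using assms by (rule ket_lmn_cases) (simp add: ladder_def extend_basis_ket)

text \<open>The ket with unchanged \<open>l\<close> is reached along two paths, up then down and
  down then up. If lowering leaves the range, the second operator cannot be expanded at the lowered
  indices, and the hypothesis on \<open>d\<close> removes that path.\<close>

lemma ladder_ladder_ket:
  assumes lin: "bounded_clinear (ladder s' t' u' d')" and valid: "valid_lmn l m n"
    and st: "s = 1/2 \<or> s = -1/2" "t = 1/2 \<or> t = -1/2"
    and d: "l = 2 * s * m \<or> l = 2 * t * n \<Longrightarrow> d l m n = 0"
  shows "ladder s' t' u' d' (ladder s t u d (ket_lmn l m n)) =
    of_real (u l m n * u' (l + 1/2) (m + s) (n + t)) *\<^sub>C ket_lmn (l + 1) (m + s + s') (n + t + t')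
  + complex_of_real (u l m n * d' (l + 1/2) (m + s) (n + t) + d l m n * u' (l - 1/2) (m + s) (n + t))
      *\<^sub>C ket_lmn l (m + s + s') (n + t + t')
  + of_real (d l m n * d' (l - 1/2) (m + s) (n + t)) *\<^sub>C ket_lmn (l - 1) (m + s + s') (n + t + t')"
proof -
  note lin = bounded_clinear_simps[OF lin]
  have "d l m n = 0 \<or> valid_lmn (l - 1/2) (m + s) (n + t)"
    using d valid_lmn_down[OF valid st] by blast
  then have down: "of_real (d l m n) *\<^sub>C ladder s' t' u' d' (ket_lmn (l - 1/2) (m + s) (n + t))
    = of_real (d l m n) *\<^sub>C ladder_vec s' t' u' d' (l - 1/2) (m + s) (n + t)"
    using ladder_ket by auto
  show ?thesis
    unfolding ladder_ket[OF valid] unfolding ladder_vec_def[of s] lin(1,2) down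
      ladder_ket[OF valid_lmn_up[OF valid st]]
    by (simp add: ladder_vec_def scaleC_add_right scaleC_add_left scaleC_scaleC algebra_simps)
qed

lemma pi_gen_eq_ladder:
  "pi_gen q gen_a = ladder (1/2) (1/2) (A_plus q) (A_minus q)"
  "pi_gen q gen_b = ladder (1/2) (-1/2) (B_plus q) (B_minus q)"
  unfolding ladder_def ladder_vec_def by simp_all


section \<open>Algebra of q-numbers\<close>

locale suq2 =
  fixes q :: real
  assumes q: "0 < q" "q < 1"
begin

abbreviation "qn \<equiv> qnum q"
abbreviation "Ap \<equiv> A_plus q"
abbreviation "Am \<equiv> A_minus q"
abbreviation "Bp \<equiv> B_plus q"
abbreviation "Bm \<equiv> B_minus q"

lemma q_inverse: "q - inverse q < 0"
  using q by (simp add: less_trans[OF q(2)] one_less_inverse)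

lemma qnum_eq: "qn x = (q powr x - 1 / q powr x) / (q - 1 / q)"
  by (simp add: qnum_def powr_minus divide_inverse)

lemma qnum_0 [simp]: "qn 0 = 0"
  by (simp add: qnum_def q less_imp_neq)

lemma qnum_pos: "0 < x \<Longrightarrow> 0 < qn x"
  unfolding qnum_def using q q_inverse powr_less_mono'[of q "- x" x]
  by (intro divide_neg_neg) auto

lemma qnum_nonneg: "0 \<le> x \<Longrightarrow> 0 \<le> qn x"
  using qnum_pos[of x] by (cases "x = 0") auto

text \<open>For middle coefficients: in the product along one path a q-number and the denominator
  occur twice under the root and come out as \<open>t\<close>; the rest \<open>z\<close> is common
  to all paths of a relation.\<close>

lemma mult_sqrt:
  assumes "x1 * x2 = z * t\<^sup>2" "0 \<le> t" "e1 + e2 = e"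
  shows "(q powr e1 * sqrt x1) * (q powr e2 * sqrt x2) = q powr e * (sqrt z * t)"
proof -
  have "(q powr e1 * sqrt x1) * (q powr e2 * sqrt x2) = (q powr e1 * q powr e2) * sqrt (x1 * x2)"
    by (simp add: real_sqrt_mult)
  then show ?thesis using assms by (simp add: real_sqrt_mult powr_add[symmetric])
qed

lemma square_sqrt:
  assumes "0 \<le> x" "2 * e = e'"
  shows "(q powr e * sqrt x) * (q powr e * sqrt x) = q powr e' * x"
  using assms(1) q powr_add[of q e e] assms(2)[symmetric] by (simp add: ac_simps)

text \<open>For outer coefficients: on the two sides of a relation the products under the root
  agree, and only the powers of \<open>q\<close> differ.\<close>

lemma mult_sqrt_cong:
  assumes "x1 * x2 = x3 * x4" "e1 + e2 = e0 + (e3 + e4)"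
  shows "(q powr e1 * sqrt x1) * (q powr e2 * sqrt x2)
    = q powr e0 * ((q powr e3 * sqrt x3) * (q powr e4 * sqrt x4))"
proof -
  have *: "(q powr a * sqrt x) * (q powr b * sqrt y) = q powr (a + b) * sqrt (x * y)" for a b x y
    by (simp add: real_sqrt_mult powr_add)
  show ?thesis unfolding * assms by (simp add: powr_add)
qed

lemma powr_simps:
  "q powr (x + y) = q powr x * q powr y" "q powr (x - y) = q powr x / q powr y"
  "q powr (- x) = 1 / q powr x" "q powr (2 * x) = (q powr x)\<^sup>2" "q powr 1 = q" "q powr 2 = q\<^sup>2"
  using q by (simp_all add: powr_add powr_diff powr_minus divide_inverse powr_powr[symmetric] mult.commute[of 2])

text \<open>After clearing \<open>q - 1 / q\<close> this is an identity of Laurent polynomials in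
  \<open>q\<close>, \<open>q powr l\<close>, \<open>q powr n\<close>; the next ones are proved
  alike. It is what the middle coefficient of \<open>ba = qab\<close>, and with \<open>m\<close> for
  \<open>n\<close> that of \<open>b*a = qab*\<close>, becomes over a common denominator.\<close>

lemma qnum_identity_1:
  "q powr (l + 1) * qn (l - n) * qn (2 * l + 2) - q powr (- l) * qn (l + n + 1) * qn (2 * l)
    = q * (q powr (l + 1) * qn (l - n + 1) * qn (2 * l) - q powr (- l) * qn (l + n) * qn (2 * l + 2))"
proof -
  define L N k where "L = q powr l" and "N = q powr n" and "k = q - 1 / q"
  have "0 < L" "0 < N" "k \<noteq> 0" using q q_inverse by (auto simp: L_def N_def k_def divide_inverse)
  then show ?thesis
    unfolding qnum_eq powr_simps L_def[symmetric] N_def[symmetric] k_def[symmetric]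
    using q by (simp add: field_simps) (simp add: power2_eq_square power_numeral_reduce algebra_simps)
qed

text \<open>The middle coefficient of \<open>bb* = b*b\<close> over a common denominator.\<close>

lemma qnum_identity_2:
  "qn (l - m + 1) * qn (l + n + 1) * qn (2 * l) + qn (l + m) * qn (l - n) * qn (2 * l + 2)
    = qn (l + m + 1) * qn (l - n + 1) * qn (2 * l) + qn (l - m) * qn (l + n) * qn (2 * l + 2)"
proof -
  define L M N k where "L = q powr l" and "M = q powr m" and "N = q powr n" and "k = q - 1 / q"
  have "0 < L" "0 < M" "0 < N" "k \<noteq> 0" using q q_inverse by (auto simp: L_def M_def N_def k_def divide_inverse)
  then show ?thesis
    unfolding qnum_eq powr_simps L_def[symmetric] M_def[symmetric] N_def[symmetric] k_def[symmetric]
    using q by (simp add: field_simps) (simp add: power2_eq_square power_numeral_reduce algebra_simps)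
qed

text \<open>In the two relations with right-hand side 1, this merges the contributions of
  \<open>a\<close> and \<open>b\<close> with the same change of \<open>l\<close>, so that one factor
  of the denominator cancels.\<close>

lemma qnum_identity_3:
  "q powr (- (2 * l)) * qn (l + n) + qn (l - n) = q powr (- l - n) * qn (2 * l)"
proof -
  define L N k where "L = q powr l" and "N = q powr n" and "k = q - 1 / q"
  have "0 < L" "0 < N" "k \<noteq> 0" using q q_inverse by (auto simp: L_def N_def k_def divide_inverse)
  then show ?thesis
    unfolding qnum_eq powr_simps L_def[symmetric] N_def[symmetric] k_def[symmetric]
    using q by (simp add: field_simps) (simp add: power2_eq_square power_numeral_reduce algebra_simps)
qed

text \<open>The last step in those relations: the two merged contributions add up to the remaining
  denominator \<open>[2l + 1]\<close>.\<close>

lemma qnum_identity_4: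
  "q powr (m - l - 1) * qn (l + m) + q powr (l + m) * qn (l - m + 1) = qn (2 * l + 1)"
proof -
  define L N k where "L = q powr l" and "N = q powr m" and "k = q - 1 / q"
  have "0 < L" "0 < N" "k \<noteq> 0" using q q_inverse by (auto simp: L_def N_def k_def divide_inverse)
  then show ?thesis
    unfolding qnum_eq powr_simps L_def[symmetric] N_def[symmetric] k_def[symmetric]
    using q by (simp add: field_simps) (simp add: power2_eq_square power_numeral_reduce algebra_simps)
qed

lemma qnum_identity_3':
  "q powr (2 * l) * qn (l - n) + qn (l + n) = q powr (l - n) * qn (2 * l)"
proof -
  have "q powr (2 * l) * qn (l - n) + qn (l + n)
      = q powr (2 * l) * (q powr (- (2 * l)) * qn (l + n) + qn (l - n))"
    using q by (simp add: algebra_simps powr_minus)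
  also have "\<dots> = q powr (l - n) * qn (2 * l)"
    unfolding qnum_identity_3 by (simp add: powr_add[symmetric])
  finally show ?thesis .
qed

text \<open>The outer coefficients of all five relations, where \<open>l\<close> changes by 1. Only
  one path leads there, so each equation is one between single products of roots.\<close>

lemma
  shows up_ba: "Ap l m n * Bp (l + 1/2) (m + 1/2) (n + 1/2)
    = q powr 1 * (Bp l m n * Ap (l + 1/2) (m + 1/2) (n - 1/2))"
    and down_ba: "Am l m n * Bm (l - 1/2) (m + 1/2) (n + 1/2)
    = q powr 1 * (Bm l m n * Am (l - 1/2) (m + 1/2) (n - 1/2))"
    and up_Ba: "Ap l m n * Bm (l + 1) m (n + 1)
    = q powr 1 * (Bm (l + 1/2) (m - 1/2) (n + 1/2) * Ap (l + 1/2) (m - 1/2) (n + 1/2))"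
    and down_Ba: "Am l m n * Bp (l - 1) m (n + 1)
    = q powr 1 * (Bp (l - 1/2) (m - 1/2) (n + 1/2) * Am (l - 1/2) (m - 1/2) (n + 1/2))"
    and up_bB: "Bm (l + 1/2) (m - 1/2) (n + 1/2) * Bp (l + 1/2) (m - 1/2) (n + 1/2)
    = q powr 0 * (Bp l m n * Bm (l + 1) m n)"
    and down_bB: "Bp (l - 1/2) (m - 1/2) (n + 1/2) * Bm (l - 1/2) (m - 1/2) (n + 1/2)
    = q powr 0 * (Bm l m n * Bp (l - 1) m n)"
    and up_Aa: "Ap l m n * Am (l + 1) m n = q powr 2 * - (Bp l m n * Bm (l + 1) m n)"
    and down_Aa: "Am l m n * Ap (l - 1) m n = q powr 2 * - (Bm l m n * Bp (l - 1) m n)"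
    and up_aA: "Am (l + 1/2) (m - 1/2) (n - 1/2) * Ap (l + 1/2) (m - 1/2) (n - 1/2)
    = q powr 0 * - (Bm (l + 1/2) (m - 1/2) (n + 1/2) * Bp (l + 1/2) (m - 1/2) (n + 1/2))"
    and down_aA: "Ap (l - 1/2) (m - 1/2) (n - 1/2) * Am (l - 1/2) (m - 1/2) (n - 1/2)
    = q powr 0 * - (Bp (l - 1/2) (m - 1/2) (n + 1/2) * Bm (l - 1/2) (m - 1/2) (n + 1/2))"
  unfolding A_plus_def A_minus_def B_plus_def B_minus_def mult_minus_left mult_minus_right minus_minus neg_equal_iff_equal
  by (rule mult_sqrt_cong; simp add: algebra_simps; (simp add: field_simps)?)+

text \<open>Here \<open>h0\<close>, \<open>h1\<close>, \<open>h2\<close> stand for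
  \<open>[2l]\<close>, \<open>[2l + 1]\<close>, \<open>[2l + 2]\<close>, while \<open>u\<close> and
  \<open>v\<close> are the powers of \<open>q\<close> that distinguish the two paths.\<close>

lemma common_denominator:
  fixes h0 h1 h2 :: real
  assumes "h0 \<noteq> 0" "h1 \<noteq> 0" "h2 \<noteq> 0"
    and "v * x2 * h2 - u * x1 * h0 = k * (v * x3 * h0 - u * x4 * h2)"
  shows "c * v * (s * (x2 / (h0 * h1))) - c * u * (s * (x1 / (h1 * h2)))
    = k * (c * v * (s * (x3 / (h1 * h2))) - c * u * (s * (x4 / (h0 * h1))))"
proof -
  have "c * v * (s * (x2 / (h0 * h1))) - c * u * (s * (x1 / (h1 * h2)))
      = c * s / (h0 * h1 * h2) * (v * x2 * h2 - u * x1 * h0)"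
    using assms(1-3) by (simp add: field_simps)
  also have "\<dots> = c * s / (h0 * h1 * h2) * (k * (v * x3 * h0 - u * x4 * h2))"
    unfolding assms(4) ..
  also have "\<dots> = k * (c * v * (s * (x3 / (h1 * h2))) - c * u * (s * (x4 / (h0 * h1))))"
    using assms(1-3) by (simp add: field_simps)
  finally show ?thesis .
qed

section \<open>Coefficients of the relations at unchanged \<open>l\<close>\<close>

context
  fixes l m n :: real
  assumes lmn: "0 \<le> l" "- l \<le> m" "m \<le> l" "- l \<le> n" "n \<le> l"
begin

lemma mid_ba:
  "Ap l m n * Bm (l + 1/2) (m + 1/2) (n + 1/2) + Am l m n * Bp (l - 1/2) (m + 1/2) (n + 1/2)
    = q * (Bp l m n * Am (l + 1/2) (m + 1/2) (n - 1/2) + Bm l m n * Ap (l - 1/2) (m + 1/2) (n - 1/2))"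
proof -
  define z where "z = qn (l + m + 1) * qn (l - m)"
  define h0 h1 h2 where "h0 = qn (2 * l)" and "h1 = qn (2 * l + 1)" and "h2 = qn (2 * l + 2)"
  note defs = A_plus_def A_minus_def B_plus_def B_minus_def mult_minus_left mult_minus_right z_def h0_def h1_def h2_def
  have 1: "Ap l m n * Bm (l + 1/2) (m + 1/2) (n + 1/2)
    = - (q powr ((m + n - 1/2) + (- l)) * (sqrt z * (qn (l + n + 1) / (h1 * h2))))"
    and 2: "Am l m n * Bp (l - 1/2) (m + 1/2) (n + 1/2)
    = q powr ((m + n - 1/2) + (l + 1)) * (sqrt z * (qn (l - n) / (h0 * h1)))"
    and 3: "Bp l m n * Am (l + 1/2) (m + 1/2) (n - 1/2)
    = q powr ((m + n - 1/2) + (l + 1)) * (sqrt z * (qn (l - n + 1) / (h1 * h2)))"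
    and 4: "Bm l m n * Ap (l - 1/2) (m + 1/2) (n - 1/2)
    = - (q powr ((m + n - 1/2) + (- l)) * (sqrt z * (qn (l + n) / (h0 * h1))))"
    unfolding defs neg_equal_iff_equal
    by (rule mult_sqrt; use lmn in \<open>simp add: algebra_simps power2_eq_square qnum_nonneg; (simp add: field_simps)?\<close>)+
  show ?thesis
  \<comment> \<open>For \<open>l = 0\<close> the denominator \<open>[2l]\<close> vanishes, but then
    \<open>m = 0\<close> and \<open>z = 0\<close>, so all four products are 0.\<close>
  proof (cases "l = 0")
    case True
    then have "z = 0" using lmn by (simp add: z_def)
    then show ?thesis unfolding 1 2 3 4 by simp
  next
    case False
    then have "h0 \<noteq> 0" "h1 \<noteq> 0" "h2 \<noteq> 0"
      using lmn qnum_pos[of "2 * l"] qnum_pos[of "2 * l + 1"] qnum_pos[of "2 * l + 2"]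
      by (auto simp: h0_def h1_def h2_def)
    from common_denominator[OF this qnum_identity_1[of l n, folded h0_def h2_def],
        of "q powr (m + n - 1/2)" "sqrt z"]
    show ?thesis unfolding 1 2 3 4 powr_add[of q "m + n - 1/2"] by simp
  qed
qed

lemma mid_Ba:
  "Ap l m n * Bp l m (n + 1) + Am l m n * Bm l m (n + 1)
    = q * (Bm (l + 1/2) (m - 1/2) (n + 1/2) * Am (l + 1/2) (m - 1/2) (n + 1/2)
         + Bp (l - 1/2) (m - 1/2) (n + 1/2) * Ap (l - 1/2) (m - 1/2) (n + 1/2))"
proof -
  define z where "z = qn (l + n + 1) * qn (l - n)"
  define h0 h1 h2 where "h0 = qn (2 * l)" and "h1 = qn (2 * l + 1)" and "h2 = qn (2 * l + 2)"
  note defs = A_plus_def A_minus_def B_plus_def B_minus_def mult_minus_left mult_minus_right z_def h0_def h1_def h2_def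
  have 1: "Ap l m n * Bp l m (n + 1)
    = q powr ((m + n - 1/2) + (- l)) * (sqrt z * (qn (l + m + 1) / (h1 * h2)))"
    and 2: "Am l m n * Bm l m (n + 1)
    = - (q powr ((m + n - 1/2) + (l + 1)) * (sqrt z * (qn (l - m) / (h0 * h1))))"
    and 3: "Bm (l + 1/2) (m - 1/2) (n + 1/2) * Am (l + 1/2) (m - 1/2) (n + 1/2)
    = - (q powr ((m + n - 1/2) + (l + 1)) * (sqrt z * (qn (l - m + 1) / (h1 * h2))))"
    and 4: "Bp (l - 1/2) (m - 1/2) (n + 1/2) * Ap (l - 1/2) (m - 1/2) (n + 1/2)
    = q powr ((m + n - 1/2) + (- l)) * (sqrt z * (qn (l + m) / (h0 * h1)))"
    unfolding defs neg_equal_iff_equal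
    by (rule mult_sqrt; use lmn in \<open>simp add: algebra_simps power2_eq_square qnum_nonneg; (simp add: field_simps)?\<close>)+
  show ?thesis
  proof (cases "l = 0")
    case True
    then have "z = 0" using lmn by (simp add: z_def)
    then show ?thesis unfolding 1 2 3 4 by simp
  next
    case False
    then have "h0 \<noteq> 0" "h1 \<noteq> 0" "h2 \<noteq> 0"
      using lmn qnum_pos[of "2 * l"] qnum_pos[of "2 * l + 1"] qnum_pos[of "2 * l + 2"]
      by (auto simp: h0_def h1_def h2_def)
    \<comment> \<open>The signs are opposite to those in \<open>mid_ba\<close>; hence
      \<open>- sqrt z\<close>.\<close>
    from common_denominator[OF this qnum_identity_1[of l m, folded h0_def h2_def],
        of "q powr (m + n - 1/2)" "- sqrt z"]
    show ?thesis unfolding 1 2 3 4 powr_add[of q "m + n - 1/2"] by simp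
  qed
qed

lemma
  shows square_A_plus: "Ap l m n * Ap l m n
    = q powr (- 2 * l + m + n - 1) * (qn (l + m + 1) * qn (l + n + 1) / (qn (2 * l + 1) * qn (2 * l + 2)))"
    and square_A_minus: "Am l m n * Am l m n
    = q powr (2 * l + m + n + 1) * (qn (l - m) * qn (l - n) / (qn (2 * l) * qn (2 * l + 1)))"
    and square_B_plus: "Bp l m n * Bp l m n
    = q powr (m + n - 1) * (qn (l + m + 1) * qn (l - n + 1) / (qn (2 * l + 1) * qn (2 * l + 2)))"
    and square_B_minus: "Bm l m n * Bm l m n
    = q powr (m + n - 1) * (qn (l - m) * qn (l + n) / (qn (2 * l) * qn (2 * l + 1)))"
  unfolding A_plus_def A_minus_def B_plus_def B_minus_def mult_minus_left mult_minus_right minus_minus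
  by (rule square_sqrt; use lmn in \<open>simp add: qnum_nonneg\<close>)+

text \<open>\<open>A_plus\<close> is paired with \<open>B_plus\<close> and \<open>A_minus\<close>
  with \<open>B_minus\<close>, which have the same denominators. \<open>qnum_identity_3\<close> and
  its variant cancel \<open>[2l + 2]\<close> and \<open>[2l]\<close>, and
  \<open>qnum_identity_4\<close> at \<open>m + 1\<close> sums the rest to 1.\<close>

lemma mid_Aa:
  "Ap l m n * Ap l m n + Am l m n * Am l m n
    + q\<^sup>2 * (Bp l m n * Bp l m n + Bm l m n * Bm l m n) = 1"
proof -
  define h0 h1 h2 where "h0 = qn (2 * l)" and "h1 = qn (2 * l + 1)" and "h2 = qn (2 * l + 2)"
  have h: "h1 \<noteq> 0" "h2 \<noteq> 0"
    using lmn qnum_pos[of "2 * l + 1"] qnum_pos[of "2 * l + 2"] by (auto simp: h1_def h2_def)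
  have e1: "q powr (- 2 * l + m + n - 1) = q powr (m + n + 1) * q powr (- (2 * (l + 1)))"
    and e2: "q powr (2 * l + m + n + 1) = q powr (m + n + 1) * q powr (2 * l)"
    unfolding powr_add[symmetric] by (simp_all add: algebra_simps)
  have "q powr (m + n + 1) = q powr 2 * q powr (m + n - 1)"
    unfolding powr_add[symmetric] by (simp add: algebra_simps)
  then have e3: "q\<^sup>2 * (q powr (m + n - 1) * x) = q powr (m + n + 1) * x" for x
    by (simp add: powr_simps(6))
  note e = e1 e2 e3
  have "Ap l m n * Ap l m n + q\<^sup>2 * (Bp l m n * Bp l m n)
      = q powr (m + n + 1) * (qn (l + m + 1) * (q powr (- (2 * (l + 1))) * qn (l + 1 + n) + qn (l + 1 - n)) / (h1 * h2))" (is "?s1 = _")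
    unfolding square_A_plus square_B_plus e h1_def[symmetric] h2_def[symmetric]
    by (simp add: algebra_simps add_divide_distrib)
  also have "q powr (- (2 * (l + 1))) * qn (l + 1 + n) + qn (l + 1 - n) = q powr (- l - n - 1) * h2"
  proof -
    have eq: "- (l + 1) - n = - l - n - 1" "2 * (l + 1) = 2 * l + 2" by simp_all
    show ?thesis using qnum_identity_3[of "l + 1" n] unfolding eq h2_def .
  qed
  also have "q powr (m + n + 1) * (qn (l + m + 1) * (q powr (- l - n - 1) * h2) / (h1 * h2))
      = (q powr (m + n + 1) * q powr (- l - n - 1)) * qn (l + m + 1) / h1"
    using h by (simp add: field_simps)
  also have "q powr (m + n + 1) * q powr (- l - n - 1) = q powr (m + 1 - l - 1)"
    by (simp add: powr_add[symmetric])
  finally have 1: "?s1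
      = q powr (m + 1 - l - 1) * qn (l + m + 1) / h1" .
  have "Am l m n * Am l m n + q\<^sup>2 * (Bm l m n * Bm l m n)
      = q powr (m + n + 1) * (qn (l - m) * (q powr (2 * l) * qn (l - n) + qn (l + n)) / (h0 * h1))" (is "?s2 = _")
    unfolding square_A_minus square_B_minus e h0_def[symmetric] h1_def[symmetric]
    by (simp add: algebra_simps add_divide_distrib)
  also have "\<dots> = (q powr (m + n + 1) * q powr (l - n)) * qn (l - m) / h1"
    unfolding qnum_identity_3' h0_def[symmetric]
  \<comment> \<open>For \<open>l = 0\<close> also \<open>m = 0\<close>, so the factor
    \<open>qn (l - m)\<close> makes both sides 0.\<close>
  proof (cases "l = 0")
    case False
    then have "h0 \<noteq> 0" using lmn qnum_pos[of "2 * l"] by (auto simp: h0_def)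
    then show "q powr (m + n + 1) * (qn (l - m) * (q powr (l - n) * h0) / (h0 * h1)) =
      q powr (m + n + 1) * q powr (l - n) * qn (l - m) / h1"
      using h by (simp add: field_simps)
  qed (use lmn in simp)
  also have "q powr (m + n + 1) * q powr (l - n) = q powr (l + (m + 1))"
    by (simp add: powr_add[symmetric] algebra_simps)
  finally have 2: "?s2
      = q powr (l + (m + 1)) * qn (l - m) / h1" .
  have "q powr (m + 1 - l - 1) * qn (l + m + 1) / h1 + q powr (l + (m + 1)) * qn (l - m) / h1 = 1"
    using qnum_identity_4[of "m + 1" l] h unfolding h1_def[symmetric] add_divide_distrib[symmetric]
    by (simp add: algebra_simps)
  moreover have "x + y + q\<^sup>2 * (z + w) = (x + q\<^sup>2 * z) + (y + q\<^sup>2 * w)" for x y z w by (simp add: algebra_simps)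
  ultimately show ?thesis using 1 2 by simp
qed

text \<open>The squared coefficients of the adjoint generators, as they enter the middle
  coefficients of \<open>aa*\<close> and \<open>bb*\<close>.\<close>

lemma square_shifted:
  "Ap (l - 1/2) (m - 1/2) (n - 1/2) * Ap (l - 1/2) (m - 1/2) (n - 1/2)
    = q powr (- 2 * l + m + n - 1) * (qn (l + m) * qn (l + n) / (qn (2 * l) * qn (2 * l + 1)))"
  "Am (l + 1/2) (m - 1/2) (n - 1/2) * Am (l + 1/2) (m - 1/2) (n - 1/2)
    = q powr (2 * l + m + n + 1) * (qn (l - m + 1) * qn (l - n + 1) / (qn (2 * l + 1) * qn (2 * l + 2)))"
  "Bp (l - 1/2) (m - 1/2) (n + 1/2) * Bp (l - 1/2) (m - 1/2) (n + 1/2)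
    = q powr (m + n - 1) * (qn (l + m) * qn (l - n) / (qn (2 * l) * qn (2 * l + 1)))"
  "Bm (l + 1/2) (m - 1/2) (n + 1/2) * Bm (l + 1/2) (m - 1/2) (n + 1/2)
    = q powr (m + n - 1) * (qn (l - m + 1) * qn (l + n + 1) / (qn (2 * l + 1) * qn (2 * l + 2)))"
  unfolding A_plus_def A_minus_def B_plus_def B_minus_def mult_minus_left mult_minus_right minus_minus
  subgoal by (subst square_sqrt[where e' = "- 2 * l + m + n - 1"]) (use lmn in \<open>simp_all add: qnum_nonneg algebra_simps, (simp add: field_simps)?\<close>)
  subgoal by (subst square_sqrt[where e' = "2 * l + m + n + 1"]) (use lmn in \<open>simp_all add: qnum_nonneg algebra_simps, (simp add: field_simps)?\<close>)
  subgoal by (subst square_sqrt[where e' = "m + n - 1"]) (use lmn in \<open>simp_all add: qnum_nonneg algebra_simps, (simp add: field_simps)?\<close>)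
  subgoal by (subst square_sqrt[where e' = "m + n - 1"]) (use lmn in \<open>simp_all add: qnum_nonneg algebra_simps, (simp add: field_simps)?\<close>)
  done

lemma mid_aA:
  "Am (l + 1/2) (m - 1/2) (n - 1/2) * Am (l + 1/2) (m - 1/2) (n - 1/2)
    + Ap (l - 1/2) (m - 1/2) (n - 1/2) * Ap (l - 1/2) (m - 1/2) (n - 1/2)
    + (Bm (l + 1/2) (m - 1/2) (n + 1/2) * Bm (l + 1/2) (m - 1/2) (n + 1/2)
    + Bp (l - 1/2) (m - 1/2) (n + 1/2) * Bp (l - 1/2) (m - 1/2) (n + 1/2)) = 1"
proof -
  define h0 h1 h2 where "h0 = qn (2 * l)" and "h1 = qn (2 * l + 1)" and "h2 = qn (2 * l + 2)"
  have h: "h1 \<noteq> 0" "h2 \<noteq> 0"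
    using lmn qnum_pos[of "2 * l + 1"] qnum_pos[of "2 * l + 2"] by (auto simp: h1_def h2_def)
  have e1: "q powr (- 2 * l + m + n - 1) = q powr (m + n - 1) * q powr (- (2 * l))"
    and e2: "q powr (2 * l + m + n + 1) = q powr (m + n - 1) * q powr (2 * (l + 1))"
    unfolding powr_add[symmetric] by (simp_all add: algebra_simps)
  note sq = square_shifted[folded h0_def h1_def h2_def, unfolded e1 e2]
  have "q powr (m + n - 1) * q powr (- (2 * l)) * (qn (l + m) * qn (l + n) / (h0 * h1))
      + q powr (m + n - 1) * (qn (l + m) * qn (l - n) / (h0 * h1))
      = q powr (m + n - 1) * (qn (l + m) * (q powr (- (2 * l)) * qn (l + n) + qn (l - n)) / (h0 * h1))" (is "?s1 = _")
    by (simp add: algebra_simps add_divide_distrib)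
  also have "\<dots> = (q powr (m + n - 1) * q powr (- l - n)) * qn (l + m) / h1"
    unfolding qnum_identity_3 h0_def[symmetric]
  proof (cases "l = 0")
    case False
    then have "h0 \<noteq> 0" using lmn qnum_pos[of "2 * l"] by (auto simp: h0_def)
    then show "q powr (m + n - 1) * (qn (l + m) * (q powr (- l - n) * h0) / (h0 * h1)) =
      q powr (m + n - 1) * q powr (- l - n) * qn (l + m) / h1"
      using h by (simp add: field_simps)
  qed (use lmn in simp)
  also have "q powr (m + n - 1) * q powr (- l - n) = q powr (m - l - 1)"
    unfolding powr_add[symmetric] by (simp add: algebra_simps)
  finally have 1: "?s1
      = q powr (m - l - 1) * qn (l + m) / h1" .
  have "q powr (m + n - 1) * q powr (2 * (l + 1)) * (qn (l - m + 1) * qn (l - n + 1) / (h1 * h2))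
      + q powr (m + n - 1) * (qn (l - m + 1) * qn (l + n + 1) / (h1 * h2))
      = q powr (m + n - 1) * (qn (l - m + 1) * (q powr (2 * (l + 1)) * qn (l + 1 - n) + qn (l + 1 + n)) / (h1 * h2))" (is "?s2 = _")
    by (simp add: algebra_simps add_divide_distrib)
  also have "q powr (2 * (l + 1)) * qn (l + 1 - n) + qn (l + 1 + n) = q powr (l + 1 - n) * h2"
    unfolding qnum_identity_3'[of "l + 1" n] h2_def by (simp add: algebra_simps)
  also have "q powr (m + n - 1) * (qn (l - m + 1) * (q powr (l + 1 - n) * h2) / (h1 * h2))
      = (q powr (m + n - 1) * q powr (l + 1 - n)) * qn (l - m + 1) / h1"
    using h by (simp add: field_simps)
  also have "q powr (m + n - 1) * q powr (l + 1 - n) = q powr (l + m)"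
    unfolding powr_add[symmetric] by (simp add: algebra_simps)
  finally have 2: "?s2
      = q powr (l + m) * qn (l - m + 1) / h1" .
  have "q powr (m - l - 1) * qn (l + m) / h1 + q powr (l + m) * qn (l - m + 1) / h1 = 1"
    using h unfolding add_divide_distrib[symmetric] qnum_identity_4 h1_def[symmetric] by simp
  then show ?thesis using 1 2 unfolding sq by linarith
qed

lemma mid_bB:
  "Bm (l + 1/2) (m - 1/2) (n + 1/2) * Bm (l + 1/2) (m - 1/2) (n + 1/2)
    + Bp (l - 1/2) (m - 1/2) (n + 1/2) * Bp (l - 1/2) (m - 1/2) (n + 1/2)
    = Bp l m n * Bp l m n + Bm l m n * Bm l m n"
proof (cases "l = 0")
  case True
  then show ?thesis using lmn unfolding square_shifted square_B_plus square_B_minus by simp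
next
  case False
  define h0 h1 h2 where "h0 = qn (2 * l)" and "h1 = qn (2 * l + 1)" and "h2 = qn (2 * l + 2)"
  have h: "h0 \<noteq> 0" "h1 \<noteq> 0" "h2 \<noteq> 0"
    using False lmn qnum_pos[of "2 * l"] qnum_pos[of "2 * l + 1"] qnum_pos[of "2 * l + 2"]
    by (auto simp: h0_def h1_def h2_def)
  have combine: "c * (x / (h1 * h2)) + c * (y / (h0 * h1)) = c * (x * h0 + y * h2) / (h0 * h1 * h2)" for c x y
    using h by (simp add: field_simps)
  show ?thesis
    unfolding square_shifted square_B_plus square_B_minus h0_def[symmetric] h1_def[symmetric] h2_def[symmetric]
      combine unfolding h0_def h2_def qnum_identity_2 ..
qed

end

text \<open>Each coefficient occurs, after a shift of the indices by 1/2, among the four squares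
  that add up to 1 in \<open>mid_aA\<close>. For \<open>A_minus\<close> and \<open>B_minus\<close>
  the shift lowers \<open>l\<close>; where it leaves the range, the coefficient itself
  vanishes.\<close>

lemma
  assumes "valid_lmn l m n"
  shows abs_A_plus_le: "\<bar>Ap l m n\<bar> \<le> 1" and abs_A_minus_le: "\<bar>Am l m n\<bar> \<le> 1"
    and abs_B_plus_le: "\<bar>Bp l m n\<bar> \<le> 1" and abs_B_minus_le: "\<bar>Bm l m n\<bar> \<le> 1"
proof -
  have le: "\<bar>x\<bar> \<le> 1" if "w * w + x * x + (y * y + z * z) = 1 \<or> x * x + w * w + (y * y + z * z) = 1 \<or>
     w * w + y * y + (x * x + z * z) = 1 \<or> w * w + y * y + (z * z + x * x) = 1" for w x y z :: real
  proof -
    have "x\<^sup>2 \<le> 1" using that zero_le_square[of w] zero_le_square[of y] zero_le_square[of z]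
      unfolding power2_eq_square by linarith
    then show ?thesis by (simp add: abs_square_le_1)
  qed
  show "\<bar>Ap l m n\<bar> \<le> 1"
    using mid_aA[of "l + 1/2" "m + 1/2" "n + 1/2"] valid_lmn_bounds[OF assms] by (intro le) auto
  show "\<bar>Bp l m n\<bar> \<le> 1"
    using mid_aA[of "l + 1/2" "m + 1/2" "n - 1/2"] valid_lmn_bounds[OF assms] by (intro le) auto
  show "\<bar>Am l m n\<bar> \<le> 1"
  proof (cases "l = m \<or> l = n")
    case False
    then have "valid_lmn (l - 1/2) (m + 1/2) (n + 1/2)" using valid_lmn_down[OF assms, of "1/2" "1/2"] by simp
    from mid_aA[OF valid_lmn_bounds[OF this]] show ?thesis by (intro le) auto
  qed (auto simp: A_minus_def)
  show "\<bar>Bm l m n\<bar> \<le> 1"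
  proof (cases "l = m \<or> l = - n")
    case False
    then have "valid_lmn (l - 1/2) (m + 1/2) (n - 1/2)" using valid_lmn_down[OF assms, of "1/2" "-1/2"] by simp
    from mid_aA[OF valid_lmn_bounds[OF this]] show ?thesis by (intro le) auto
  qed (auto simp: B_minus_def)
qed

lemma adjoint_pair_pi_a:
  "adjoint_pair (pi_gen q gen_a) (ladder (-1/2) (-1/2) (\<lambda>l m n. Am (l + 1/2) (m - 1/2) (n - 1/2))
     (\<lambda>l m n. Ap (l - 1/2) (m - 1/2) (n - 1/2)))"
  using adjoint_pair_ladder[of "Ap" 1 "Am" "1/2" "1/2"] abs_A_plus_le abs_A_minus_le
  unfolding pi_gen_eq_ladder by simp

lemma adjoint_pair_pi_b:
  "adjoint_pair (pi_gen q gen_b) (ladder (-1/2) (1/2) (\<lambda>l m n. Bm (l + 1/2) (m - 1/2) (n + 1/2))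
     (\<lambda>l m n. Bp (l - 1/2) (m - 1/2) (n + 1/2)))"
  using adjoint_pair_ladder[of "Bp" 1 "Bm" "1/2" "-1/2"] abs_B_plus_le abs_B_minus_le
  unfolding pi_gen_eq_ladder by simp

lemma pi_gen_adjoint_pair: "\<exists>S. adjoint_pair (pi_gen q g) S"
  using adjoint_pair_pi_a adjoint_pair_pi_b by (cases g) blast+

lemma pi_gen_relations:
  assumes "(x, y) \<in> suq2_relations q"
  shows "star_eval (pi_gen q) x = star_eval (pi_gen q) y"
proof (rule bounded_clinear_eq_on_kets)
  note pair = star_eval_adjoint_pair[of "pi_gen q", OF pi_gen_adjoint_pair]
  show "bounded_clinear (star_eval (pi_gen q) x)" "bounded_clinear (star_eval (pi_gen q) y)"
    by (rule adjoint_pairD(1)[OF pair])+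
  define a where "a = ladder (1/2) (1/2) (Ap) (Am)"
  define b where "b = ladder (1/2) (-1/2) (Bp) (Bm)"
  define A where "A = ladder (-1/2) (-1/2) (\<lambda>l m n. Am (l + 1/2) (m - 1/2) (n - 1/2))
     (\<lambda>l m n. Ap (l - 1/2) (m - 1/2) (n - 1/2))"
  define B where "B = ladder (-1/2) (1/2) (\<lambda>l m n. Bm (l + 1/2) (m - 1/2) (n + 1/2))
     (\<lambda>l m n. Bp (l - 1/2) (m - 1/2) (n + 1/2))"
  have pair_a: "adjoint_pair a A" and pair_b: "adjoint_pair b B"
    using adjoint_pair_pi_a adjoint_pair_pi_b
    by (auto simp: a_def b_def A_def B_def pi_gen_eq_ladder simp del: pi_gen.simps)
  note star = cadjoint_eqI[OF pair_a] cadjoint_eqI[OF pair_b]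
  note lin = adjoint_pairD(1,2)[OF pair_a] adjoint_pairD(1,2)[OF pair_b]
  have pi: "pi_gen q gen_a = a" "pi_gen q gen_b = b"
    by (simp_all only: a_def b_def pi_gen_eq_ladder)
  fix i
  obtain l m n where "Rep_lmn i = (l, m, n)" by (metis prod_cases3)
  then have valid: "valid_lmn l m n" and ket: "ket i = ket_lmn l m n"
    using valid_Rep_lmn ket_lmn_Rep by auto
  note bounds = valid_lmn_bounds[OF valid]
  \<comment> \<open>The lowering coefficients of \<open>a\<close>, \<open>b\<close> and their
    adjoints vanish wherever \<open>ladder_ladder_ket\<close> asks for it.\<close>
  have zero: "l = m \<or> l = n \<Longrightarrow> Am l m n = 0" "l = m \<or> l = - n \<Longrightarrow> Bm l m n = 0"
    "l = - m \<or> l = - n \<Longrightarrow> Ap (l - 1/2) (m - 1/2) (n - 1/2) = 0"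
    "l = - m \<or> l = n \<Longrightarrow> Bp (l - 1/2) (m - 1/2) (n + 1/2) = 0"
    by (auto simp: A_minus_def B_minus_def A_plus_def B_plus_def)
  \<comment> \<open>A product of two of these ladders sends \<open>ket i\<close> to a combination of
    three kets; \<open>comb\<close> turns the relations into equations between coefficient
    triples.\<close>
  define comb where "comb c1 c2 c3 m n = complex_of_real c1 *\<^sub>C ket_lmn (l + 1) m n
    + complex_of_real c2 *\<^sub>C ket_lmn l m n + complex_of_real c3 *\<^sub>C ket_lmn (l - 1) m n" for c1 c2 c3 m n
  note expand = ladder_ladder_ket[OF _ valid, folded comb_def]
  have comb_scale: "complex_of_real c *\<^sub>C comb c1 c2 c3 m n = comb (c * c1) (c * c2) (c * c3) m n" for c c1 c2 c3 m n
    by (simp add: comb_def scaleC_add_right scaleC_scaleC)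
  have comb_add: "comb c1 c2 c3 m n + comb d1 d2 d3 m n = comb (c1 + d1) (c2 + d2) (c3 + d3) m n" for c1 c2 c3 d1 d2 d3 m n
    by (simp add: comb_def scaleC_add_left)
  have comb_1: "comb 0 1 0 m n = ket i" by (simp add: comb_def ket scaleC_one)
  have ba: "b (a (ket i)) = comb (Ap l m n * Bp (l + 1/2) (m + 1/2) (n + 1/2))
      (Ap l m n * Bm (l + 1/2) (m + 1/2) (n + 1/2) + Am l m n * Bp (l - 1/2) (m + 1/2) (n + 1/2))
      (Am l m n * Bm (l - 1/2) (m + 1/2) (n + 1/2))  (m + 1) n"
    unfolding a_def b_def ket by (subst expand[OF lin(3)[unfolded b_def]]) (simp_all add: zero add.commute[of 1])
  have ab: "a (b (ket i)) = comb (Bp l m n * Ap (l + 1/2) (m + 1/2) (n - 1/2))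
      (Bp l m n * Am (l + 1/2) (m + 1/2) (n - 1/2) + Bm l m n * Ap (l - 1/2) (m + 1/2) (n - 1/2))
      (Bm l m n * Am (l - 1/2) (m + 1/2) (n - 1/2))  (m + 1) n"
    unfolding a_def b_def ket by (subst expand[OF lin(1)[unfolded a_def]]) (simp_all add: zero add.commute[of 1])
  have Ba: "B (a (ket i)) = comb (Ap l m n * Bm (l + 1) m (n + 1))
      (Ap l m n * Bp l m (n + 1) + Am l m n * Bm l m (n + 1))
      (Am l m n * Bp (l - 1) m (n + 1)) m (n + 1)"
    unfolding a_def B_def ket by (subst expand[OF lin(4)[unfolded B_def]]) (simp_all add: zero add.commute[of 1])
  have aB: "a (B (ket i)) = comb (Bm (l + 1/2) (m - 1/2) (n + 1/2) * Ap (l + 1/2) (m - 1/2) (n + 1/2))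
      (Bm (l + 1/2) (m - 1/2) (n + 1/2) * Am (l + 1/2) (m - 1/2) (n + 1/2)
        + Bp (l - 1/2) (m - 1/2) (n + 1/2) * Ap (l - 1/2) (m - 1/2) (n + 1/2))
      (Bp (l - 1/2) (m - 1/2) (n + 1/2) * Am (l - 1/2) (m - 1/2) (n + 1/2)) m (n + 1)"
    unfolding a_def B_def ket by (subst expand[OF lin(1)[unfolded a_def]]) (simp_all add: zero add.commute[of 1])
  have bB: "b (B (ket i)) = comb (Bm (l + 1/2) (m - 1/2) (n + 1/2) * Bp (l + 1/2) (m - 1/2) (n + 1/2))
      (Bm (l + 1/2) (m - 1/2) (n + 1/2) * Bm (l + 1/2) (m - 1/2) (n + 1/2)
        + Bp (l - 1/2) (m - 1/2) (n + 1/2) * Bp (l - 1/2) (m - 1/2) (n + 1/2))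
      (Bp (l - 1/2) (m - 1/2) (n + 1/2) * Bm (l - 1/2) (m - 1/2) (n + 1/2)) m n"
    unfolding b_def B_def ket by (subst expand[OF lin(3)[unfolded b_def]]) (simp_all add: zero add.commute[of 1])
  have Bb: "B (b (ket i)) = comb (Bp l m n * Bm (l + 1) m n)
      (Bp l m n * Bp l m n + Bm l m n * Bm l m n)
      (Bm l m n * Bp (l - 1) m n) m n"
    unfolding b_def B_def ket by (subst expand[OF lin(4)[unfolded B_def]]) (simp_all add: zero add.commute[of 1])
  have Aa: "A (a (ket i)) = comb (Ap l m n * Am (l + 1) m n)
      (Ap l m n * Ap l m n + Am l m n * Am l m n)
      (Am l m n * Ap (l - 1) m n) m n"
    unfolding a_def A_def ket by (subst expand[OF lin(2)[unfolded A_def]]) (simp_all add: zero add.commute[of 1])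
  have aA: "a (A (ket i)) = comb (Am (l + 1/2) (m - 1/2) (n - 1/2) * Ap (l + 1/2) (m - 1/2) (n - 1/2))
      (Am (l + 1/2) (m - 1/2) (n - 1/2) * Am (l + 1/2) (m - 1/2) (n - 1/2)
        + Ap (l - 1/2) (m - 1/2) (n - 1/2) * Ap (l - 1/2) (m - 1/2) (n - 1/2))
      (Ap (l - 1/2) (m - 1/2) (n - 1/2) * Am (l - 1/2) (m - 1/2) (n - 1/2)) m n"
    unfolding a_def A_def ket by (subst expand[OF lin(1)[unfolded a_def]]) (simp_all add: zero add.commute[of 1])
  have q_powr: "q powr 0 = 1" using q by simp
  have "b (a (ket i)) = complex_of_real q *\<^sub>C a (b (ket i))"
    unfolding ba ab comb_scale up_ba down_ba mid_ba[OF bounds] powr_simps ..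
  moreover have "B (a (ket i)) = complex_of_real q *\<^sub>C a (B (ket i))"
    unfolding Ba aB comb_scale up_Ba down_Ba mid_Ba[OF bounds] powr_simps ..
  moreover have "b (B (ket i)) = B (b (ket i))"
    unfolding bB Bb up_bB down_bB mid_bB[OF bounds] q_powr mult_1 ..
  \<comment> \<open>By \<open>up_Aa\<close> and \<open>down_Aa\<close> the outer coefficients of the
    two summands are negatives of each other.\<close>
  moreover have "A (a (ket i)) + of_real (q\<^sup>2) *\<^sub>C B (b (ket i)) = ket i"
    unfolding Aa Bb comb_scale comb_add up_Aa down_Aa mid_Aa[OF bounds] powr_simps(6)
    unfolding comb_1[symmetric] by (rule arg_cong2[where f = "\<lambda>c d. comb c 1 d m n"]) simp_all
  moreover have "a (A (ket i)) + b (B (ket i)) = ket i"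
    unfolding aA bB comb_add up_aA down_aA mid_aA[OF bounds] q_powr
    unfolding comb_1[symmetric] by (rule arg_cong2[where f = "\<lambda>c d. comb c 1 d m n"]) simp_all
  ultimately show "star_eval (pi_gen q) x (ket i) = star_eval (pi_gen q) y (ket i)"
    using assms
    by (auto simp: suq2_relations_def Let_def pi star scaleC_one
        simp del: pi_gen.simps)
qed

end


section \<open>Matrix elements in the spinor basis\<close>

context suq2
begin

text \<open>\<open>C\<close> and \<open>S\<close> act as cosine and sine of the rotation from kets
  to spinors. The identity clears to \<open>q powr (- j - \<mu>) * [j - \<mu>] + q powr (j - \<mu>)
  * [j + \<mu>] = [2j]\<close>.\<close>

lemma C_S_norm:
  assumes "0 < j" "- j \<le> \<mu>" "\<mu> \<le> j"
  shows "C_coeff q j \<mu> * C_coeff q j \<mu> + S_coeff q j \<mu> * S_coeff q j \<mu> = 1"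
proof -
  have h: "0 < qn (2 * j)" using assms by (intro qnum_pos q) simp
  have 1: "C_coeff q j \<mu> * C_coeff q j \<mu> = q powr (- j - \<mu>) * qn (j - \<mu>) / qn (2 * j)"
    using h square_sqrt[of "qn (j - \<mu>)" "- (j + \<mu>) / 2" "- j - \<mu>"] assms
    by (simp add: C_coeff_def qnum_nonneg)
  have 2: "S_coeff q j \<mu> * S_coeff q j \<mu> = q powr (j - \<mu>) * qn (j + \<mu>) / qn (2 * j)"
    using h square_sqrt[of "qn (j + \<mu>)" "(j - \<mu>) / 2" "j - \<mu>"] assms
    by (simp add: S_coeff_def qnum_nonneg)
  have "q powr (- j - \<mu>) * qn (j - \<mu>) + q powr (j - \<mu>) * qn (j + \<mu>) = qn (2 * j)"
  proof -
    define L N k where "L = q powr j" and "N = q powr \<mu>" and "k = q - 1 / q"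
    have "0 < L" "0 < N" "k \<noteq> 0" using q q_inverse by (auto simp: L_def N_def k_def divide_inverse)
    then show ?thesis
      unfolding qnum_eq powr_simps L_def[symmetric] N_def[symmetric] k_def[symmetric]
      using q by (simp add: field_simps) (simp add: power2_eq_square power_numeral_reduce algebra_simps)
  qed
  then show ?thesis using h unfolding 1 2 add_divide_distrib[symmetric] by simp
qed

lemma C_S_le:
  assumes "0 < j" "- j \<le> \<mu>" "\<mu> \<le> j"
  shows "\<bar>C_coeff q j \<mu>\<bar> \<le> 1" "\<bar>S_coeff q j \<mu>\<bar> \<le> 1"
proof -
  have "(C_coeff q j \<mu>)\<^sup>2 \<le> 1" "(S_coeff q j \<mu>)\<^sup>2 \<le> 1"
    using C_S_norm[OF assms] zero_le_square[of "C_coeff q j \<mu>"] zero_le_square[of "S_coeff q j \<mu>"]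
    unfolding power2_eq_square by linarith+
  then show "\<bar>C_coeff q j \<mu>\<bar> \<le> 1" "\<bar>S_coeff q j \<mu>\<bar> \<le> 1" by (simp_all add: abs_square_le_1)
qed

text \<open>The coefficients of the generators split as \<open>u l m n = X * q powr (m/2) * sqrt [l + m + 1]\<close> and
  \<open>d l m n = Y * q powr (m/2) * sqrt [l - m]\<close>, where \<open>X\<close>, \<open>Y\<close> do not depend on \<open>m\<close>. Here \<open>j = l + 1/2\<close>.\<close>

lemma up_to_down_plus:
  "C_coeff q (j + 1/2) (\<mu> + 1/2) * (- S_coeff q j \<mu>) * (X * (q powr ((\<mu> + 1/2) / 2) * sqrt (qn (j + \<mu> + 1))))
   + S_coeff q (j + 1/2) (\<mu> + 1/2) * C_coeff q j \<mu> * (X * (q powr ((\<mu> - 1/2) / 2) * sqrt (qn (j + \<mu>)))) = 0"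
proof -
  \<comment> \<open>Both terms contain the same three square roots, so the sum vanishes as soon as
    the powers of \<open>q\<close> agree, which is \<open>e\<close>.\<close>
  have ring: "(p1 * a / D') * (- (p2 * b / D)) * (X * (p3 * c)) + (s1 * c / D') * (s2 * a / D) * (X * (s3 * b))
    = X * a * b * c / (D * D') * (s1 * s2 * s3 - p1 * p2 * p3)" for p1 p2 p3 s1 s2 s3 a b c D D' :: real
    by (simp add: divide_inverse algebra_simps)
  have e: "q powr ((j + 1/2 - (\<mu> + 1/2)) / 2) * q powr (- (j + \<mu>) / 2) * q powr ((\<mu> - 1/2) / 2)
    = q powr (- (j + 1/2 + (\<mu> + 1/2)) / 2) * q powr ((j - \<mu>) / 2) * q powr ((\<mu> + 1/2) / 2)"
    unfolding powr_add[symmetric] by (rule arg_cong[where f = "\<lambda>x. q powr x"]) (simp add: field_simps)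
  have eq: "j + 1/2 - (\<mu> + 1/2) = j - \<mu>" "j + 1/2 + (\<mu> + 1/2) = j + \<mu> + 1" by simp_all
  show ?thesis
    unfolding C_coeff_def S_coeff_def using e unfolding eq ring by simp
qed

text \<open>The mechanism of \<open>up_to_down_plus\<close> for lowering \<open>l\<close>: both
  terms share their roots, and the powers of \<open>q\<close> coincide.\<close>

lemma down_to_up_minus:
  "- S_coeff q (j - 1/2) (\<mu> + 1/2) * C_coeff q j \<mu> * (Y * (q powr ((\<mu> + 1/2) / 2) * sqrt (qn (j - \<mu> - 1))))
   + C_coeff q (j - 1/2) (\<mu> + 1/2) * S_coeff q j \<mu> * (Y * (q powr ((\<mu> - 1/2) / 2) * sqrt (qn (j - \<mu>)))) = 0"
proof -
  have ring: "- (p1 * a / D') * (p2 * b / D) * (Y * (p3 * c)) + (s1 * c / D') * (s2 * a / D) * (Y * (s3 * b))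
    = Y * a * b * c / (D * D') * (s1 * s2 * s3 - p1 * p2 * p3)" for p1 p2 p3 s1 s2 s3 a b c D D' :: real
    by (simp add: divide_inverse algebra_simps)
  have e: "q powr (- (j - 1/2 + (\<mu> + 1/2)) / 2) * q powr ((j - \<mu>) / 2) * q powr ((\<mu> - 1/2) / 2)
    = q powr ((j - 1/2 - (\<mu> + 1/2)) / 2) * q powr (- (j + \<mu>) / 2) * q powr ((\<mu> + 1/2) / 2)"
    unfolding powr_add[symmetric] by (rule arg_cong[where f = "\<lambda>x. q powr x"]) (simp add: field_simps)
  have eq: "j - 1/2 - (\<mu> + 1/2) = j - \<mu> - 1" "j - 1/2 + (\<mu> + 1/2) = j + \<mu>" by simp_all
  show ?thesis
    unfolding C_coeff_def S_coeff_def using e unfolding eq ring by simp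
qed

text \<open>Each equation collapses a difference of q-numbers to a single power of \<open>q\<close>;
  in the second one the growing parts cancel.\<close>

lemma qnum_step: "qn (x + 1) - q * qn x = q powr (- x)" "qn x - q * qn (x + 1) = - (q powr (x + 1))"
proof -
  define L where "L = q powr x"
  have L: "0 < L" "q * q \<noteq> 1"
    using q mult_strict_mono[of q 1 q 1] by (auto simp: L_def)
  show "qn (x + 1) - q * qn x = q powr (- x)" "qn x - q * qn (x + 1) = - (q powr (x + 1))"
    unfolding qnum_eq powr_simps L_def[symmetric]
    using L q by (simp_all add: divide_simps) (simp_all add: power2_eq_square algebra_simps)
qed

text \<open>In each term one root now occurs squared, so the sum does not cancel; its value is
  governed by \<open>[j + \<mu>] - q * [j + \<mu> + 1]\<close>, a single power of
  \<open>q\<close>.\<close>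

lemma down_to_up_plus:
  assumes "- j \<le> \<mu>"
  shows "- S_coeff q (j + 1/2) (\<mu> + 1/2) * C_coeff q j \<mu> * (X * (q powr ((\<mu> + 1/2) / 2) * sqrt (qn (j + \<mu> + 1))))
   + C_coeff q (j + 1/2) (\<mu> + 1/2) * S_coeff q j \<mu> * (X * (q powr ((\<mu> - 1/2) / 2) * sqrt (qn (j + \<mu>))))
   = - (X * sqrt (qn (j - \<mu>)) / (sqrt (qn (2 * j)) * sqrt (qn (2 * j + 1))) * q powr (j + \<mu> / 2 + 1/4))"
proof -
  have ring: "- (p1 * c / D') * (p2 * a / D) * (X * (p3 * c)) + (s1 * a / D') * (s2 * b / D) * (X * (s3 * b))
    = X * a / (D * D') * (s1 * s2 * s3 * (b * b) - p1 * p2 * p3 * (c * c))" for p1 p2 p3 s1 s2 s3 a b c D D' :: real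
    by (simp add: divide_inverse algebra_simps)
  have e1: "q powr ((j - \<mu>) / 2) * q powr (- (j + \<mu>) / 2) * q powr ((\<mu> + 1/2) / 2) = q powr (- \<mu> / 2 - 3/4) * q powr 1"
    and e2: "q powr (- (j + \<mu> + 1) / 2) * q powr ((j - \<mu>) / 2) * q powr ((\<mu> - 1/2) / 2) = q powr (- \<mu> / 2 - 3/4)"
    and e3: "q powr (- \<mu> / 2 - 3/4) * q powr (j + \<mu> + 1) = q powr (j + \<mu> / 2 + 1/4)"
    unfolding powr_add[symmetric] by (rule arg_cong[where f = "\<lambda>x. q powr x"]; simp add: field_simps)+
  have sq: "sqrt (qn (j + \<mu> + 1)) * sqrt (qn (j + \<mu> + 1)) = qn (j + \<mu> + 1)"
    "sqrt (qn (j + \<mu>)) * sqrt (qn (j + \<mu>)) = qn (j + \<mu>)"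
    using qnum_nonneg[of "j + \<mu> + 1"] qnum_nonneg[of "j + \<mu>"] assms by simp_all
  have eq: "j + 1/2 - (\<mu> + 1/2) = j - \<mu>" "j + 1/2 + (\<mu> + 1/2) = j + \<mu> + 1" "2 * (j + 1/2) = 2 * j + 1" by simp_all
  have "q powr (- \<mu> / 2 - 3/4) * qn (j + \<mu>) - q powr (- \<mu> / 2 - 3/4) * q powr 1 * qn (j + \<mu> + 1)
      = q powr (- \<mu> / 2 - 3/4) * (qn (j + \<mu>) - q * qn (j + \<mu> + 1))"
    using q by (simp add: algebra_simps)
  also have "\<dots> = - (q powr (j + \<mu> / 2 + 1/4))"
    unfolding qnum_step(2) e3[symmetric] by simp
  finally show ?thesis
    unfolding C_coeff_def S_coeff_def eq ring e1 e2 sq by simp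
qed

text \<open>As in \<open>down_to_up_plus\<close>, now with
  \<open>[j - \<mu>] - q * [j - \<mu> - 1]\<close>; the condition \<open>\<mu> \<le> j - 1\<close>
  keeps the q-numbers under the squared roots nonnegative.\<close>

lemma up_to_down_minus:
  assumes "\<mu> \<le> j - 1"
  shows "C_coeff q (j - 1/2) (\<mu> + 1/2) * (- S_coeff q j \<mu>) * (Y * (q powr ((\<mu> + 1/2) / 2) * sqrt (qn (j - \<mu> - 1))))
   + S_coeff q (j - 1/2) (\<mu> + 1/2) * C_coeff q j \<mu> * (Y * (q powr ((\<mu> - 1/2) / 2) * sqrt (qn (j - \<mu>))))
   = Y * sqrt (qn (j + \<mu>)) / (sqrt (qn (2 * j)) * sqrt (qn (2 * j - 1))) * q powr (- j + \<mu> / 2 + 1/4)"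
proof -
  have ring: "(p1 * c / D') * (- (p2 * a / D)) * (Y * (p3 * c)) + (s1 * a / D') * (s2 * b / D) * (Y * (s3 * b))
    = Y * a / (D * D') * (s1 * s2 * s3 * (b * b) - p1 * p2 * p3 * (c * c))" for p1 p2 p3 s1 s2 s3 a b c D D' :: real
    by (simp add: divide_inverse algebra_simps)
  have e1: "q powr (- (j + \<mu>) / 2) * q powr ((j - \<mu>) / 2) * q powr ((\<mu> + 1/2) / 2) = q powr (- \<mu> / 2 - 3/4) * q powr 1"
    and e2: "q powr ((j - \<mu> - 1) / 2) * q powr (- (j + \<mu>) / 2) * q powr ((\<mu> - 1/2) / 2) = q powr (- \<mu> / 2 - 3/4)"
    and e3: "q powr (- \<mu> / 2 - 3/4) * q powr (- (j - \<mu> - 1)) = q powr (- j + \<mu> / 2 + 1/4)"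
    unfolding powr_add[symmetric] by (rule arg_cong[where f = "\<lambda>x. q powr x"]; simp add: field_simps)+
  have sq: "sqrt (qn (j - \<mu> - 1)) * sqrt (qn (j - \<mu> - 1)) = qn (j - \<mu> - 1)"
    "sqrt (qn (j - \<mu>)) * sqrt (qn (j - \<mu>)) = qn (j - \<mu>)"
    using qnum_nonneg[of "j - \<mu> - 1"] qnum_nonneg[of "j - \<mu>"] assms by simp_all
  have eq: "j - 1/2 - (\<mu> + 1/2) = j - \<mu> - 1" "j - 1/2 + (\<mu> + 1/2) = j + \<mu>" "2 * (j - 1/2) = 2 * j - 1" by simp_all
  have "q powr (- \<mu> / 2 - 3/4) * qn (j - \<mu>) - q powr (- \<mu> / 2 - 3/4) * q powr 1 * qn (j - \<mu> - 1)
      = q powr (- \<mu> / 2 - 3/4) * (qn (j - \<mu> - 1 + 1) - q * qn (j - \<mu> - 1))"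
    using q by (simp add: algebra_simps)
  also have "\<dots> = q powr (- j + \<mu> / 2 + 1/4)"
    unfolding qnum_step(1) e3[symmetric] by simp
  finally show ?thesis
    unfolding C_coeff_def S_coeff_def eq ring e1 e2 sq by simp
qed

text \<open>Both bounds come from \<open>[x] = q powr (1 - x) + q * [x - 1]\<close>.\<close>

lemma qnum_lower:
  assumes "1 \<le> x"
  shows "q powr (1 - x) \<le> qn x" "1 \<le> qn x"
proof -
  have "qn x = q powr (1 - x) + q * qn (x - 1)" using qnum_step(1)[of "x - 1"] by simp
  moreover have "0 \<le> q * qn (x - 1)" using assms q by (intro mult_nonneg_nonneg qnum_nonneg) auto
  ultimately show *: "q powr (1 - x) \<le> qn x" by simp
  have "q powr 0 \<le> q powr (1 - x)" using q assms by (intro powr_mono') auto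
  then show "1 \<le> qn x" using * q by simp
qed

lemma sqrt_qnum_upper:
  assumes "0 \<le> x"
  shows "sqrt (qn x) \<le> sqrt (1 / (1 / q - q)) * q powr (- x / 2)"
proof -
  have k: "0 < 1 / q - q" using q_inverse by (simp add: divide_inverse)
  have "qn x = (q powr (- x) - q powr x) / (1 / q - q)"
    unfolding qnum_def using minus_divide_divide[of "q powr x - q powr (- x)" "q - 1 / q"]
    by (simp add: inverse_eq_divide)
  also have "\<dots> \<le> q powr (- x) / (1 / q - q)" using k by (intro divide_right_mono) auto
  finally have "qn x \<le> (1 / (1 / q - q)) * q powr (- x)" by simp
  then have "sqrt (qn x) \<le> sqrt (1 / (1 / q - q)) * sqrt (q powr (- x))"
    unfolding real_sqrt_mult[symmetric] by (rule real_sqrt_le_mono)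
  also have "sqrt (q powr (- x)) = q powr (- x / 2)"
    using q by (intro real_sqrt_unique) (auto simp: power2_eq_square powr_add[symmetric])
  finally show ?thesis .
qed

text \<open>The inequality \<open>y \<le> exp y\<close> at \<open>y = l * (- ln q)\<close>,
  multiplied by \<open>q powr l = exp (- y)\<close>. This is what beats the linear growth of the
  eigenvalue differences.\<close>

lemma linear_times_powr_bounded:
  assumes "0 \<le> l"
  shows "(1 + l) * q powr l \<le> 1 + 1 / (- ln q)"
proof -
  have lnq: "0 < - ln q" using q by simp
  have "l * (- ln q) \<le> exp (l * (- ln q))" using exp_ge_add_one_self[of "l * (- ln q)"] by linarith
  then have "l * (- ln q) * q powr l \<le> exp (l * (- ln q)) * q powr l" by (intro mult_right_mono) auto
  also have "\<dots> = 1" using q by (simp add: powr_def exp_add[symmetric])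
  finally have "l * q powr l \<le> 1 / (- ln q)" using lnq by (simp add: field_simps)
  moreover have "q powr l \<le> 1" using q assms powr_mono'[of 0 l q] by simp
  ultimately show ?thesis by (simp add: algebra_simps)
qed

text \<open>Here \<open>x\<close> is the factor of a generator coefficient that does not depend on
  \<open>m\<close>; the hypothesis on it is the bound 1 for the coefficient at an extremal
  \<open>m\<close>, and yields \<open>\<bar>x\<bar> * sqrt [t] \<le> q powr e1\<close>. Of
  \<open>[t']\<close> only the lower bound 1 enters, and the other factors are bounded by powers of
  \<open>q\<close>.\<close>

lemma decay_bound:
  assumes x: "\<bar>x\<bar> * (q powr - e1 * sqrt (qn t)) \<le> 1"
    and y: "0 \<le> y" and t: "1 \<le> t" "1 \<le> t'"
  shows "\<bar>x * sqrt (qn y) / (sqrt (qn t) * sqrt (qn t')) * q powr e2\<bar>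
    \<le> sqrt (1 / (1 / q - q)) * q powr (e1 - y / 2 + e2 + (t - 1))"
proof -
  define D where "D = sqrt (qn t)"
  define D' where "D' = sqrt (qn t')"
  define a where "a = sqrt (qn y)"
  define \<kappa> where "\<kappa> = sqrt (1 / (1 / q - q))"
  have D: "1 \<le> D" "1 \<le> D'" "q powr (1 - t) \<le> D * D"
    using qnum_lower[of t] qnum_lower[of t'] t by (simp_all add: D_def D'_def)
  have a: "0 \<le> a" "a \<le> \<kappa> * q powr (- y / 2)"
    using sqrt_qnum_upper[OF y] qnum_nonneg[OF y] by (auto simp: a_def \<kappa>_def)
  have \<kappa>: "0 \<le> \<kappa>" using q_inverse by (simp add: \<kappa>_def divide_inverse)
  have "q powr e1 * (\<bar>x\<bar> * (q powr - e1 * D)) \<le> q powr e1 * 1"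
    using x by (intro mult_left_mono) (auto simp: D_def)
  moreover have "q powr (e1 + - e1) = 1" using q by simp
  moreover have "q powr e1 * (\<bar>x\<bar> * (q powr - e1 * D)) = q powr (e1 + - e1) * (\<bar>x\<bar> * D)"
    unfolding powr_add by (simp only: mult_ac)
  ultimately have xD: "\<bar>x\<bar> * D \<le> q powr e1" by (simp only: mult_1 mult_1_right)
  have inv: "1 / (D * D) \<le> q powr (t - 1)"
  proof -
    have "1 / (D * D) \<le> 1 / q powr (1 - t)" using D(1,3) q by (intro divide_left_mono mult_pos_pos) auto
    also have "\<dots> = q powr (t - 1)" by (simp add: powr_minus_divide[symmetric])
    finally show ?thesis .
  qed
  have "\<bar>x * a / (D * D') * q powr e2\<bar> = \<bar>x\<bar> * a * q powr e2 / (D * D')"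
    using D a by (simp add: abs_mult)
  also have "\<dots> \<le> \<bar>x\<bar> * a * q powr e2 / (D * 1)"
    using D a by (intro divide_left_mono mult_left_mono mult_pos_pos mult_nonneg_nonneg) auto
  \<comment> \<open>Expanding by \<open>D\<close> brings in the controlled product
    \<open>\<bar>x\<bar> * D\<close> and leaves \<open>1 / (D * D)\<close>, which is at most
    \<open>q powr (t - 1)\<close>.\<close>
  also have "\<dots> = (\<bar>x\<bar> * D) * a * q powr e2 * (1 / (D * D))"
    using D(1,2) by (simp add: field_simps)
  also have "\<dots> \<le> q powr e1 * (\<kappa> * q powr (- y / 2)) * q powr e2 * q powr (t - 1)"
    using xD a inv D \<kappa> by (intro mult_mono mult_nonneg_nonneg) auto
  also have "\<dots> = \<kappa> * q powr (e1 + - y / 2 + e2 + (t - 1))" unfolding powr_add by (simp only: mult_ac)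
  also have "e1 + - y / 2 = e1 - y / 2" by simp
  finally show ?thesis by (simp only: a_def D_def D'_def \<kappa>_def)
qed

text \<open>With \<open>e1 = - l / 2\<close>, \<open>t = 2 * j\<close> and
  \<open>y = j - \<mu>\<close> the exponents in \<open>decay_bound\<close> add up to
  \<open>l + (j + \<mu>)\<close>, and \<open>j + \<mu>\<close> is nonnegative.\<close>

lemma down_to_up_plus_bound:
  assumes l: "0 \<le> l" and j: "j = l + 1/2" and \<mu>: "- j \<le> \<mu>" "\<mu> \<le> j"
    and X: "\<bar>X\<bar> * (q powr (l / 2) * sqrt (qn (2 * l + 1))) \<le> 1"
  shows "\<bar>X * sqrt (qn (j - \<mu>)) / (sqrt (qn (2 * j)) * sqrt (qn (2 * j + 1))) * q powr (j + \<mu> / 2 + 1/4)\<bar>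
    \<le> sqrt (1 / (1 / q - q)) * q powr l"
proof -
  have "2 * j = 2 * l + 1" using j by simp
  then have "\<bar>X\<bar> * (q powr - (- (l / 2)) * sqrt (qn (2 * j))) \<le> 1" using X by simp
  moreover have "0 \<le> j - \<mu>" "1 \<le> 2 * j" "1 \<le> 2 * j + 1" using l j \<mu> by simp_all
  ultimately have "\<bar>X * sqrt (qn (j - \<mu>)) / (sqrt (qn (2 * j)) * sqrt (qn (2 * j + 1))) * q powr (j + \<mu> / 2 + 1/4)\<bar>
    \<le> sqrt (1 / (1 / q - q)) * q powr (- (l / 2) - (j - \<mu>) / 2 + (j + \<mu> / 2 + 1/4) + (2 * j - 1))"
    by (rule decay_bound)
  also have "- (l / 2) - (j - \<mu>) / 2 + (j + \<mu> / 2 + 1/4) + (2 * j - 1) = l + (j + \<mu>)" by (simp add: j field_simps)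
  also have "sqrt (1 / (1 / q - q)) * q powr (l + (j + \<mu>)) \<le> sqrt (1 / (1 / q - q)) * q powr l"
  proof (rule mult_left_mono)
    show "q powr (l + (j + \<mu>)) \<le> q powr l" using q \<mu> by (intro powr_mono') auto
    show "0 \<le> sqrt (1 / (1 / q - q))" using q_inverse by (simp add: divide_inverse)
  qed
  finally show ?thesis .
qed

text \<open>With \<open>e1 = l / 2\<close>, \<open>t = 2 * l\<close> and
  \<open>y = j + \<mu>\<close> the exponents in \<open>decay_bound\<close> add up to
  \<open>l - 3/2\<close>; here \<open>\<mu>\<close> cancels.\<close>

lemma up_to_down_minus_bound:
  assumes l: "1 \<le> 2 * l" and j: "j = l + 1/2" and \<mu>: "- j \<le> \<mu>" "\<mu> \<le> j"
    and Y: "\<bar>Y\<bar> * (q powr (- l / 2) * sqrt (qn (2 * l))) \<le> 1"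
  shows "\<bar>Y * sqrt (qn (j + \<mu>)) / (sqrt (qn (2 * j)) * sqrt (qn (2 * j - 1))) * q powr (- j + \<mu> / 2 + 1/4)\<bar>
    \<le> sqrt (1 / (1 / q - q)) * q powr (l - 3/2)"
proof -
  have "\<bar>Y\<bar> * (q powr - (l / 2) * sqrt (qn (2 * l))) \<le> 1" using Y by simp
  moreover have "0 \<le> j + \<mu>" "1 \<le> 2 * j" using l j \<mu> by simp_all
  ultimately have "\<bar>Y * sqrt (qn (j + \<mu>)) / (sqrt (qn (2 * l)) * sqrt (qn (2 * j))) * q powr (- j + \<mu> / 2 + 1/4)\<bar>
    \<le> sqrt (1 / (1 / q - q)) * q powr (l / 2 - (j + \<mu>) / 2 + (- j + \<mu> / 2 + 1/4) + (2 * l - 1))"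
    using l by (intro decay_bound)
  also have "l / 2 - (j + \<mu>) / 2 + (- j + \<mu> / 2 + 1/4) + (2 * l - 1) = l - 3/2" by (simp add: j field_simps)
  also have "2 * l = 2 * j - 1" using j by simp
  finally show ?thesis by (simp only: mult.commute[of "sqrt (qn (2 * j))"])
qed

end


section \<open>The spinor basis\<close>

definition ket_spinor :: "real \<Rightarrow> real \<Rightarrow> real \<Rightarrow> spin \<Rightarrow> spinors" where
  "ket_spinor l m n \<sigma> = ket_lmn l m n \<otimes>\<^sub>2 ket \<sigma>"

lemma ell2_coeff_ket_spinor:
  "ell2_coeff (ket_spinor l m n \<sigma>) (i, \<tau>) = (if Rep_lmn i = (l, m, n) \<and> \<tau> = \<sigma> then 1 else 0)"
  by (simp add: ket_spinor_def tensor.rep_eq ell2_coeff_ket_lmn ell2_coeff_ket)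

lemma ket_spinor_Rep: "Rep_lmn i = (l, m, n) \<Longrightarrow> ket_spinor l m n \<sigma> = ket (i, \<sigma>)"
  by (rule ell2_eqI) (auto simp: ell2_coeff_ket_spinor ell2_coeff_ket Rep_lmn_inject[symmetric] split: if_splits)

lemma ket_spinor_invalid: "\<not> valid_lmn l m n \<Longrightarrow> ket_spinor l m n \<sigma> = 0"
  by (rule ell2_eqI) (auto simp: ell2_coeff_ket_spinor dest: valid_Rep_lmn)

lemma cinner_ket_spinor:
  "cinner (ket_spinor l m n \<sigma>) (ket_spinor l' m' n' \<sigma>')
    = (if valid_lmn l m n \<and> l' = l \<and> m' = m \<and> n' = n \<and> \<sigma>' = \<sigma> then 1 else 0)"
proof (cases "valid_lmn l m n")
  case True
  then obtain i where "Rep_lmn i = (l, m, n)" by (rule ket_lmn_cases)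
  then show ?thesis using True by (auto simp: ket_spinor_Rep[of i l m n] cinner_ket ell2_coeff_ket_spinor)
qed (simp add: ket_spinor_invalid)

text \<open>We label spinors by \<open>l\<close> instead of \<open>j\<close>, so that \<open>j = l - 1/2\<close> for \<open>Up\<close> and \<open>j = l + 1/2\<close>
  for \<open>Down\<close>.\<close>

definition coeff_Minus :: "real \<Rightarrow> arrow \<Rightarrow> real \<Rightarrow> real \<Rightarrow> real" where
  "coeff_Minus q s l \<mu> = (case s of Up \<Rightarrow> - S_coeff q (l + 1/2) \<mu> | Down \<Rightarrow> C_coeff q (l + 1/2) \<mu>)"

definition coeff_Plus :: "real \<Rightarrow> arrow \<Rightarrow> real \<Rightarrow> real \<Rightarrow> real" where
  "coeff_Plus q s l \<mu> = (case s of Up \<Rightarrow> C_coeff q (l + 1/2) \<mu> | Down \<Rightarrow> S_coeff q (l + 1/2) \<mu>)"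

fun spinor_l :: "real \<Rightarrow> arrow \<times> real \<times> real \<times> real \<Rightarrow> spinors" where
  "spinor_l q (s, l, \<mu>, n) =
     of_real (coeff_Minus q s l \<mu>) *\<^sub>C ket_spinor l (\<mu> + 1/2) n Minus
   + of_real (coeff_Plus q s l \<mu>) *\<^sub>C ket_spinor l (\<mu> - 1/2) n Plus"

text \<open>For given \<open>l\<close> and \<open>n\<close> there are two values of
  \<open>\<mu>\<close> fewer for \<open>Up\<close> than for \<open>Down\<close>: at
  \<open>\<mu> = l + 1/2\<close> and \<open>\<mu> = - (l + 1/2)\<close> only the down spinor exists,
  and for \<open>l = 0\<close> there is no up spinor at all.\<close>

definition spinor_index_l :: "(arrow \<times> real \<times> real \<times> real) set" where
  "spinor_index_l = {(s, l, \<mu>, n). 2 * l \<in> \<nat> \<and> l + n \<in> \<nat> \<and> l - n \<in> \<nat> \<and>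
     l + 1/2 + \<mu> \<in> \<nat> \<and> l + 1/2 - \<mu> \<in> \<nat> \<and> (s = Up \<longrightarrow> l - 1/2 + \<mu> \<in> \<nat> \<and> l - 1/2 - \<mu> \<in> \<nat>)}"

fun index_of_l :: "arrow \<times> real \<times> real \<times> real \<Rightarrow> arrow \<times> real \<times> real \<times> real" where
  "index_of_l (s, l, \<mu>, n) = (s, (case s of Up \<Rightarrow> l - 1/2 | Down \<Rightarrow> l + 1/2), \<mu>, n)"

lemma spinor_index_of_l: "spinor q (index_of_l k) = spinor_l q k"
  by (cases k; cases "fst k")
    (auto simp: coeff_Minus_def coeff_Plus_def ket_spinor_def add.commute[of "1/2"])

lemma bij_betw_index_of_l: "bij_betw index_of_l spinor_index_l spinor_index"
proof (rule bij_betwI[where g = "\<lambda>(s, j, \<mu>, n). (s, (case s of Up \<Rightarrow> j + 1/2 | Down \<Rightarrow> j - 1/2), \<mu>, n)"])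
  show "index_of_l \<in> spinor_index_l \<rightarrow> spinor_index"
  proof
    fix k assume k: "k \<in> spinor_index_l"
    obtain s l \<mu> n where k_eq: "k = (s, l, \<mu>, n)" by (metis prod_cases4)
    show "index_of_l k \<in> spinor_index"
    proof (cases s)
      case Up
      have "2 * (l - 1/2) \<in> \<nat>"
        using k Nats_add[of "l - 1/2 + \<mu>" "l - 1/2 - \<mu>"] unfolding k_eq Up spinor_index_l_def
        by (simp add: algebra_simps)
      then show ?thesis using k unfolding k_eq Up spinor_index_l_def spinor_index_def by simp
    next
      case Down
      have "2 * (l + 1/2) \<in> \<nat>"
        using k Nats_plus_one[of "2 * l"] unfolding k_eq Down spinor_index_l_def by simp
      then show ?thesis using k unfolding k_eq Down spinor_index_l_def spinor_index_def by simp
    qed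
  qed
  show "(\<lambda>(s, j, \<mu>, n). (s, (case s of Up \<Rightarrow> j + 1/2 | Down \<Rightarrow> j - 1/2), \<mu>, n)) \<in> spinor_index \<rightarrow> spinor_index_l"
  proof
    fix k assume k: "k \<in> spinor_index"
    obtain s j \<mu> n where k_eq: "k = (s, j, \<mu>, n)" by (metis prod_cases4)
    show "(case k of (s, j, \<mu>, n) \<Rightarrow> (s, (case s of Up \<Rightarrow> j + 1/2 | Down \<Rightarrow> j - 1/2), \<mu>, n)) \<in> spinor_index_l"
    proof (cases s)
      case Up
      have "2 * (j + 1/2) \<in> \<nat>" "j + 1 + \<mu> \<in> \<nat>" "j + 1 - \<mu> \<in> \<nat>"
        using k Nats_plus_one[of "2 * j"] Nats_plus_one[of "j + \<mu>"] Nats_plus_one[of "j - \<mu>"]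
        unfolding k_eq Up spinor_index_def by (simp_all add: algebra_simps)
      then show ?thesis using k unfolding k_eq Up spinor_index_l_def spinor_index_def by (simp add: algebra_simps)
    next
      case Down
      have "2 * (j - 1/2) \<in> \<nat>"
        using k Nats_add[of "j - 1/2 + n" "j - 1/2 - n"] unfolding k_eq Down spinor_index_def
        by (simp add: algebra_simps)
      then show ?thesis using k unfolding k_eq Down spinor_index_l_def spinor_index_def by simp
    qed
  qed
qed (auto split: arrow.splits)

lemma spinor_index_l_bounds:
  assumes "(s, l, \<mu>, n) \<in> spinor_index_l"
  shows "0 \<le> l" "- (l + 1/2) \<le> \<mu>" "\<mu> \<le> l + 1/2" "- l \<le> n" "n \<le> l" "2 * l \<in> \<nat>"
    "s = Up \<Longrightarrow> - (l - 1/2) \<le> \<mu> \<and> \<mu> \<le> l - 1/2"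
proof -
  have nn: "0 \<le> x" if "x \<in> \<nat>" for x :: real using that by (auto elim: Nats_cases)
  show "2 * l \<in> \<nat>" using assms by (simp add: spinor_index_l_def)
  have idx: "l + n \<in> \<nat>" "l - n \<in> \<nat>" "l + 1/2 + \<mu> \<in> \<nat>" "l + 1/2 - \<mu> \<in> \<nat>"
    "s = Up \<Longrightarrow> l - 1/2 + \<mu> \<in> \<nat> \<and> l - 1/2 - \<mu> \<in> \<nat>"
    using assms by (auto simp: spinor_index_l_def)
  show "0 \<le> l" "- (l + 1/2) \<le> \<mu>" "\<mu> \<le> l + 1/2" "- l \<le> n" "n \<le> l"
    using nn[OF idx(1)] nn[OF idx(2)] nn[OF idx(3)] nn[OF idx(4)] by auto
  show "- (l - 1/2) \<le> \<mu> \<and> \<mu> \<le> l - 1/2" if "s = Up"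
    using nn[OF conjunct1[OF idx(5)[OF that]]] nn[OF conjunct2[OF idx(5)[OF that]]] by auto
qed

context suq2
begin

lemma C_coeff_top [simp]: "C_coeff q j j = 0" and S_coeff_bot [simp]: "S_coeff q j (- j) = 0"
  using q by (simp_all add: C_coeff_def S_coeff_def qnum_0)

text \<open>A ket out of range enters a spinor only at the two extremal \<open>\<mu>\<close> of a
  down spinor, and there its coefficient \<open>C\<close> or \<open>S\<close> is 0.\<close>

lemma spinor_coeff_zero:
  assumes "(s, l, \<mu>, n) \<in> spinor_index_l"
  shows "valid_lmn l (\<mu> + 1/2) n \<or> coeff_Minus q s l \<mu> = 0"
    and "valid_lmn l (\<mu> - 1/2) n \<or> coeff_Plus q s l \<mu> = 0"
proof -
  have idx: "2 * l \<in> \<nat>" "l + n \<in> \<nat>" "l - n \<in> \<nat>" "l + 1/2 + \<mu> \<in> \<nat>" "l + 1/2 - \<mu> \<in> \<nat>"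
    "s = Up \<Longrightarrow> l - 1/2 + \<mu> \<in> \<nat> \<and> l - 1/2 - \<mu> \<in> \<nat>"
    using assms by (auto simp: spinor_index_l_def)
  have "l - (\<mu> + 1/2) \<in> \<nat> \<or> coeff_Minus q s l \<mu> = 0"
  proof (cases s)
    case Up then show ?thesis using idx(6) by (simp add: algebra_simps)
  next
    case Down
    then show ?thesis using Nats_minus_one[OF idx(5)]
      by (cases "\<mu> = l + 1/2") (auto simp: coeff_Minus_def algebra_simps)
  qed
  then show "valid_lmn l (\<mu> + 1/2) n \<or> coeff_Minus q s l \<mu> = 0"
    using idx by (auto simp: valid_lmn_def algebra_simps)
  have "l + (\<mu> - 1/2) \<in> \<nat> \<or> coeff_Plus q s l \<mu> = 0"
  proof (cases s)
    case Up then show ?thesis using idx(6) by (simp add: algebra_simps)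
  next
    case Down
    show ?thesis
    proof (cases "l + 1/2 + \<mu> = 0")
      case True
      then have "\<mu> = - (l + 1/2)" by simp
      then show ?thesis using S_coeff_bot[of "l + 1/2"] by (simp only: Down coeff_Plus_def arrow.case simp_thms)
    next
      case False
      then show ?thesis using Nats_minus_one[OF idx(4) False] by (simp add: algebra_simps)
    qed
  qed
  then show "valid_lmn l (\<mu> - 1/2) n \<or> coeff_Plus q s l \<mu> = 0"
    using idx by (auto simp: valid_lmn_def algebra_simps)
qed

text \<open>Validity of the ket does not appear on the right because a spinor coefficient vanishes
  whenever its ket is out of range.\<close>

lemma cinner_spinor_l_ket_spinor:
  assumes "(s, l, \<mu>, n) \<in> spinor_index_l"
  shows "cinner (spinor_l q (s, l, \<mu>, n)) (ket_spinor l' m' n' \<sigma>)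
    = (if l' = l \<and> n' = n then
        (case \<sigma> of Minus \<Rightarrow> if m' = \<mu> + 1/2 then complex_of_real (coeff_Minus q s l \<mu>) else 0
         | Plus \<Rightarrow> if m' = \<mu> - 1/2 then complex_of_real (coeff_Plus q s l \<mu>) else 0) else 0)"
  using spinor_coeff_zero[OF assms]
  by (cases \<sigma>) (auto simp: cinner_add_left cinner_scaleC_left cinner_ket_spinor)

lemma spinor_coeff_norm:
  assumes "0 \<le> l" "- (l + 1/2) \<le> \<mu>" "\<mu> \<le> l + 1/2"
  shows "coeff_Minus q s l \<mu> * coeff_Minus q s' l \<mu> + coeff_Plus q s l \<mu> * coeff_Plus q s' l \<mu>
    = (if s = s' then 1 else 0)"
  using C_S_norm[of "l + 1/2" \<mu>] assms
  by (cases s; cases s') (auto simp: coeff_Minus_def coeff_Plus_def algebra_simps)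

lemma spinor_l_orthonormal:
  assumes "k \<in> spinor_index_l" "k' \<in> spinor_index_l"
  shows "cinner (spinor_l q k) (spinor_l q k') = (if k = k' then 1 else 0)"
proof -
  obtain s l \<mu> n s' l' \<mu>' n' where k: "k = (s, l, \<mu>, n)" "k' = (s', l', \<mu>', n')" by (metis prod_cases4)
  note bounds = spinor_index_l_bounds[OF assms(1)[unfolded k]]
  have "cinner (spinor_l q k) (spinor_l q k') =
    (if l' = l \<and> \<mu>' = \<mu> \<and> n' = n then
      complex_of_real (coeff_Minus q s l \<mu> * coeff_Minus q s' l \<mu>
        + coeff_Plus q s l \<mu> * coeff_Plus q s' l \<mu>) else 0)"
    unfolding k spinor_l.simps(1)[of q s' l' \<mu>' n'] cinner_add_right cinner_scaleC_right
      cinner_spinor_l_ket_spinor[OF assms(1)[unfolded k]]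
    by (auto simp: mult.commute)
  also have "\<dots> = (if k = k' then 1 else 0)"
    unfolding spinor_coeff_norm[OF bounds(1-3)] by (auto simp: k)
  finally show ?thesis .
qed

text \<open>Inversion of the rotation that defines the two spinors at fixed \<open>l\<close>,
  \<open>\<mu>\<close>, \<open>n\<close>; it gives the completeness of the spinor basis.\<close>

lemma ket_spinor_eq:
  assumes "0 \<le> l" "- (l + 1/2) \<le> \<mu>" "\<mu> \<le> l + 1/2"
  shows "ket_spinor l (\<mu> + 1/2) n Minus = of_real (C_coeff q (l + 1/2) \<mu>) *\<^sub>C spinor_l q (Down, l, \<mu>, n)
      - of_real (S_coeff q (l + 1/2) \<mu>) *\<^sub>C spinor_l q (Up, l, \<mu>, n)"
    and "ket_spinor l (\<mu> - 1/2) n Plus = of_real (S_coeff q (l + 1/2) \<mu>) *\<^sub>C spinor_l q (Down, l, \<mu>, n)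
      + of_real (C_coeff q (l + 1/2) \<mu>) *\<^sub>C spinor_l q (Up, l, \<mu>, n)"
proof -
  define c s where "c = complex_of_real (C_coeff q (l + 1/2) \<mu>)" and "s = complex_of_real (S_coeff q (l + 1/2) \<mu>)"
  have cs: "c * c + s * s = 1"
    using C_S_norm[of "l + 1/2" \<mu>] assms unfolding c_def s_def of_real_mult[symmetric] of_real_add[symmetric] by simp
  have "c * (c * x + s * y) - s * (c * y - s * x) = (c * c + s * s) * x"
    "s * (c * x + s * y) + c * (c * y - s * x) = (c * c + s * s) * y" for x y
    by (simp_all only: algebra_simps)
  then have rotation: "c * (c * x + s * y) - s * (c * y - s * x) = x" "s * (c * x + s * y) + c * (c * y - s * x) = y" for x y
    unfolding cs by simp_all
  show "ket_spinor l (\<mu> + 1/2) n Minus = of_real (C_coeff q (l + 1/2) \<mu>) *\<^sub>C spinor_l q (Down, l, \<mu>, n)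
      - of_real (S_coeff q (l + 1/2) \<mu>) *\<^sub>C spinor_l q (Up, l, \<mu>, n)"
    by (rule ell2_eqI)
      (simp add: coeff_Minus_def coeff_Plus_def rotation flip: c_def s_def)
  show "ket_spinor l (\<mu> - 1/2) n Plus = of_real (S_coeff q (l + 1/2) \<mu>) *\<^sub>C spinor_l q (Down, l, \<mu>, n)
      + of_real (C_coeff q (l + 1/2) \<mu>) *\<^sub>C spinor_l q (Up, l, \<mu>, n)"
    by (rule ell2_eqI)
      (simp add: coeff_Minus_def coeff_Plus_def rotation flip: c_def s_def)
qed

text \<open>Spinors and kets are related by a matrix \<open>M\<close> with at most two entries in
  each row and column, so it defines \<open>V\<close> with adjoint \<open>W\<close>. Orthonormality
  gives \<open>V \<circ> W = id\<close>; the other order needs that every ket lies in the range of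
  \<open>W\<close>.\<close>

lemma spinor_l_orthonormal_basis:
  fixes f :: "nat \<Rightarrow> arrow \<times> real \<times> real \<times> real"
  assumes f: "bij_betw f UNIV spinor_index_l"
  obtains V W where "orthonormal_basis (\<lambda>n. spinor_l q (f n)) V W"
proof -
  define M where "M n p = ell2_coeff (spinor_l q (f n)) p" for n p
  have f_mem: "f n \<in> spinor_index_l" for n using f by (auto simp: bij_betw_def)
  have f_inj: "f m = f n \<longleftrightarrow> m = n" for m n using f by (auto simp: bij_betw_def inj_on_def)
  have M: "M n (i, \<sigma>) = cinner (spinor_l q (f n)) (ket (i, \<sigma>))" for n i \<sigma>
  proof -
    obtain s l \<mu> n' where k: "f n = (s, l, \<mu>, n')" by (metis prod_cases4)
    show ?thesis
      unfolding M_def k cinner_commute[of _ "ket _"] cinner_ket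
      by (simp add: ell2_coeff_ket_spinor)
  qed
  have M_eq: "M n (i, \<sigma>) = (case f n of (s, l, \<mu>, n') \<Rightarrow> case \<sigma> of
      Minus \<Rightarrow> if Rep_lmn i = (l, \<mu> + 1/2, n') then complex_of_real (coeff_Minus q s l \<mu>) else 0
    | Plus \<Rightarrow> if Rep_lmn i = (l, \<mu> - 1/2, n') then complex_of_real (coeff_Plus q s l \<mu>) else 0)" for n i \<sigma>
    unfolding M_def by (cases "f n"; cases \<sigma>) (auto simp: ell2_coeff_ket_spinor)
  have bound: "cmod (M n p) \<le> 1" for n p
  proof -
    obtain s l \<mu> n' i \<sigma> where k: "f n = (s, l, \<mu>, n')" "p = (i, \<sigma>)" by (metis prod_cases4 surj_pair)
    have "\<bar>coeff_Minus q s l \<mu>\<bar> \<le> 1" "\<bar>coeff_Plus q s l \<mu>\<bar> \<le> 1"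
      using C_S_le[of "l + 1/2" \<mu>] spinor_index_l_bounds[of s l \<mu> n'] f_mem[of n, unfolded k]
      by (cases s; simp add: coeff_Minus_def coeff_Plus_def)+
    then show ?thesis unfolding k(2) M_eq k(1) by (cases \<sigma>) auto
  qed
  have rows: "finite {p. M n p \<noteq> 0}" "card {p. M n p \<noteq> 0} \<le> 2" for n
  proof -
    obtain s l \<mu> n' where k: "f n = (s, l, \<mu>, n')" by (metis prod_cases4)
    have *: "{p. M n p \<noteq> 0} \<subseteq> {(Abs_lmn (l, \<mu> + 1/2, n'), Minus), (Abs_lmn (l, \<mu> - 1/2, n'), Plus)}"
    proof
      fix p assume "p \<in> {p. M n p \<noteq> 0}"
      moreover obtain i \<sigma> where p: "p = (i, \<sigma>)" by (metis surj_pair)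
      ultimately have "\<sigma> = Minus \<and> Rep_lmn i = (l, \<mu> + 1/2, n') \<or> \<sigma> = Plus \<and> Rep_lmn i = (l, \<mu> - 1/2, n')"
        by (cases \<sigma>) (auto simp: M_eq k split: if_splits)
      then show "p \<in> {(Abs_lmn (l, \<mu> + 1/2, n'), Minus), (Abs_lmn (l, \<mu> - 1/2, n'), Plus)}"
        unfolding p using Rep_lmn_inverse[of i] by auto
    qed
    show "finite {p. M n p \<noteq> 0}" by (rule finite_subset[OF *]) simp
    show "card {p. M n p \<noteq> 0} \<le> 2" using card_mono[OF _ *] by simp
  qed
  have cols: "finite {n. M n p \<noteq> 0}" "card {n. M n p \<noteq> 0} \<le> 2" for p
  proof -
    obtain i \<sigma> where p: "p = (i, \<sigma>)" by (metis surj_pair)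
    obtain l m n' where i: "Rep_lmn i = (l, m, n')" by (metis prod_cases3)
    \<comment> \<open>The label of the spinors that contain this ket: \<open>m = \<mu> + 1/2\<close>
      for \<open>Minus\<close> and \<open>m = \<mu> - 1/2\<close> for \<open>Plus\<close>. Only the
      arrow is left free.\<close>
    define \<mu> where "\<mu> = (case \<sigma> of Minus \<Rightarrow> m - 1/2 | Plus \<Rightarrow> m + 1/2)"
    have *: "f ` {n. M n p \<noteq> 0} \<subseteq> {(Up, l, \<mu>, n'), (Down, l, \<mu>, n')}"
    proof
      fix k assume "k \<in> f ` {n. M n p \<noteq> 0}"
      then obtain n where n: "k = f n" "M n p \<noteq> 0" by auto
      obtain s l2 \<mu>2 n2 where k: "f n = (s, l2, \<mu>2, n2)" by (metis prod_cases4)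
      show "k \<in> {(Up, l, \<mu>, n'), (Down, l, \<mu>, n')}"
        using n(2) unfolding n(1) k p M_eq
        by (cases \<sigma>; cases s) (auto simp: i \<mu>_def split: if_splits)
    qed
    have inj: "inj_on f A" for A using f_inj by (auto simp: inj_on_def)
    show "finite {n. M n p \<noteq> 0}" using finite_subset[OF *] finite_imageD[OF _ inj] by simp
    have "card {n. M n p \<noteq> 0} = card (f ` {n. M n p \<noteq> 0})" by (rule card_image[OF inj, symmetric])
    also have "\<dots> \<le> card {(Up, l, \<mu>, n'), (Down, l, \<mu>, n')}" by (rule card_mono[OF _ *]) simp
    finally show "card {n. M n p \<noteq> 0} \<le> 2" by simp
  qed
  obtain V W where VW: "adjoint_pair V W" "\<And>p n. ell2_coeff (V (ket p)) n = M n p"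
    "\<And>p n. ell2_coeff (W (ket n)) p = cnj (M n p)"
    using band_adjoint_pair[of M 1 2] bound rows cols by blast
  note lin = bounded_clinear_simps[OF adjoint_pairD(1)[OF VW(1)]] bounded_clinear_simps[OF adjoint_pairD(2)[OF VW(1)]]
  have W_ket: "W (ket n) = spinor_l q (f n)" for n
  proof (rule ell2_eqI)
    fix p :: "lmn \<times> spin"
    obtain i \<sigma> where p: "p = (i, \<sigma>)" by (metis surj_pair)
    have "cnj (M n p) = M n p" unfolding p M_eq by (cases "f n"; cases \<sigma>) auto
    then show "ell2_coeff (W (ket n)) p = ell2_coeff (spinor_l q (f n)) p" by (simp add: VW(3) M_def)
  qed
  have VW_id: "V (W y) = y" for y
  proof -
    have "V \<circ> W = id"
    proof (rule bounded_clinear_eq_on_kets)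
      show "bounded_clinear (V \<circ> W)" by (intro bounded_clinear_compose adjoint_pairD[OF VW(1)])
      show "(V \<circ> W) (ket n) = id (ket n)" for n
      proof (rule ell2_eqI)
        fix m
        have "ell2_coeff ((V \<circ> W) (ket n)) m = cinner (spinor_l q (f m)) (spinor_l q (f n))"
          using adjoint_pairD(3)[OF VW(1), of "ket m" "W (ket n)"] by (simp add: cinner_ket W_ket)
        then show "ell2_coeff ((V \<circ> W) (ket n)) m = ell2_coeff (id (ket n)) m"
          by (simp add: spinor_l_orthonormal[OF f_mem f_mem] f_inj ell2_coeff_ket)
      qed
    qed (rule bounded_clinear_id)
    then show ?thesis by (metis comp_apply id_apply)
  qed
  have spinor_range: "spinor_l q k \<in> range W" if "k \<in> spinor_index_l" for k
  proof -
    have "k \<in> range f" using that f by (simp add: bij_betw_def)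
    then obtain n where "spinor_l q k = W (ket n)" unfolding W_ket by blast
    then show ?thesis by simp
  qed
  \<comment> \<open>Where no up spinor exists, its coefficient in \<open>ket_spinor_eq\<close> is 0;
    this is the alternative \<open>c' = 0\<close>.\<close>
  have combination_range: "c *\<^sub>C spinor_l q (Down, l, \<mu>, n) + c' *\<^sub>C spinor_l q (Up, l, \<mu>, n) \<in> range W"
    if k: "(Down, l, \<mu>, n) \<in> spinor_index_l" "(Up, l, \<mu>, n) \<in> spinor_index_l \<or> c' = 0" for c c' l \<mu> n
  proof -
    obtain x where x: "spinor_l q (Down, l, \<mu>, n) = W x" using spinor_range[OF k(1)] by blast
    obtain y where y: "c' *\<^sub>C spinor_l q (Up, l, \<mu>, n) = c' *\<^sub>C W y"
    proof (cases "c' = 0")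
      case False
      then obtain z where "spinor_l q (Up, l, \<mu>, n) = W z" using k(2) spinor_range by blast
      then show thesis by (intro that[of z]) simp
    qed simp
    have "c *\<^sub>C spinor_l q (Down, l, \<mu>, n) + c' *\<^sub>C spinor_l q (Up, l, \<mu>, n) = W (c *\<^sub>C x + c' *\<^sub>C y)"
      unfolding x y lin ..
    then show ?thesis by (simp only: rangeI)
  qed
  have "ket p \<in> range W" for p
  proof -
    obtain i \<sigma> where p: "p = (i, \<sigma>)" by (metis surj_pair)
    obtain l m n where i: "Rep_lmn i = (l, m, n)" by (metis prod_cases3)
    note valid = valid_Rep_lmn[OF i]
    note b = valid_lmn_bounds[OF valid]
    define \<mu> where "\<mu> = (case \<sigma> of Minus \<Rightarrow> m - 1/2 | Plus \<Rightarrow> m + 1/2)"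
    have idx: "2 * l \<in> \<nat>" "l + m \<in> \<nat>" "l - m \<in> \<nat>" "l + n \<in> \<nat>" "l - n \<in> \<nat>"
      using valid by (auto simp: valid_lmn_def)
    have down: "(Down, l, \<mu>, n) \<in> spinor_index_l"
      using idx Nats_plus_one[OF idx(2)] Nats_plus_one[OF idx(3)]
      by (cases \<sigma>) (simp_all add: spinor_index_l_def \<mu>_def algebra_simps)
    have \<mu>_bounds: "- (l + 1/2) \<le> \<mu>" "\<mu> \<le> l + 1/2" using b by (cases \<sigma>; simp add: \<mu>_def)+
    show ?thesis
    proof (cases \<sigma>)
      case Minus
      have "(Up, l, \<mu>, n) \<in> spinor_index_l \<or> \<mu> = - (l + 1/2)"
        using down Nats_minus_one[OF idx(2)] idx(3)
        by (cases "l + m = 0") (simp_all add: Minus spinor_index_l_def \<mu>_def algebra_simps)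
      then have up: "(Up, l, \<mu>, n) \<in> spinor_index_l \<or> - complex_of_real (S_coeff q (l + 1/2) \<mu>) = 0"
        by (elim disjE) (simp_all only: S_coeff_bot of_real_0 minus_zero simp_thms)
      have "ket p = ket_spinor l (\<mu> + 1/2) n Minus"
        using ket_spinor_Rep[OF i, of Minus] by (simp add: p \<mu>_def Minus)
      then show ?thesis
        using combination_range[OF down up, of "complex_of_real (C_coeff q (l + 1/2) \<mu>)"]
        by (simp only: ket_spinor_eq[OF b(1) \<mu>_bounds] diff_conv_add_uminus complex_vector.scale_minus_left)
    next
      case Plus
      have "(Up, l, \<mu>, n) \<in> spinor_index_l \<or> \<mu> = l + 1/2"
        using down Nats_minus_one[OF idx(3)] idx(2)
        by (cases "l - m = 0") (simp_all add: Plus spinor_index_l_def \<mu>_def algebra_simps)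
      then have up: "(Up, l, \<mu>, n) \<in> spinor_index_l \<or> complex_of_real (C_coeff q (l + 1/2) \<mu>) = 0"
        by (elim disjE) (simp_all only: C_coeff_top of_real_0 simp_thms)
      have "ket p = ket_spinor l (\<mu> - 1/2) n Plus"
        using ket_spinor_Rep[OF i, of Plus] by (simp add: p \<mu>_def Plus)
      then show ?thesis
        using combination_range[OF down up, of "complex_of_real (S_coeff q (l + 1/2) \<mu>)"]
        by (simp only: ket_spinor_eq(2)[OF b(1) \<mu>_bounds])
    qed
  qed
  \<comment> \<open>On the range of \<open>W\<close> the map \<open>W \<circ> V\<close> is the
    identity, by \<open>V \<circ> W = id\<close>.\<close>
  then have "(W \<circ> V) (ket p) = id (ket p)" for p
    using VW_id by (metis comp_apply id_apply rangeE)
  then have "W \<circ> V = id"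
    by (intro bounded_clinear_eq_on_kets bounded_clinear_compose bounded_clinear_id adjoint_pairD[OF VW(1)])
  then have "W (V x) = x" for x by (metis comp_apply id_apply)
  then have "orthonormal_basis (\<lambda>n. spinor_l q (f n)) V W"
    using VW(1) W_ket VW_id by (intro orthonormal_basis.intro)
  then show thesis by (rule that)
qed

end


section \<open>Increasing enumerations\<close>

text \<open>Greedy choice: \<open>f n\<close> minimizes \<open>g\<close> among the elements not yet
  listed. Finite sublevel sets give both the minimum and the divergence of \<open>g (f n)\<close>,
  and an element can stay unlisted only as long as \<open>g (f n)\<close> does not exceed its
  value.\<close>

lemma increasing_enumeration:
  fixes g :: "'k \<Rightarrow> real"
  assumes inf: "infinite K" and fin: "\<And>r. finite {k \<in> K. g k \<le> r}"
  obtains f :: "nat \<Rightarrow> 'k" where "bij_betw f UNIV K" "mono (\<lambda>n. g (f n))"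
    "filterlim (\<lambda>n. g (f n)) at_top sequentially"
proof -
  define least where "least F k \<longleftrightarrow> k \<in> K - F \<and> (\<forall>k'\<in>K - F. g k \<le> g k')" for F k
  have ex: "\<exists>k. least F k" if F: "finite F" for F
  proof -
    obtain k0 where k0: "k0 \<in> K - F" using infinite_imp_nonempty[OF Diff_infinite_finite[OF F inf]] by blast
    define A where "A = {k \<in> K - F. g k \<le> g k0}"
    have A: "finite A" unfolding A_def by (rule finite_subset[OF _ fin[of "g k0"]]) auto
    moreover have "k0 \<in> A" using k0 by (simp add: A_def)
    ultimately have "Min (g ` A) \<in> g ` A" by (intro Min_in) auto
    then obtain k where "k \<in> A" "g k = Min (g ` A)" by auto
    then have k: "k \<in> A" "\<And>k'. k' \<in> A \<Longrightarrow> g k \<le> g k'" using A by simp_all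
    have "g k \<le> g k'" if "k' \<in> K - F" for k'
      using k(1) k(2)[of k'] that by (cases "g k' \<le> g k0") (auto simp: A_def)
    then show ?thesis using k(1) by (auto simp: least_def A_def)
  qed
  define step where "step F = (SOME k. least F k)" for F
  \<comment> \<open>Course-of-values recursion, since each choice depends on the set of all earlier
    values.\<close>
  define f where "f = wfrec less_than (\<lambda>h n. step (h ` {..<n}))"
  have f: "least (f ` {..<n}) (f n)" for n
  proof -
    have "f n = step (cut f less_than n ` {..<n})"
      unfolding f_def by (rule wfrec[OF wf_less_than])
    also have "cut f less_than n ` {..<n} = f ` {..<n}"
      by (rule image_cong) (auto simp: cut_def)
    finally show ?thesis
      using someI_ex[OF ex[of "f ` {..<n}"]] by (simp add: step_def)
  qed
  have f_mem: "f n \<in> K" and f_new: "f n \<notin> f ` {..<n}" and f_le: "k \<in> K \<Longrightarrow> k \<notin> f ` {..<n} \<Longrightarrow> g (f n) \<le> g k" for n k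
    using f[of n] by (auto simp: least_def)
  have inj: "inj f"
  proof (rule linorder_injI)
    fix m n :: nat assume "m < n"
    then show "f m \<noteq> f n" using f_new[of n] by (metis imageI lessThan_iff)
  qed
  have mono: "mono (\<lambda>n. g (f n))"
  proof (rule monoI)
    fix m n :: nat assume "m \<le> n"
    then have "f n \<notin> f ` {..<m}" using f_new[of n] by auto
    then show "g (f m) \<le> g (f n)" by (rule f_le[OF f_mem])
  qed
  have unbounded: "\<exists>n. r < g (f n)" for r
  proof (rule ccontr)
    assume "\<nexists>n. r < g (f n)"
    then have "range f \<subseteq> {k \<in> K. g k \<le> r}" using f_mem by (auto simp: not_less)
    then have "finite (range f)" by (rule finite_subset[OF _ fin])
    then show False using inj finite_imageD[of f UNIV] by simp
  qed
  have "range f = K"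
  proof (intro equalityI subsetI)
    fix k assume k: "k \<in> K"
    obtain n where "g k < g (f n)" using unbounded by blast
    then have "k \<in> f ` {..<n}" using f_le[OF k, of n] not_less by blast
    then show "k \<in> range f" by blast
  qed (use f_mem in auto)
  moreover have "filterlim (\<lambda>n. g (f n)) at_top sequentially"
    unfolding filterlim_at_top_dense
  proof
    fix r
    obtain n where n: "r < g (f n)" using unbounded by blast
    have "r < g (f m)" if "n \<le> m" for m using n monoD[OF mono that] by linarith
    then show "\<forall>\<^sub>F n in sequentially. r < g (f n)" by (rule eventually_sequentiallyI)
  qed
  ultimately show thesis using that[of f] inj mono by (simp add: bij_betw_def)
qed

lemma diagonal_op_reindex:
  assumes "bij_betw f A B"
  shows "diagonal_op B e d = diagonal_op A (e \<circ> f) (d \<circ> f)"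
  unfolding diagonal_op_def
  using summable_on_reindex_bij_betw[OF assms, of "\<lambda>k. (d k)\<^sup>2 * (cmod (cinner (e k) x))\<^sup>2" for x]
    infsum_reindex_bij_betw[OF assms, of "\<lambda>k. (complex_of_real (d k) * cinner (e k) x) *\<^sub>C e k" for x]
  by simp


section \<open>The Dirac operator\<close>

definition eigenvalue :: "real \<Rightarrow> real \<Rightarrow> arrow \<times> real \<times> real \<times> real \<Rightarrow> real" where
  "eigenvalue c1 c2 = (\<lambda>(s, l, \<mu>, n). case s of Up \<Rightarrow> c1 * (l - 1/2) + c2 | Down \<Rightarrow> - (c1 * (l - 1/2) + c2))"

text \<open>This is where the relations between the constants enter: up to sign, the eigenvalue is the
  same linear function of \<open>l\<close> on both kinds of spinors.\<close>

lemma dirac_eq: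
  "dirac q c1 c2 (- c1) (- c2 + c1) = diagonal_op spinor_index_l (spinor_l q) (eigenvalue c1 c2)"
proof -
  have "(\<lambda>(s, j, \<mu>, n). case s of Up \<Rightarrow> c1 * j + c2 | Down \<Rightarrow> - c1 * j + (- c2 + c1)) \<circ> index_of_l = eigenvalue c1 c2"
    by (auto simp: fun_eq_iff eigenvalue_def algebra_simps split: arrow.splits)
  moreover have "spinor q \<circ> index_of_l = spinor_l q" by (simp add: fun_eq_iff spinor_index_of_l)
  ultimately show ?thesis
    unfolding dirac_def diagonal_op_reindex[OF bij_betw_index_of_l] by simp
qed

text \<open>\<open>\<Lambda>\<close> bounds \<open>l\<close>, by solving the bound on the
  eigenvalue. The map \<open>h\<close> sends an index to its arrow and the natural numbers
  \<open>2 * l\<close>, \<open>l + 1/2 + \<mu>\<close>, \<open>l + n\<close>, each bounded linearly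
  in \<open>r\<close>; this is where the exponent 3 comes from.\<close>

lemma card_spinor_index_l:
  fixes c1 c2 r :: real
  assumes c1: "c1 \<noteq> 0" and r: "0 \<le> r"
  shows "finite {k \<in> spinor_index_l. \<bar>eigenvalue c1 c2 k\<bar> \<le> r}" (is "finite ?A")
    and "real (card {k \<in> spinor_index_l. \<bar>eigenvalue c1 c2 k\<bar> \<le> r}) \<le> (2 * (2 * ((r + \<bar>c2\<bar>) / \<bar>c1\<bar> + 1/2) + 2)) ^ 3"
proof -
  define \<Lambda> where "\<Lambda> = (r + \<bar>c2\<bar>) / \<bar>c1\<bar> + 1/2"
  define P where "P = nat \<lfloor>2 * \<Lambda>\<rfloor>"
  define h where "h = (\<lambda>(s :: arrow, l :: real, \<mu> :: real, n :: real). (s, 2 * l, l + 1/2 + \<mu>, l + n))"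
  define B where "B = {Up, Down} \<times> real ` {..P} \<times> real ` {..P + 1} \<times> real ` {..P}"
  have \<Lambda>: "0 \<le> \<Lambda>" using r by (simp add: \<Lambda>_def)
  \<comment> \<open>A natural number below \<open>N + 1\<close> is at most \<open>N\<close>;
    \<open>y\<close> will be the fractional part of \<open>2 * \<Lambda>\<close>.\<close>
  have le_P: "x \<in> real ` {..N}" if x: "x \<in> \<nat>" "x \<le> real N + y" "y < 1" for x y N
  proof -
    obtain k where k: "x = real k" using x(1) by (rule Nats_cases)
    then have "real k < real (Suc N)" using x by simp
    then show ?thesis unfolding k by (intro imageI) simp
  qed
  have sub: "h ` ?A \<subseteq> B"
  proof
    fix y assume "y \<in> h ` ?A"
    then obtain s l \<mu> n where k: "(s, l, \<mu>, n) \<in> spinor_index_l" "\<bar>eigenvalue c1 c2 (s, l, \<mu>, n)\<bar> \<le> r"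
      and y: "y = (s, 2 * l, l + 1/2 + \<mu>, l + n)" by (auto simp: h_def)
    note b = spinor_index_l_bounds[OF k(1)]
    have "\<bar>c1 * (l - 1/2) + c2\<bar> \<le> r" using k(2) by (cases s) (simp_all only: eigenvalue_def prod.case arrow.case abs_minus_cancel)
    then have "\<bar>c1\<bar> * \<bar>l - 1/2\<bar> \<le> r + \<bar>c2\<bar>" unfolding abs_mult[symmetric] by linarith
    then have abs_le: "\<bar>l - 1/2\<bar> \<le> (r + \<bar>c2\<bar>) / \<bar>c1\<bar>" using c1 by (simp add: field_simps)
    have double: "2 * l \<le> 2 * (u + 1/2)" if "\<bar>l - 1/2\<bar> \<le> u" for u
      using that by (simp add: abs_le_iff)
    have l: "2 * l \<le> 2 * \<Lambda>" unfolding \<Lambda>_def by (rule double[OF abs_le])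
    have "2 * \<Lambda> < real P + 1" using \<Lambda> unfolding P_def by linarith
    moreover define y0 where "y0 = 2 * \<Lambda> - real P"
    ultimately have P: "2 * \<Lambda> = real P + y0" "y0 < 1" by auto
    have "l + n \<in> \<nat>" "l + 1/2 + \<mu> \<in> \<nat>" using k(1) by (auto simp: spinor_index_l_def)
    then show "y \<in> B"
      using le_P[of "2 * l" P y0] le_P[of "l + 1/2 + \<mu>" "P + 1" y0] le_P[of "l + n" P y0] b l P
      unfolding y B_def by (cases s) auto
  qed
  have B: "finite B" "card B \<le> 2 * ((P + 1) * ((P + 2) * (P + 1)))"
  proof -
    show "finite B" by (simp add: B_def)
    have "card {Up, Down} = 2" by simp
    then show "card B \<le> 2 * ((P + 1) * ((P + 2) * (P + 1)))"
      by (simp add: B_def card_cartesian_product card_image)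
  qed
  have h: "inj_on h ?A" by (rule inj_onI) (auto simp: h_def)
  show "finite ?A" by (rule finite_imageD[OF finite_subset[OF sub B(1)] h])
  have "card ?A = card (h ` ?A)" using card_image[OF h] by simp
  also have "\<dots> \<le> card B" by (rule card_mono[OF B(1) sub])
  also have "\<dots> \<le> 2 * ((P + 1) * ((P + 2) * (P + 1)))" by (rule B(2))
  also have "\<dots> \<le> (2 * (P + 2)) ^ 3" by (simp add: power3_eq_cube algebra_simps)
  finally have "real (card ?A) \<le> real ((2 * (P + 2)) ^ 3)" by (simp only: of_nat_le_iff)
  also have "real ((2 * (P + 2)) ^ 3) = (2 * (real P + 2)) ^ 3" by (simp add: algebra_simps)
  also have "real P \<le> 2 * \<Lambda>" using \<Lambda> unfolding P_def by linarith
  then have "(2 * (real P + 2)) ^ 3 \<le> (2 * (2 * \<Lambda> + 2)) ^ 3" by (intro power_mono) auto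
  finally show "real (card ?A) \<le> (2 * (2 * ((r + \<bar>c2\<bar>) / \<bar>c1\<bar> + 1/2) + 2)) ^ 3" by (simp only: \<Lambda>_def)
qed

lemma infinite_spinor_index_l: "infinite spinor_index_l"
proof
  assume "finite spinor_index_l"
  moreover have "(\<lambda>k. (Down, real k, 1/2, 0)) ` UNIV \<subseteq> spinor_index_l"
    by (auto simp: spinor_index_l_def Nats_add)
  ultimately have "finite (range (\<lambda>k. (Down, real k, 1/2 :: real, 0 :: real)))" by (rule finite_subset[rotated])
  then have "finite (UNIV :: nat set)" by (rule finite_imageD) (auto simp: inj_on_def)
  then show False by simp
qed

text \<open>Brings the cubic count into the form demanded by \<open>growth\<close> in
  \<open>plus_summable\<close>: both 1 and \<open>r\<close> are at most
  \<open>t = sqrt (1 + r\<^sup>2)\<close>, so an affine bound in \<open>r\<close> is absorbed into a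
  multiple of \<open>t\<close>.\<close>

lemma spinor_index_l_growth:
  fixes c1 c2 r :: real
  assumes "c1 \<noteq> 0" "0 \<le> r"
  shows "real (card {k \<in> spinor_index_l. \<bar>eigenvalue c1 c2 k\<bar> \<le> r})
    \<le> (4 * (2 * ((1 + \<bar>c2\<bar>) / \<bar>c1\<bar>) + 3) * sqrt (1 + r\<^sup>2)) powr 3"
proof -
  define t where "t = sqrt (1 + r\<^sup>2)"
  have t: "1 \<le> t" "r \<le> t" using real_le_rsqrt[of r "1 + r\<^sup>2"] by (simp_all add: t_def)
  have quot: "(r + \<bar>c2\<bar>) / \<bar>c1\<bar> \<le> (1 + \<bar>c2\<bar>) / \<bar>c1\<bar> * t"
  proof -
    have "r + \<bar>c2\<bar> \<le> (1 + \<bar>c2\<bar>) * t" using t mult_left_mono[of 1 t "\<bar>c2\<bar>"] by (simp add: algebra_simps)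
    then show ?thesis by (simp add: divide_right_mono)
  qed
  have shift: "2 * (2 * (u + 1/2) + 2) \<le> 2 * (2 * v + 3 * t)" if "u \<le> v" for u v :: real
    using t that by simp
  have "2 * (2 * ((r + \<bar>c2\<bar>) / \<bar>c1\<bar> + 1/2) + 2) \<le> 2 * (2 * ((1 + \<bar>c2\<bar>) / \<bar>c1\<bar> * t) + 3 * t)"
    by (rule shift[OF quot])
  also have "\<dots> = 2 * (2 * ((1 + \<bar>c2\<bar>) / \<bar>c1\<bar>) + 3) * t" by (simp add: algebra_simps)
  also have "\<dots> \<le> 4 * (2 * ((1 + \<bar>c2\<bar>) / \<bar>c1\<bar>) + 3) * t" using t by (intro mult_right_mono) auto
  finally have le: "2 * (2 * ((r + \<bar>c2\<bar>) / \<bar>c1\<bar> + 1/2) + 2) \<le> 4 * (2 * ((1 + \<bar>c2\<bar>) / \<bar>c1\<bar>) + 3) * t" .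
  have "0 \<le> 2 * (2 * ((r + \<bar>c2\<bar>) / \<bar>c1\<bar> + 1/2) + 2)" using assms by simp
  then have "(2 * (2 * ((r + \<bar>c2\<bar>) / \<bar>c1\<bar> + 1/2) + 2)) ^ 3 \<le> (4 * (2 * ((1 + \<bar>c2\<bar>) / \<bar>c1\<bar>) + 3) * t) ^ 3"
    by (intro power_mono le)
  moreover have "0 < 4 * (2 * ((1 + \<bar>c2\<bar>) / \<bar>c1\<bar>) + 3) * t" using t by (intro mult_pos_pos add_nonneg_pos) auto
  ultimately show ?thesis
    using card_spinor_index_l(2)[OF assms, of c2] by (simp only: t_def powr_numeral)
qed


section \<open>Matrix elements of the generators and of their commutators\<close>

lemma tensor_op_ladder_ket_spinor:
  assumes "valid_lmn l m n"
  shows "tensor_op (ladder s t u d) id (ket_spinor l m n \<sigma>) =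
      of_real (u l m n) *\<^sub>C ket_spinor (l + 1/2) (m + s) (n + t) \<sigma>
    + of_real (d l m n) *\<^sub>C ket_spinor (l - 1/2) (m + s) (n + t) \<sigma>"
proof -
  obtain i where i: "Rep_lmn i = (l, m, n)" "ket_lmn l m n = ket i" using assms by (rule ket_lmn_cases)
  have "tensor_op (ladder s t u d) id (ket_spinor l m n \<sigma>) = ladder_vec s t u d l m n \<otimes>\<^sub>2 ket \<sigma>"
    unfolding ket_spinor_Rep[OF i(1)] tensor_op_def extend_basis_ket
    using ladder_ket[OF assms, of s t u d] by (simp add: i(2))
  then show ?thesis
    by (simp add: ladder_vec_def ket_spinor_def)
      (rule ell2_eqI, simp add: tensor.rep_eq algebra_simps split: prod.splits)
qed

context suq2
begin

lemma cinner_spinor_l_ladder: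
  assumes lin: "bounded_clinear (tensor_op (ladder (1/2) t u d) id :: spinors \<Rightarrow> spinors)"
    and k: "(s, l, \<mu>, n) \<in> spinor_index_l" and k': "(s', l', \<mu>', n') \<in> spinor_index_l"
  shows "cinner (spinor_l q (s', l', \<mu>', n')) (tensor_op (ladder (1/2) t u d) id (spinor_l q (s, l, \<mu>, n)))
    = (if \<mu>' = \<mu> + 1/2 \<and> n' = n + t then
        (if l' = l + 1/2 then complex_of_real
            (coeff_Minus q s' l' \<mu>' * coeff_Minus q s l \<mu> * u l (\<mu> + 1/2) n
              + coeff_Plus q s' l' \<mu>' * coeff_Plus q s l \<mu> * u l (\<mu> - 1/2) n)
         else if l' = l - 1/2 then complex_of_real
            (coeff_Minus q s' l' \<mu>' * coeff_Minus q s l \<mu> * d l (\<mu> + 1/2) n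
              + coeff_Plus q s' l' \<mu>' * coeff_Plus q s l \<mu> * d l (\<mu> - 1/2) n)
         else 0)
       else 0)"
proof -
  let ?T = "tensor_op (ladder (1/2) t u d) id :: spinors \<Rightarrow> spinors"
  \<comment> \<open>The operator is expanded at valid indices only; in the remaining case the spinor
    coefficient \<open>c\<close> is 0.\<close>
  have T: "complex_of_real c *\<^sub>C ?T (ket_spinor l m n \<sigma>) = complex_of_real c *\<^sub>C
     (of_real (u l m n) *\<^sub>C ket_spinor (l + 1/2) (m + 1/2) (n + t) \<sigma>
    + of_real (d l m n) *\<^sub>C ket_spinor (l - 1/2) (m + 1/2) (n + t) \<sigma>)"
    if "valid_lmn l m n \<or> c = 0" for c m \<sigma>
    using that tensor_op_ladder_ket_spinor[of l m n "1/2" t u d \<sigma>] by (cases "c = 0") auto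
  have *: "?T (spinor_l q (s, l, \<mu>, n)) =
      of_real (coeff_Minus q s l \<mu>) *\<^sub>C ?T (ket_spinor l (\<mu> + 1/2) n Minus)
    + of_real (coeff_Plus q s l \<mu>) *\<^sub>C ?T (ket_spinor l (\<mu> - 1/2) n Plus)"
    by (simp add: bounded_clinear_simps[OF lin])
  show ?thesis
    unfolding * T[OF spinor_coeff_zero(1)[OF k]] T[OF spinor_coeff_zero(2)[OF k]]
      cinner_add_right cinner_scaleC_right cinner_spinor_l_ket_spinor[OF k']
    by (auto simp: algebra_simps)
qed

text \<open>\<open>X\<close> and \<open>Y\<close> isolate the dependence on \<open>m\<close>: the
  mixed entries combine two kets with different \<open>m\<close>, and only with this dependence in
  closed form can their cancellation be computed.\<close>

lemma commutator_matrix_bound: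
  assumes lin: "bounded_clinear (tensor_op (ladder (1/2) t u d) id :: spinors \<Rightarrow> spinors)"
    and u: "\<And>l m n. u l m n = X l n * (q powr (m / 2) * sqrt (qn (l + m + 1)))"
    and d: "\<And>l m n. d l m n = Y l n * (q powr (m / 2) * sqrt (qn (l - m)))"
    and u_le: "\<And>l m n. valid_lmn l m n \<Longrightarrow> \<bar>u l m n\<bar> \<le> 1"
    and d_le: "\<And>l m n. valid_lmn l m n \<Longrightarrow> \<bar>d l m n\<bar> \<le> 1"
  shows "\<exists>C. \<forall>k\<in>spinor_index_l. \<forall>k'\<in>spinor_index_l.
    cmod ((complex_of_real (eigenvalue c1 c2 k') - complex_of_real (eigenvalue c1 c2 k))
      * cinner (spinor_l q k') (tensor_op (ladder (1/2) t u d) id (spinor_l q k))) \<le> C"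
proof -
  let ?T = "tensor_op (ladder (1/2) t u d) id :: spinors \<Rightarrow> spinors"
  define \<kappa> where "\<kappa> = sqrt (1 / (1 / q - q))"
  have \<kappa>: "0 \<le> \<kappa>" using q_inverse by (simp add: \<kappa>_def divide_inverse)
  define E where "E = 2 * (\<bar>c1\<bar> + \<bar>c2\<bar>)"
  \<comment> \<open>The first entry of the maximum is the difference
    \<open>\<bar>c1\<bar> / 2\<close> of eigenvalues with equal arrows times the bound 2 for a sum
    of two products; the second is the constant of the mixed case.\<close>
  define C where "C = max \<bar>c1\<bar> (E * (\<kappa> * q powr (-3/2) * (1 + 1 / (- ln q))))"
  have "cmod ((complex_of_real (eigenvalue c1 c2 (s', l', \<mu>', n')) - complex_of_real (eigenvalue c1 c2 (s, l, \<mu>, n)))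
      * cinner (spinor_l q (s', l', \<mu>', n')) (?T (spinor_l q (s, l, \<mu>, n)))) \<le> C"
    if k: "(s, l, \<mu>, n) \<in> spinor_index_l" and k': "(s', l', \<mu>', n') \<in> spinor_index_l" for s l \<mu> n s' l' \<mu>' n'
  proof -
    note b = spinor_index_l_bounds[OF k] and b' = spinor_index_l_bounds[OF k']
    note zero = spinor_coeff_zero[OF k]
    define w where "w u = coeff_Minus q s' l' \<mu>' * coeff_Minus q s l \<mu> * u l (\<mu> + 1/2) n
      + coeff_Plus q s' l' \<mu>' * coeff_Plus q s l \<mu> * u l (\<mu> - 1/2) n" for u :: "real \<Rightarrow> real \<Rightarrow> real \<Rightarrow> real"
    define \<delta> where "\<delta> = eigenvalue c1 c2 (s', l', \<mu>', n') - eigenvalue c1 c2 (s, l, \<mu>, n)"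
    have C0: "0 \<le> C" unfolding C_def by (rule order_trans[OF abs_ge_zero max.cobounded1])
    have coeff_le: "\<bar>coeff_Minus q s l \<mu>\<bar> \<le> 1" "\<bar>coeff_Plus q s l \<mu>\<bar> \<le> 1"
      "\<bar>coeff_Minus q s' l' \<mu>'\<bar> \<le> 1" "\<bar>coeff_Plus q s' l' \<mu>'\<bar> \<le> 1"
    proof -
      have "0 < l + 1/2" "0 < l' + 1/2" using b(1) b'(1) by simp_all
      note cs = C_S_le[OF this(1) b(2,3)] C_S_le[OF this(2) b'(2,3)]
      show "\<bar>coeff_Minus q s l \<mu>\<bar> \<le> 1" "\<bar>coeff_Plus q s l \<mu>\<bar> \<le> 1"
        using cs(1,2) by (cases s; simp add: coeff_Minus_def coeff_Plus_def)+
      show "\<bar>coeff_Minus q s' l' \<mu>'\<bar> \<le> 1" "\<bar>coeff_Plus q s' l' \<mu>'\<bar> \<le> 1"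
        using cs(3,4) by (cases s'; simp add: coeff_Minus_def coeff_Plus_def)+
    qed
    have prod_le: "\<bar>x * y * z\<bar> \<le> 1" if "\<bar>x\<bar> \<le> 1" "\<bar>y\<bar> \<le> 1" "\<bar>z\<bar> \<le> 1 \<or> y = 0" for x y z :: real
    proof (cases "y = 0")
      case False
      then show ?thesis using that unfolding abs_mult by (intro mult_le_one mult_nonneg_nonneg) auto
    qed simp
    have w_le: "\<bar>w v\<bar> \<le> 2" if "\<And>l m n. valid_lmn l m n \<Longrightarrow> \<bar>v l m n\<bar> \<le> 1" for v
    proof -
      have "\<bar>coeff_Minus q s' l' \<mu>' * coeff_Minus q s l \<mu> * v l (\<mu> + 1/2) n\<bar> \<le> 1"
        using zero(1) that[of l "\<mu> + 1/2" n] coeff_le by (intro prod_le) blast+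
      moreover have "\<bar>coeff_Plus q s' l' \<mu>' * coeff_Plus q s l \<mu> * v l (\<mu> - 1/2) n\<bar> \<le> 1"
        using zero(2) that[of l "\<mu> - 1/2" n] coeff_le by (intro prod_le) blast+
      ultimately show ?thesis unfolding w_def by linarith
    qed
    have decay: "\<bar>\<delta>\<bar> * \<bar>x\<bar> \<le> C" if x: "\<bar>x\<bar> \<le> \<kappa> * q powr (l - 3/2)" and \<delta>: "\<bar>\<delta>\<bar> \<le> E * (1 + l)" for x
    proof -
      have "\<bar>\<delta>\<bar> * \<bar>x\<bar> \<le> (E * (1 + l)) * (\<kappa> * q powr (l - 3/2))"
        by (intro mult_mono x \<delta>) (use b in \<open>auto simp: E_def\<close>)
      also have "\<dots> = E * (\<kappa> * q powr (-3/2) * ((1 + l) * q powr l))"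
        using powr_add[of q l "-3/2"] by simp
      also have "\<dots> \<le> E * (\<kappa> * q powr (-3/2) * (1 + 1 / (- ln q)))"
        using \<kappa> by (intro mult_left_mono linear_times_powr_bounded q b) (auto simp: E_def)
      also have "\<dots> \<le> C" by (simp add: C_def)
      finally show ?thesis .
    qed
    have main: "\<bar>\<delta>\<bar> * \<bar>w v\<bar> \<le> C"
      if \<mu>': "\<mu>' = \<mu> + 1/2" and l': "l' = l + 1/2 \<and> v = u \<or> l' = l - 1/2 \<and> v = d" for v
    proof (cases "s = s'")
      case True
      have "\<delta> = c1 * (l' - l) \<or> \<delta> = - (c1 * (l' - l))"
        using True by (cases s) (auto simp: \<delta>_def eigenvalue_def algebra_simps)
      then have "\<bar>\<delta>\<bar> = \<bar>c1\<bar> / 2" using l' by (auto simp: abs_mult)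
      moreover have "\<bar>w v\<bar> \<le> 2" using l' w_le u_le d_le by auto
      ultimately have "\<bar>\<delta>\<bar> * \<bar>w v\<bar> \<le> \<bar>c1\<bar> / 2 * 2" by (intro mult_mono) auto
      then show ?thesis by (simp add: C_def)
    next
      case False
      have \<delta>: "\<bar>\<delta>\<bar> \<le> E * (1 + l)"
      proof -
        have "\<delta> = c1 * (l' + l - 1) + 2 * c2 \<or> \<delta> = - (c1 * (l' + l - 1) + 2 * c2)"
          using False by (cases s; cases s') (auto simp: \<delta>_def eigenvalue_def algebra_simps)
        then have "\<bar>\<delta>\<bar> \<le> \<bar>c1 * (l' + l - 1)\<bar> + \<bar>2 * c2\<bar>" by linarith
        also have "\<bar>c1 * (l' + l - 1)\<bar> \<le> \<bar>c1\<bar> * (2 * (1 + l))"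
          unfolding abs_mult using l' b b' by (intro mult_left_mono) (auto simp: abs_le_iff)
        also have "\<bar>2 * c2\<bar> \<le> \<bar>c2\<bar> * (2 * (1 + l))"
          using mult_left_mono[of 2 "2 * (1 + l)" "\<bar>c2\<bar>"] b by (simp add: abs_mult)
        finally show ?thesis by (simp add: E_def algebra_simps)
      qed
      \<comment> \<open>The two mixed entries that survive decay like \<open>q powr l\<close> and
        \<open>q powr (l - 3/2)\<close>; the weaker bound serves for both.\<close>
      have q_mono: "q powr l \<le> q powr (l - 3/2)" using q by (intro powr_mono') auto
      define j where "j = l + 1/2"
      have args: "l + (\<mu> + 1/2) + 1 = j + \<mu> + 1" "l + (\<mu> - 1/2) + 1 = j + \<mu>" "l - (\<mu> + 1/2) = j - \<mu> - 1"
        "l - (\<mu> - 1/2) = j - \<mu>" by (simp_all add: j_def)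
      have j_bounds: "- j \<le> \<mu>" "\<mu> \<le> j" using b(2,3) by (simp_all add: j_def)
      have l'_j: "l' = l + 1/2 \<Longrightarrow> l' + 1/2 = j + 1/2" "l' = l - 1/2 \<Longrightarrow> l' + 1/2 = j - 1/2"
        by (simp_all add: j_def)
      have "\<bar>w v\<bar> \<le> \<kappa> * q powr (l - 3/2)"
      proof (cases "l' = l + 1/2")
        case True
        then have v: "v = u" using l' by auto
        \<comment> \<open>At \<open>m = l\<close> the bound 1 for \<open>u\<close> becomes a bound
          for \<open>X l n\<close> that involves \<open>[2l + 1] = [2j]\<close>, a factor of the
          denominator of the entry.\<close>
        have valid: "valid_lmn l l n"
          using k by (auto simp: spinor_index_l_def valid_lmn_def)
        have X: "\<bar>X l n\<bar> * (q powr (l / 2) * sqrt (qn (2 * l + 1))) \<le> 1"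
          using u_le[OF valid] qnum_nonneg[of "2 * l + 1"] b by (simp add: u abs_mult)
        show ?thesis
        proof (cases s)
          case Up
          then have "s' = Down" using False by (cases s') auto
          then have "w v = 0"
            unfolding w_def v u args coeff_Minus_def coeff_Plus_def Up arrow.case l'_j(1)[OF True] \<mu>' j_def[symmetric]
            using up_to_down_plus[of j \<mu> "X l n"] by simp
          then show ?thesis using \<kappa> by simp
        next
          case Down
          then have "s' = Up" using False by (cases s') auto
          then have w: "w v = - (X l n * sqrt (qn (j - \<mu>)) / (sqrt (qn (2 * j)) * sqrt (qn (2 * j + 1))) * q powr (j + \<mu> / 2 + 1/4))"
            unfolding w_def v u args coeff_Minus_def coeff_Plus_def Down arrow.case l'_j(1)[OF True] \<mu>' j_def[symmetric]
            using down_to_up_plus[OF j_bounds(1), of "X l n"] by simp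
          have "\<bar>w v\<bar> \<le> \<kappa> * q powr l"
            unfolding w abs_minus_cancel \<kappa>_def by (rule down_to_up_plus_bound[OF b(1) j_def j_bounds X])
          also have "\<dots> \<le> \<kappa> * q powr (l - 3/2)" using q_mono \<kappa> by (intro mult_left_mono)
          finally show ?thesis .
        qed
      next
        case False': False
        then have l'_eq: "l' = l - 1/2" and v: "v = d" using l' by auto
        \<comment> \<open>At \<open>m = - l\<close> the bound 1 for \<open>d\<close> brings in
          \<open>[2l] = [2j - 1]\<close>, again a factor of the denominator.\<close>
        have valid: "valid_lmn l (- l) n"
          using k by (auto simp: spinor_index_l_def valid_lmn_def)
        have Y: "\<bar>Y l n\<bar> * (q powr (- l / 2) * sqrt (qn (2 * l))) \<le> 1"
          using d_le[OF valid] qnum_nonneg[of "2 * l"] b by (simp add: d abs_mult)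
        show ?thesis
        proof (cases s)
          case Up
          then have s': "s' = Down" using False by (cases s') auto
          have \<mu>_le: "\<mu> \<le> j - 1" using b(7)[OF Up] by (simp add: j_def)
          have w: "w v = Y l n * sqrt (qn (j + \<mu>)) / (sqrt (qn (2 * j)) * sqrt (qn (2 * j - 1))) * q powr (- j + \<mu> / 2 + 1/4)"
            unfolding w_def v d args s' coeff_Minus_def coeff_Plus_def Up arrow.case l'_j(2)[OF l'_eq] \<mu>' j_def[symmetric]
            using up_to_down_minus[OF \<mu>_le, of "Y l n"] by simp
          have l1: "1 \<le> 2 * l" using b'(1) l'_eq by simp
          show ?thesis
            unfolding w \<kappa>_def by (rule up_to_down_minus_bound[OF l1 j_def j_bounds Y])
        next
          case Down
          then have s': "s' = Up" using False by (cases s') auto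
          have "w v = 0"
            unfolding w_def v d args s' coeff_Minus_def coeff_Plus_def Down arrow.case l'_j(2)[OF l'_eq] \<mu>' j_def[symmetric]
            using down_to_up_minus[of j \<mu> "Y l n"] by simp
          then show ?thesis using \<kappa> by simp
        qed
      qed
      then show ?thesis using \<delta> by (rule decay)
    qed
    have "cinner (spinor_l q (s', l', \<mu>', n')) (?T (spinor_l q (s, l, \<mu>, n)))
      = (if \<mu>' = \<mu> + 1/2 \<and> n' = n + t then (if l' = l + 1/2 then complex_of_real (w u) else
          if l' = l - 1/2 then complex_of_real (w d) else 0) else 0)"
      unfolding cinner_spinor_l_ladder[OF lin k k'] w_def ..
    then show ?thesis
      unfolding norm_mult of_real_diff[symmetric] norm_of_real \<delta>_def[symmetric]
      using main[of u] main[of d] C0 by auto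
  qed
  then show ?thesis by (intro exI[of _ C] ballI) (simp only: split_paired_all)
qed

text \<open>In every coefficient the exponent of \<open>q\<close> is affine in \<open>m\<close>, and
  a single q-number under the root contains \<open>m\<close>. The real function \<open>sqrt\<close>
  is multiplicative on negative numbers too, so the factorization is valid for all
  arguments.\<close>

lemma pi_gen_factorized:
  obtains t u d X Y where "pi_gen q g = ladder (1/2) t u d"
    "\<And>l m n. u l m n = X l n * (q powr (m / 2) * sqrt (qn (l + m + 1)))"
    "\<And>l m n. d l m n = Y l n * (q powr (m / 2) * sqrt (qn (l - m)))"
    "\<And>l m n. valid_lmn l m n \<Longrightarrow> \<bar>u l m n\<bar> \<le> 1"
    "\<And>l m n. valid_lmn l m n \<Longrightarrow> \<bar>d l m n\<bar> \<le> 1"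
proof (cases g)
  case gen_a
  show thesis
  proof (rule that)
    show "pi_gen q g = ladder (1/2) (1/2) (Ap) (Am)"
      unfolding gen_a pi_gen_eq_ladder ..
    show "Ap l m n = (\<lambda>l n. q powr ((- 2 * l + n - 1) / 2) * sqrt (qn (l + n + 1) / (qn (2 * l + 1) * qn (2 * l + 2)))) l n
        * (q powr (m / 2) * sqrt (qn (l + m + 1)))" for l m n
    proof -
      have "(- 2 * l + m + n - 1) / 2 = (- 2 * l + n - 1) / 2 + m / 2" by (simp add: field_simps)
      then show ?thesis by (simp only: A_plus_def powr_add) (simp add: real_sqrt_mult real_sqrt_divide)
    qed
    show "Am l m n = (\<lambda>l n. q powr ((2 * l + n + 1) / 2) * sqrt (qn (l - n) / (qn (2 * l) * qn (2 * l + 1)))) l n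
        * (q powr (m / 2) * sqrt (qn (l - m)))" for l m n
    proof -
      have "(2 * l + m + n + 1) / 2 = (2 * l + n + 1) / 2 + m / 2" by (simp add: field_simps)
      then show ?thesis by (simp only: A_minus_def powr_add) (simp add: real_sqrt_mult real_sqrt_divide)
    qed
  qed (rule abs_A_plus_le abs_A_minus_le; assumption)+
next
  case gen_b
  show thesis
  proof (rule that)
    show "pi_gen q g = ladder (1/2) (-1/2) (Bp) (Bm)"
      unfolding gen_b pi_gen_eq_ladder ..
    show "Bp l m n = (\<lambda>l n. q powr ((n - 1) / 2) * sqrt (qn (l - n + 1) / (qn (2 * l + 1) * qn (2 * l + 2)))) l n
        * (q powr (m / 2) * sqrt (qn (l + m + 1)))" for l m n
    proof -
      have "(m + n - 1) / 2 = (n - 1) / 2 + m / 2" by (simp add: field_simps)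
      then show ?thesis by (simp only: B_plus_def powr_add) (simp add: real_sqrt_mult real_sqrt_divide)
    qed
    show "Bm l m n = (\<lambda>l n. - (q powr ((n - 1) / 2)) * sqrt (qn (l + n) / (qn (2 * l) * qn (2 * l + 1)))) l n
        * (q powr (m / 2) * sqrt (qn (l - m)))" for l m n
    proof -
      have "(m + n - 1) / 2 = (n - 1) / 2 + m / 2" by (simp add: field_simps)
      then show ?thesis by (simp only: B_minus_def powr_add) (simp add: real_sqrt_mult real_sqrt_divide)
    qed
  qed (rule abs_B_plus_le abs_B_minus_le; assumption)+
qed

lemma star_representation_spinor_rep: "star_representation (A_SUq2 q) (spinor_rep q)"
proof -
  note rel = pi_gen_adjoint_pair pi_gen_relations
  have adj: "\<exists>S. adjoint_pair (pi_rep q X) S" if "X \<in> carrier (A_SUq2 q)" for X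
  proof -
    obtain x where "X = star_class (suq2_relations q) x"
      using \<open>X \<in> carrier (A_SUq2 q)\<close> unfolding A_SUq2_def presented_star_alg_simps(1) by blast
    then show ?thesis
      unfolding pi_rep_def using induced_rep_star_class[of "pi_gen q", OF rel]
        star_eval_adjoint_pair[of "pi_gen q", OF rel(1)] by auto
  qed
  have rep: "star_representation (A_SUq2 q) (pi_rep q)"
    unfolding A_SUq2_def pi_rep_def by (rule star_representation_induced_rep[of "pi_gen q", OF rel])
  have star: "star (A_SUq2 q) X \<in> carrier (A_SUq2 q)" if "X \<in> carrier (A_SUq2 q)" for X
    using star_algebra.star_closed[OF presented_star_algebra] that unfolding A_SUq2_def by blast
  show ?thesis
    unfolding spinor_rep_def[abs_def] by (rule star_representation_tensor_op_id[OF rep adj star])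
qed

lemma spectral_triple_and_plus_summable:
  fixes c1 c2 :: real
  assumes c1: "c1 \<noteq> 0"
  defines "D \<equiv> diagonal_op spinor_index_l (spinor_l q) (eigenvalue c1 c2)"
  shows "spectral_triple (A_SUq2 q) (spinor_rep q) D \<and> plus_summable 3 D"
proof -
  obtain f :: "nat \<Rightarrow> arrow \<times> real \<times> real \<times> real" where f: "bij_betw f UNIV spinor_index_l"
    and mono: "mono (\<lambda>n. \<bar>eigenvalue c1 c2 (f n)\<bar>)"
    and lim: "filterlim (\<lambda>n. \<bar>eigenvalue c1 c2 (f n)\<bar>) at_top sequentially"
  proof (rule increasing_enumeration[of spinor_index_l "\<lambda>k. \<bar>eigenvalue c1 c2 k\<bar>"])
    show "infinite spinor_index_l" by (rule infinite_spinor_index_l)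
    show "finite {k \<in> spinor_index_l. \<bar>eigenvalue c1 c2 k\<bar> \<le> r}" for r
      by (rule finite_subset[OF _ card_spinor_index_l(1)[OF c1 abs_ge_zero, of c2 r]]) auto
  qed
  obtain V W where VW: "orthonormal_basis (\<lambda>n. spinor_l q (f n)) V W"
    using spinor_l_orthonormal_basis[OF f] by blast
  have f_mem: "f n \<in> spinor_index_l" for n using f by (auto simp: bij_betw_def)
  have f_inj: "inj_on f A" for A using f by (auto simp: bij_betw_def intro: inj_on_subset)
  have D_eq: "D = diagonal_op UNIV (\<lambda>n. spinor_l q (f n)) (\<lambda>n. eigenvalue c1 c2 (f n))"
    unfolding D_def diagonal_op_reindex[OF f] by (simp add: o_def)
  interpret diagonal_dirac "\<lambda>n. spinor_l q (f n)" V W "\<lambda>n. eigenvalue c1 c2 (f n)" D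
    by (rule diagonal_dirac.intro[OF VW]) (rule eq_reflection[OF D_eq])
  have gen: "has_commutator (tensor_op (pi_gen q g) id)" for g
  proof -
    obtain t u d X Y where g: "pi_gen q g = ladder (1/2) t u d"
      and factor: "\<And>l m n. u l m n = X l n * (q powr (m / 2) * sqrt (qn (l + m + 1)))"
        "\<And>l m n. d l m n = Y l n * (q powr (m / 2) * sqrt (qn (l - m)))"
        "\<And>l m n. valid_lmn l m n \<Longrightarrow> \<bar>u l m n\<bar> \<le> 1"
        "\<And>l m n. valid_lmn l m n \<Longrightarrow> \<bar>d l m n\<bar> \<le> 1"
      by (rule pi_gen_factorized[of g]) (rule that)
    let ?T = "tensor_op (pi_gen q g) id :: spinors \<Rightarrow> spinors"
    obtain S0 where "adjoint_pair (pi_gen q g) S0" using pi_gen_adjoint_pair by blast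
    then have pair: "adjoint_pair ?T (tensor_op S0 id)" by (rule adjoint_pair_tensor_op_id)
    note lin = adjoint_pairD(1)[OF pair, unfolded g]
    obtain C where C: "\<And>k k'. k \<in> spinor_index_l \<Longrightarrow> k' \<in> spinor_index_l \<Longrightarrow>
      cmod ((complex_of_real (eigenvalue c1 c2 k') - complex_of_real (eigenvalue c1 c2 k))
        * cinner (spinor_l q k') (?T (spinor_l q k))) \<le> C"
      using commutator_matrix_bound[OF lin factor, of c1 c2] unfolding g by blast
    \<comment> \<open>Supersets of the targets and the sources of a nonzero transition: two arrows
      and two values of \<open>l\<close>, with \<open>\<mu>\<close> and \<open>n\<close> determined;
      hence at most 4 elements.\<close>
    define up where "up = (\<lambda>(s :: arrow, l :: real, \<mu> :: real, n). {Up, Down} \<times> {l + 1/2, l - 1/2} \<times> {\<mu> + 1/2} \<times> {n + t})"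
    define down where "down = (\<lambda>(s :: arrow, l :: real, \<mu> :: real, n). {Up, Down} \<times> {l + 1/2, l - 1/2} \<times> {\<mu> - 1/2} \<times> {n - t})"
    have card: "finite (up k)" "card (up k) \<le> 4" "finite (down k)" "card (down k) \<le> 4" for k
    proof -
      have "card {Up, Down} \<le> 2" "card {x, y} \<le> 2" for x y :: real
        by (simp_all add: card_insert_if)
      then have "card {Up, Down} * card {x, y} \<le> 2 * 2" for x y :: real
        by (rule mult_le_mono)
      then show "finite (up k)" "card (up k) \<le> 4" "finite (down k)" "card (down k) \<le> 4"
        by (auto simp: up_def down_def card_cartesian_product split: prod.splits)
    qed
    have nonzero: "f m \<in> up (f n)" "f n \<in> down (f m)" if "crd (?T (spinor_l q (f n))) m \<noteq> 0" for m n
    proof -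
      obtain s l \<mu> n0 s' l' \<mu>' n' where k: "f n = (s, l, \<mu>, n0)" "f m = (s', l', \<mu>', n')" by (metis prod_cases4)
      have "cinner (spinor_l q (f m)) (?T (spinor_l q (f n))) \<noteq> 0" using that by (simp add: cinner_e)
      then have "\<mu>' = \<mu> + 1/2 \<and> n' = n0 + t \<and> (l' = l + 1/2 \<or> l' = l - 1/2)"
        unfolding k g cinner_spinor_l_ladder[OF lin f_mem[of n, unfolded k] f_mem[of m, unfolded k]]
        by (auto split: if_splits)
      then show "f m \<in> up (f n)" "f n \<in> down (f m)"
        unfolding k up_def down_def by (cases s; cases s'; auto)+
    qed
    have preimage: "finite A" "card A \<le> 4" if "f ` A \<subseteq> B" "finite B" "card B \<le> 4" for A B
    proof -
      show "finite A" by (rule finite_imageD[OF finite_subset[OF that(1,2)] f_inj])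
      have "card A = card (f ` A)" by (rule card_image[OF f_inj, symmetric])
      also have "\<dots> \<le> card B" by (rule card_mono[OF that(2,1)])
      finally show "card A \<le> 4" using that(3) by simp
    qed
    have rows: "f ` {n. crd (?T (spinor_l q (f n))) m \<noteq> 0} \<subseteq> down (f m)" for m using nonzero(2) by blast
    have cols: "f ` {m. crd (?T (spinor_l q (f n))) m \<noteq> 0} \<subseteq> up (f n)" for n using nonzero(1) by blast
    show ?thesis
    proof (rule has_commutator_if_band[OF pair])
      show "cmod (complex_of_real (eigenvalue c1 c2 (f m) - eigenvalue c1 c2 (f n))
          * crd (?T (spinor_l q (f n))) m) \<le> C" for m n
        using C[OF f_mem f_mem] unfolding cinner_e of_real_diff .
    qed (rule preimage[OF rows card(3,4)] preimage[OF cols card(1,2)])+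
  qed
  let ?cl = "star_class (suq2_relations q)"
  have commutator: "has_commutator (spinor_rep q (?cl x))" for x
  proof (induction x)
    case (Gen g)
    have "pi_rep q (?cl (Gen g)) = pi_gen q g"
      unfolding pi_rep_def
      using induced_rep_star_class[of "pi_gen q", OF pi_gen_adjoint_pair pi_gen_relations] by simp
    then show ?case using gen by (simp only: spinor_rep_def)
  next
    case (Scalar c)
    \<comment> \<open>A scalar is \<open>c\<close> times the unit, so linearity of the
      representation applies.\<close>
    have "?cl (Scalar c) = ?cl (star_poly.Mult (Scalar c) (Scalar 1))"
      unfolding star_class_eq_iff
      using star_cong.sym[OF star_cong.Scalar_mult[of "suq2_relations q" c 1]] by simp
    moreover have "spinor_rep q (?cl (star_poly.Mult (Scalar c) x))
        = (\<lambda>v. c *\<^sub>C spinor_rep q (?cl x) v)" for x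
    proof -
      have "spinor_rep q (scal (A_SUq2 q) c X) = (\<lambda>v. c *\<^sub>C spinor_rep q X v)" if "X \<in> carrier (A_SUq2 q)" for X
        using star_representation_spinor_rep that unfolding star_representation_def by blast
      from this[of "?cl x"] show ?thesis
        unfolding A_SUq2_def presented_star_alg_simps by blast
    qed
    moreover have "spinor_rep q (?cl (Scalar 1)) = id"
      using star_representation_spinor_rep unfolding star_representation_def
      by (simp add: A_SUq2_def presented_star_alg_simps)
    ultimately have "spinor_rep q (?cl (Scalar c)) = (\<lambda>v. c *\<^sub>C v)" by simp
    then show ?case using has_commutator_scaleC by simp
  next
    case (Add x y)
    have "spinor_rep q (?cl (star_poly.Add x y))
      = (\<lambda>v. spinor_rep q (?cl x) v + spinor_rep q (?cl y) v)"
      using star_representation_spinor_rep unfolding star_representation_def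
      by (simp add: A_SUq2_def presented_star_alg_simps)
    then show ?case using has_commutator_add[OF Add.IH] by simp
  next
    case (Mult x y)
    have "spinor_rep q (?cl (star_poly.Mult x y))
      = spinor_rep q (?cl x) \<circ> spinor_rep q (?cl y)"
      using star_representation_spinor_rep unfolding star_representation_def
      by (simp add: A_SUq2_def presented_star_alg_simps)
    then show ?case using has_commutator_compose[OF Mult.IH] by (simp only:)
  next
    case (Star x)
    have "adjoint_pair (spinor_rep q (?cl x)) (spinor_rep q (?cl (star_poly.Star x)))"
      using star_representation_spinor_rep unfolding star_representation_def adjoint_pair_def
      by (simp add: A_SUq2_def presented_star_alg_simps)
    then show ?case by (rule has_commutator_adjoint[OF Star.IH])
  qed
  have "spectral_triple (A_SUq2 q) (spinor_rep q) D"
    unfolding spectral_triple_def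
  proof (intro conjI ballI)
    show "star_algebra (A_SUq2 q)" unfolding A_SUq2_def by (rule presented_star_algebra)
    show "star_representation (A_SUq2 q) (spinor_rep q)" by (rule star_representation_spinor_rep)
    show "Defs.selfadjoint D" by (rule selfadjoint)
    show "Defs.compact_resolvent D" by (rule compact_resolvent[OF lim])
    fix X assume "X \<in> carrier (A_SUq2 q)"
    then obtain x where "X = star_class (suq2_relations q) x"
      unfolding A_SUq2_def presented_star_alg_simps(1) by blast
    then show "commutator_bounded D (spinor_rep q X)"
      using has_commutator_imp_commutator_bounded[OF commutator] by simp
  qed
  moreover have "Defs.plus_summable 3 D"
  proof (rule plus_summable[OF lim mono])
    show "real n \<le> (4 * (2 * ((1 + \<bar>c2\<bar>) / \<bar>c1\<bar>) + 3) * sqrt (1 + (eigenvalue c1 c2 (f n))\<^sup>2)) powr 3" for n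
    proof -
      let ?r = "\<bar>eigenvalue c1 c2 (f n)\<bar>"
      \<comment> \<open>By monotonicity the first \<open>n\<close> enumerated indices lie in the
        sublevel set of the eigenvalue at \<open>f n\<close>, so this set has at least
        \<open>n\<close> elements.\<close>
      have "f ` {..<n} \<subseteq> {k \<in> spinor_index_l. \<bar>eigenvalue c1 c2 k\<bar> \<le> ?r}"
        using f_mem monoD[OF mono, of _ n] by auto
      from card_mono[OF card_spinor_index_l(1)[OF c1 abs_ge_zero] this]
      have "n \<le> card {k \<in> spinor_index_l. \<bar>eigenvalue c1 c2 k\<bar> \<le> ?r}"
        by (simp add: card_image[OF f_inj])
      then have "real n \<le> real (card {k \<in> spinor_index_l. \<bar>eigenvalue c1 c2 k\<bar> \<le> ?r})" by simp
      also have "\<dots> \<le> (4 * (2 * ((1 + \<bar>c2\<bar>) / \<bar>c1\<bar>) + 3) * sqrt (1 + ?r\<^sup>2)) powr 3"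
        by (rule spinor_index_l_growth[OF c1 abs_ge_zero])
      finally show ?thesis by simp
    qed
  qed simp_all
  ultimately show ?thesis ..
qed

end

theorem theorem5p3:
  fixes q c1_up c2_up c1_down c2_down :: real
  assumes "0 < q" and "q < 1"
    and "c1_up \<noteq> 0"
    and "c1_down = - c1_up"
    and "c2_down = - c2_up + c1_up"
  shows "spectral_triple (A_SUq2 q) (spinor_rep q) (dirac q c1_up c2_up c1_down c2_down)
    \<and> plus_summable 3 (dirac q c1_up c2_up c1_down c2_down)"
  unfolding assms(4,5) dirac_eq by (rule suq2.spectral_triple_and_plus_summable[OF suq2.intro[OF assms(1,2)] assms(3)])

end
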